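(* Let $V$ be a complex Hilbert space and $\mathfrak{a}:V\times V\to\mathbb{C}$ a bounded, coercive, sectorial sesquilinear form whose real part equals the inner product of $V$, i.e. $\Re\mathfrak{a}(u,v)=\langle u,v\rangle_V$ for all $u,v\in V$. Let $H$ be a Hilbert space into which $V$ is densely and continuously embedded, and let $T,Q\in\mathcal{L}(V)$ be the selfadjoint operators associated with $(\mathfrak{a},H)$ (see context). Then the following assertions are equivalent: (i) $(\mathfrak{a},H)$ has the Kato property. (ii) There exist a positive operator $S$ on $V$ and some $\theta<\frac{\pi}{2}$ such that $\langle QS(I+iT)u,u\rangle_V\in\Sigma_\theta$ for every $u\in V$. (ii') There exists a positive operator $S$ on $V$ such that $\Re\langle QS(I+iT)u,u\rangle_V\ge 0$ for every $u\in V$. (iii) There exist a positive operator $S$ on $V$ and some $\theta<\frac{\pi}{2}$ such that $\langle S(I-iT)^{-1}Qu,u\rangle_V\in\Sigma_\theta$ for every $u\in V$; that is, $(I-iT)^{-1}Q$ is similar to a $\theta$-accretive operator, or, equivalently, $(I-iT)^{-1}Q$ has a bounded $H^\infty(\Sigma_\theta)$ functional calculus. (iv) There exist a positive operator $S$ on $V$ and some $\theta<\frac{\pi}{2}$ such that $\langle SQ(I+iT)^{-1}u,u\rangle_V\in\Sigma_\theta$ for every $u\in V$; that is, $Q(I+iT)^{-1}$ is similar to a $\theta$-accretive operator, or, equivalently, $Q(I+iT)^{-1}$ has a bounded $H^\infty(\Sigma_\theta)$ functional calculus. (v) The operator $(I-Q+iT)(I+Q+iT)^{-1}$ is polynomially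 bounded. (vi) The operator $(I-Q+iT)(I+Q+iT)^{-1}$ is similar to a contraction.
   Context: For a sesquilinear form $\mathfrak{a}$ on $V$, $\mathfrak{a}^*(u,v):=\overline{\mathfrak{a}(v,u)}$, $\Re\mathfrak{a}:=(\mathfrak{a}+\mathfrak{a}^* )/2$, $\Im\mathfrak{a}:=(\mathfrak{a}-\mathfrak{a}^* )/(2i)$. Coercive means $\Re\mathfrak{a}(u,u)\ge\eta\|u\|_V^2$ for some $\eta>0$ and all $u$; sectorial means $|\Im\mathfrak{a}(u,u)|\le\beta\,\Re\mathfrak{a}(u,u)$ for some $\beta\ge0$ and all $u$. The embedding is a bounded injective linear map $j:V\to H$ with dense range; $V$ is identified with $j(V)$. The associated operators $T,Q\in\mathcal{L}(V)$ are the unique selfadjoint operators with $\Im\mathfrak{a}(u,v)=\langle Tu,v\rangle_V$ and $\langle ju,jv\rangle_H=\langle Qu,v\rangle_V$ for all $u,v\in V$; thus $\mathfrak{a}(u,v)=\langle (I+iT)u,v\rangle_V$ and $Q$ is nonnegative and injective. The operator $L_H$ on $H$ is defined by $\mathcal{D}(L_H)=\{u\in j(V):\exists f\in H\ \forall v\in V:\ \mathfrak{a}(j^{-1}u,v)=\langle f,jv\rangle_H\}$, $L_Hu:=f$; it is a sectorial, invertible operator, and its square root $L_H^{1/2}$ is defined by the usual functional calculus of sectorial operators. The pair $(\mathfrak{a},H)$ has the Kato property if $\mathcal{D}(L_H^{1/2})=j(V)$. $\Sigma_\theta:=\{z\in\mathbb{C}:|\arg z|\le\theta\}$. A (bounded)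 operator $B$ on a Hilbert space is $\theta$-accretive if $\langle Bu,u\rangle\in\Sigma_\theta$ for all $u$. A positive operator $S$ on $V$ means a bounded selfadjoint operator with $\langle Su,u\rangle_V\ge c\|u\|_V^2$ for some $c>0$ (so it defines an equivalent inner product). A bounded operator $C$ is polynomially bounded if there is $M\ge0$ with $\|p(C)\|\le M\sup_{|z|\le1}|p(z)|$ for all polynomials $p$. *)

theory Defs
  imports "HOL-Analysis.Analysis" "HOL-Computational_Algebra.Polynomial"
begin

class complex_vector = real_vector +
  fixes scaleC :: "complex \<Rightarrow> 'a \<Rightarrow> 'a" (infixr \<open>*\<^sub>C\<close> 75)
  assumes scaleC_add_right: "a *\<^sub>C (x + y) = a *\<^sub>C x + a *\<^sub>C y"
    and scaleC_add_left: "(a + b) *\<^sub>C x = a *\<^sub>C x + b *\<^sub>C x"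
    and scaleC_scaleC: "a *\<^sub>C (b *\<^sub>C x) = (a * b) *\<^sub>C x"
    and scaleC_one: "1 *\<^sub>C x = x"
    and scaleR_scaleC: "r *\<^sub>R x = complex_of_real r *\<^sub>C x"

class complex_inner = complex_vector + real_normed_vector +
  fixes cinner :: "'a \<Rightarrow> 'a \<Rightarrow> complex"
  assumes cinner_commute: "cinner x y = cnj (cinner y x)"
    and cinner_add_left: "cinner (x + y) z = cinner x z + cinner y z"
    and cinner_scaleC_left: "cinner (r *\<^sub>C x) y = r * cinner x y"
    and cinner_ge_zero: "0 \<le> Re (cinner x x)"
    and cinner_eq_zero_iff: "cinner x x = 0 \<longleftrightarrow> x = 0"
    and norm_eq_sqrt_cinner: "norm x = sqrt (Re (cinner x x))"

class chilbert_space = complex_inner + complete_space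

definition clinear :: "('a::complex_vector \<Rightarrow> 'b::complex_vector) \<Rightarrow> bool" where
  "clinear f \<longleftrightarrow> (\<forall>x y. f (x + y) = f x + f y) \<and> (\<forall>c x. f (c *\<^sub>C x) = c *\<^sub>C f x)"

definition cbounded_linear :: "('a::complex_inner \<Rightarrow> 'b::complex_inner) \<Rightarrow> bool" where
  "cbounded_linear f \<longleftrightarrow> clinear f \<and> (\<exists>K. \<forall>x. norm (f x) \<le> norm x * K)"

definition selfadjoint_op :: "('a::complex_inner \<Rightarrow> 'a) \<Rightarrow> bool" where
  "selfadjoint_op T \<longleftrightarrow> cbounded_linear T \<and> (\<forall>u v. cinner (T u) v = cinner u (T v))"

text \<open>Positive operator: bounded selfadjoint, bounded below (defines an equivalent inner product).\<close>
definition positive_op :: "('a::complex_inner \<Rightarrow> 'a) \<Rightarrow> bool" where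
  "positive_op S \<longleftrightarrow> selfadjoint_op S \<and> (\<exists>c>0. \<forall>u. Re (cinner (S u) u) \<ge> c * (norm u)\<^sup>2)"

text \<open>Closed sector of half-angle theta (with Arg 0 = 0).\<close>
definition sector :: "real \<Rightarrow> complex set" where
  "sector \<theta> = {z. \<bar>Arg z\<bar> \<le> \<theta>}"

definition poly_op :: "complex poly \<Rightarrow> ('a::complex_vector \<Rightarrow> 'a) \<Rightarrow> 'a \<Rightarrow> 'a" where
  "poly_op p C x = (\<Sum>i\<le>degree p. coeff p i *\<^sub>C (C ^^ i) x)"

definition polynomially_bounded :: "('a::complex_inner \<Rightarrow> 'a) \<Rightarrow> bool" where
  "polynomially_bounded C \<longleftrightarrow> (\<exists>M\<ge>0. \<forall>p x.
      norm (poly_op p C x) \<le> M * (SUP z\<in>cball 0 1. cmod (poly p z)) * norm x)"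

definition similar_to_contraction :: "('a::complex_inner \<Rightarrow> 'a) \<Rightarrow> bool" where
  "similar_to_contraction C \<longleftrightarrow> (\<exists>S R :: 'a \<Rightarrow> 'a. cbounded_linear S \<and> cbounded_linear R \<and>
      (\<forall>x. S (R x) = x) \<and> (\<forall>x. R (S x) = x) \<and> (\<forall>x. norm (S (C (R x))) \<le> norm x))"

definition sesquilinear :: "('a::complex_vector \<Rightarrow> 'a \<Rightarrow> complex) \<Rightarrow> bool" where
  "sesquilinear a \<longleftrightarrow>
     (\<forall>x y z. a (x + y) z = a x z + a y z) \<and> (\<forall>c x y. a (c *\<^sub>C x) y = c * a x y) \<and>
     (\<forall>x y z. a x (y + z) = a x y + a x z) \<and> (\<forall>c x y. a x (c *\<^sub>C y) = cnj c * a x y)"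

definition bounded_form :: "('a::complex_inner \<Rightarrow> 'a \<Rightarrow> complex) \<Rightarrow> bool" where
  "bounded_form a \<longleftrightarrow> (\<exists>M. \<forall>u v. cmod (a u v) \<le> M * norm u * norm v)"

definition form_adj :: "('a \<Rightarrow> 'a \<Rightarrow> complex) \<Rightarrow> 'a \<Rightarrow> 'a \<Rightarrow> complex" where
  "form_adj a u v = cnj (a v u)"

definition form_re :: "('a \<Rightarrow> 'a \<Rightarrow> complex) \<Rightarrow> 'a \<Rightarrow> 'a \<Rightarrow> complex" where
  "form_re a u v = (a u v + form_adj a u v) / 2"

definition form_im :: "('a \<Rightarrow> 'a \<Rightarrow> complex) \<Rightarrow> 'a \<Rightarrow> 'a \<Rightarrow> complex" where
  "form_im a u v = (a u v - form_adj a u v) / (2 * \<i>)"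

definition coercive_form :: "('a::complex_inner \<Rightarrow> 'a \<Rightarrow> complex) \<Rightarrow> bool" where
  "coercive_form a \<longleftrightarrow> (\<exists>\<eta>>0. \<forall>u. Re (form_re a u u) \<ge> \<eta> * (norm u)\<^sup>2)"

definition sectorial_form :: "('a::complex_inner \<Rightarrow> 'a \<Rightarrow> complex) \<Rightarrow> bool" where
  "sectorial_form a \<longleftrightarrow> (\<exists>\<beta>\<ge>0. \<forall>u. cmod (form_im a u u) \<le> \<beta> * Re (form_re a u u))"

definition dense_embedding :: "('v::complex_inner \<Rightarrow> 'h::complex_inner) \<Rightarrow> bool" where
  "dense_embedding j \<longleftrightarrow> cbounded_linear j \<and> inj j \<and> closure (range j) = UNIV"

definition formop_dom :: "('v \<Rightarrow> 'v \<Rightarrow> complex) \<Rightarrow> ('v \<Rightarrow> 'h::complex_inner) \<Rightarrow> 'h set" where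
  "formop_dom a j = {h. \<exists>u f. h = j u \<and> (\<forall>v. a u v = cinner f (j v))}"

definition formop :: "('v \<Rightarrow> 'v \<Rightarrow> complex) \<Rightarrow> ('v \<Rightarrow> 'h::complex_inner) \<Rightarrow> 'h \<Rightarrow> 'h" where
  "formop a j h = (THE f. \<forall>v. a (inv j h) v = cinner f (j v))"

definition formop_resolvent ::
    "('v \<Rightarrow> 'v \<Rightarrow> complex) \<Rightarrow> ('v \<Rightarrow> 'h::complex_inner) \<Rightarrow> real \<Rightarrow> 'h \<Rightarrow> 'h" where
  "formop_resolvent a j t f = (THE h. h \<in> formop_dom a j \<and> t *\<^sub>R h + formop a j h = f)"

text \<open>L_H^{-1/2} via the functional calculus (Balakrishnan representation for the
invertible sectorial operator L_H): L^{-1/2} f = (1/pi) \<integral>_0^\<infinity> t^{-1/2} (t+L)^{-1} f dt.\<close>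
definition formop_inv_sqrt ::
    "('v \<Rightarrow> 'v \<Rightarrow> complex) \<Rightarrow> ('v \<Rightarrow> 'h::chilbert_space) \<Rightarrow> 'h \<Rightarrow> 'h" where
  "formop_inv_sqrt a j f =
     (1 / pi) *\<^sub>R integral {0<..} (\<lambda>t. (t powr (-1/2)) *\<^sub>R formop_resolvent a j t f)"

text \<open>D(L_H^{1/2}) = range of L_H^{-1/2}, since L_H^{1/2} = (L_H^{-1/2})^{-1}.\<close>
definition formop_sqrt_dom :: "('v \<Rightarrow> 'v \<Rightarrow> complex) \<Rightarrow> ('v \<Rightarrow> 'h::chilbert_space) \<Rightarrow> 'h set" where
  "formop_sqrt_dom a j = range (formop_inv_sqrt a j)"

definition kato_property :: "('v \<Rightarrow> 'v \<Rightarrow> complex) \<Rightarrow> ('v \<Rightarrow> 'h::chilbert_space) \<Rightarrow> bool" where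
  "kato_property a j \<longleftrightarrow> formop_sqrt_dom a j = range j"

end

theory Submission
  imports Defs
begin

text \<open>Write \<open>A = I + iT\<close>, let \<open>j\<^sup>*\<close> be the adjoint of the embedding, \<open>Q = j\<^sup>* j\<close>, and
  \<open>U t = (A + t Q)\<^sup>-\<^sup>1\<close>. Then \<open>(t + L)\<^sup>-\<^sup>1 = j (U t) j\<^sup>*\<close> on \<open>H\<close>, and the same operator restricted to \<open>V\<close>
  is \<open>(U t) Q\<close>. Put \<open>D = L\<^sup>-\<^sup>1\<^sup>/\<^sup>2\<close> and \<open>X = Q A\<^sup>-\<^sup>1\<close>; the operator in (v) and (vi) is the Cayley transform
  of \<open>X\<close>.

  The conditions (ii), (iii), (iv) are equivalent by taking adjoints and replacing \<open>S\<close> by its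
  inverse, and (ii') says that \<open>X\<close> is accretive for the inner product given by \<open>S\<close>, i.e. that its
  Cayley transform is contractive for it; with the square root of \<open>S\<close> this is (vi), and (v) follows
  by von Neumann's inequality. If the Kato property holds, \<open>j\<^sup>-\<^sup>1 D\<close> is an isomorphism that carries the
  sectorial operator \<open>L\<^sup>-\<^sup>1\<close> on \<open>H\<close> to \<open>A\<^sup>-\<^sup>1 Q\<close>, which is similar to \<open>X\<close>; this gives (iv).

  From (v) to the Kato property: the functions \<open>\<Sum> \<plusminus> t\<^sub>k z / (1 + t\<^sub>k z)\<^sup>2\<close>, \<open>t\<^sub>k = 4\<^sup>k t\<^sub>0\<close>, are uniformly
  bounded on the right half plane, so polynomial boundedness and a choice of signs give the square
  function estimate \<open>\<integral> \<parallel>t X (1 + t X)\<^sup>-\<^sup>2 v\<parallel>\<^sup>2 dt/t \<le> M \<parallel>v\<parallel>\<^sup>2\<close> in \<open>V\<close>, and its adjoint version. In \<open>H\<close> the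
  energy identity for \<open>t (t + L)\<^sup>-\<^sup>1 f\<close> gives \<open>\<integral> t\<^sup>2 \<parallel>(t + L)\<^sup>-\<^sup>2 f\<parallel>\<^sub>V\<^sup>2 dt \<le> \<parallel>f\<parallel>\<^sub>H\<^sup>2 / 2\<close>. Integrating
  Balakrishnan's formula by parts so that \<open>(t + L)\<^sup>-\<^sup>1\<close> becomes \<open>t\<^sup>2 L (t + L)\<^sup>-\<^sup>4\<close> and pairing the two
  estimates by Cauchy--Schwarz shows that \<open>L\<^sup>-\<^sup>1\<^sup>/\<^sup>2\<close> is bounded from \<open>H\<close> to \<open>V\<close> and \<open>L\<^sup>1\<^sup>/\<^sup>2\<close> from \<open>V\<close> to \<open>H\<close>.\<close>

text \<open>The energy estimate holds for every form, and abstract forms can fail the Kato property.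
  The missing information must enter through V, which is why the pairing joins one factor from H
  with one square function in V. The bound for L^(-1/2) uses the adjoint square function, the bound
  for L^(1/2) the direct one. Polynomial boundedness speaks of polynomials, while the functions
  needed are rational. They are replaced by Taylor truncations, whose remainders vanish because (t -
  1)/(t + 1) is less than 1 and the powers of the Cayley transform are bounded. The square root is
  given only by an integral of resolvents. That it squares to L^(-1) is shown by shifting the
  resolvent parameter to infinity rather than through a double integral. The same result with the
  identity as embedding gives the square root of a positive operator. The Kato property is only an
  equality of ranges; the boundedness of the isomorphism that it induces comes from a closed graph
  argument tested on adjoints.\<close>

instance chilbert_space \<subseteq> banach ..

section \<open>Complex inner product spaces\<close>

lemma cinner_scaleC_right:
  "cinner x (r *\<^sub>C y) = cnj r * cinner (x::'a::complex_inner) y"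
  by (metis cinner_commute cinner_scaleC_left complex_cnj_mult)

lemma cinner_add_right:
  "cinner (x::'a::complex_inner) (y + z) = cinner x y + cinner x z"
  by (metis cinner_add_left cinner_commute complex_cnj_add)

lemma cinner_scaleR_left:
  "cinner (r *\<^sub>R x) y = r *\<^sub>R cinner (x::'a::complex_inner) y"
  by (simp add: scaleR_scaleC cinner_scaleC_left scaleR_conv_of_real)

lemma cinner_scaleR_right:
  "cinner x (r *\<^sub>R y) = r *\<^sub>R cinner (x::'a::complex_inner) y"
  by (simp add: scaleR_scaleC cinner_scaleC_right scaleR_conv_of_real)

lemma Im_cinner_self: "Im (cinner x (x::'a::complex_inner)) = 0"
  using arg_cong[OF cinner_commute[of x x], of Im] by simp

lemma cinner_self_Re: "Re (cinner x (x::'a::complex_inner)) = (norm x)\<^sup>2"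
  by (simp add: norm_eq_sqrt_cinner cinner_ge_zero)

lemma cinner_self: "cinner x (x::'a::complex_inner) = complex_of_real ((norm x)\<^sup>2)"
  by (rule complex_eqI) (simp_all add: cinner_self_Re Im_cinner_self)

lemma Re_cinner_commute: "Re (cinner x y) = Re (cinner y (x::'a::complex_inner))"
  by (subst cinner_commute) simp

lemma norm_add_square:
  "(norm (x + y))\<^sup>2 = (norm x)\<^sup>2 + 2 * Re (cinner x y) + (norm (y::'a::complex_inner))\<^sup>2"
  unfolding cinner_self_Re[symmetric]
  by (simp add: cinner_add_left cinner_add_right Re_cinner_commute[of y x])

lemma cinner_Cauchy_Schwarz: "cmod (cinner x y) \<le> norm x * norm (y::'a::complex_inner)"
proof (cases "cinner x y = 0")
  case False
  \<comment> \<open>A phase that turns y so that its inner product with x becomes real and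
    nonnegative; the real quadratic argument then applies.\<close>
  define e where "e = cinner x y / complex_of_real (cmod (cinner x y))"
  have e: "cnj e * cinner x y = complex_of_real (cmod (cinner x y))"
    using False by (simp add: e_def complex_norm_square[symmetric] power2_eq_square field_simps)
  have "cmod e = 1"
    using False by (simp add: e_def norm_divide)
  define y' where "y' = e *\<^sub>C y"
  have nz: "norm y' = norm y"
  proof -
    have "(norm y')\<^sup>2 = (norm y)\<^sup>2"
    proof -
      have "cinner y' y' = (e * cnj e) * cinner y y"
        by (simp add: y'_def cinner_scaleC_left cinner_scaleC_right)
      also have "e * cnj e = 1"
        using \<open>cmod e = 1\<close> by (simp add: complex_norm_square[symmetric])
      finally show ?thesis
        by (simp add: cinner_self_Re[symmetric])
    qed
    thus ?thesis by simp
  qed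
  have re: "Re (cinner x y') = cmod (cinner x y)"
    unfolding y'_def cinner_scaleC_right e by simp
  show ?thesis
  proof (cases "x = 0")
    case True
    have "cinner 0 y = 0"
      using cinner_add_left[of 0 0 y] by simp
    with True False show ?thesis by simp
  next
    case xn: False
    \<comment> \<open>The minimiser of the squared norm of t x + y' over real t.\<close>
    define t where "t = - Re (cinner x y') / (norm x)\<^sup>2"
    have "0 \<le> (norm (t *\<^sub>R x + y'))\<^sup>2" by simp
    also have "\<dots> = t\<^sup>2 * (norm x)\<^sup>2 + 2 * t * Re (cinner x y') + (norm y')\<^sup>2"
      unfolding norm_add_square by (simp add: cinner_scaleR_left power_mult_distrib)
    also have "\<dots> = (norm y')\<^sup>2 - (Re (cinner x y'))\<^sup>2 / (norm x)\<^sup>2"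
      using xn by (simp add: t_def field_simps power2_eq_square)
    finally have "(Re (cinner x y'))\<^sup>2 \<le> (norm x * norm y')\<^sup>2"
      using xn by (simp add: field_simps power_mult_distrib)
    hence "Re (cinner x y') \<le> norm x * norm y'"
      by (rule power2_le_imp_le) simp
    with nz re show ?thesis by simp
  qed
qed simp

lemma bounded_bilinear_cinner: "bounded_bilinear (cinner :: 'a::complex_inner \<Rightarrow> 'a \<Rightarrow> complex)"
  by (rule bounded_bilinear.intro)
    (auto simp: cinner_add_left cinner_add_right cinner_scaleR_left cinner_scaleR_right
      intro!: exI[of _ 1] cinner_Cauchy_Schwarz)

interpretation cinner: bounded_bilinear "cinner :: 'a::complex_inner \<Rightarrow> 'a \<Rightarrow> complex"
  by (rule bounded_bilinear_cinner)

lemma Re_cinner_le: "\<bar>Re (cinner x y)\<bar> \<le> norm x * norm (y::'a::complex_inner)"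
  using cinner_Cauchy_Schwarz[of x y] abs_Re_le_cmod order_trans by blast

lemma cinner_ext_left:
  assumes "\<And>v. cinner x v = cinner (y::'a::complex_inner) v" shows "x = y"
proof -
  have "cinner (x - y) (x - y) = 0"
    using assms by (simp add: cinner.diff_left)
  thus ?thesis by (simp add: cinner_eq_zero_iff)
qed

lemma norm_diff_square:
  "(norm (x - y))\<^sup>2 = (norm x)\<^sup>2 - 2 * Re (cinner x y) + (norm (y::'a::complex_inner))\<^sup>2"
  using norm_add_square[of x "- y"] by (simp add: cinner.minus_right)

lemma norm_scaleC: "norm (c *\<^sub>C x) = cmod c * norm (x::'a::complex_inner)"
proof -
  have "cinner (c *\<^sub>C x) (c *\<^sub>C x) = (c * cnj c) * cinner x x"
    by (simp add: cinner_scaleC_left cinner_scaleC_right)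
  hence "(norm (c *\<^sub>C x))\<^sup>2 = (cmod c * norm x)\<^sup>2"
    unfolding cinner_self complex_norm_square[symmetric]
    by (metis of_real_eq_iff of_real_mult of_real_power power_mult_distrib)
  thus ?thesis by simp
qed

lemma bounded_bilinear_scaleC:
  "bounded_bilinear (scaleC :: complex \<Rightarrow> 'a::complex_inner \<Rightarrow> 'a)"
  by (rule bounded_bilinear.intro)
    (auto simp: scaleC_add_left scaleC_add_right scaleR_scaleC scaleC_scaleC norm_scaleC mult.commute
      scaleR_conv_of_real intro!: exI[of _ 1])

interpretation scaleC: bounded_bilinear "scaleC :: complex \<Rightarrow> 'a::complex_inner \<Rightarrow> 'a"
  by (rule bounded_bilinear_scaleC)

lemma norm_le_by_cinner:
  assumes "\<And>w. norm w \<le> 1 \<Longrightarrow> cmod (cinner x w) \<le> M" and "0 \<le> M"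
  shows "norm (x::'a::complex_inner) \<le> M"
proof (cases "x = 0")
  case False
  have "cmod (cinner x (inverse (norm x) *\<^sub>R x)) \<le> M"
    by (rule assms(1)) (simp add: False)
  moreover have "cmod (cinner x (inverse (norm x) *\<^sub>R x)) = norm x"
    using False by (simp add: cinner.scaleR_right cinner_self norm_mult power2_eq_square)
  ultimately show ?thesis by simp
qed (use assms in auto)

lemma cbounded_linearI:
  assumes "\<And>x y. f (x + y) = f x + f y" and "\<And>c x. f (c *\<^sub>C x) = c *\<^sub>C f x"
    and "\<And>x. norm (f x) \<le> norm x * M"
  shows "cbounded_linear f"
  using assms by (auto simp: cbounded_linear_def clinear_def)

lemma cbounded_linear_scaleC: "cbounded_linear f \<Longrightarrow> f (c *\<^sub>C x) = c *\<^sub>C f x"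
  by (simp add: cbounded_linear_def clinear_def)

lemma cbounded_linear_bounded_linear:
  assumes "cbounded_linear f" shows "bounded_linear f"
proof -
  obtain M where "\<And>x. norm (f x) \<le> norm x * M"
    using assms by (auto simp: cbounded_linear_def)
  thus ?thesis
    using assms by (intro bounded_linear_intro[of f M])
      (auto simp: cbounded_linear_def clinear_def scaleR_scaleC)
qed

lemma cbounded_linear_pos_bound:
  assumes "cbounded_linear f"
  obtains M where "M > 0" "\<And>x. norm (f x) \<le> M * norm x"
  using bounded_linear.pos_bounded[OF cbounded_linear_bounded_linear[OF assms]]
  by (auto simp: mult.commute)

lemma cbounded_linear_iff:
  "cbounded_linear f \<longleftrightarrow> bounded_linear f \<and> (\<forall>c x. f (c *\<^sub>C x) = c *\<^sub>C f x)"
  by (metis cbounded_linear_bounded_linear cbounded_linear_def clinear_def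
      bounded_linear.bounded linear_simps(1))

lemma cbounded_linear_compose:
  assumes "cbounded_linear f" "cbounded_linear g"
  shows "cbounded_linear (\<lambda>x. f (g x))"
  using assms by (auto simp: cbounded_linear_iff intro: bounded_linear_compose)

lemma cbounded_linear_add:
  assumes "cbounded_linear f" "cbounded_linear g"
  shows "cbounded_linear (\<lambda>x. f x + g x)"
  using assms by (auto simp: cbounded_linear_iff scaleC_add_right intro: bounded_linear_add)

lemma cbounded_linear_diff:
  assumes "cbounded_linear f" "cbounded_linear g"
  shows "cbounded_linear (\<lambda>x. f x - g x)"
  using assms by (auto simp: cbounded_linear_iff scaleC.diff_right intro: bounded_linear_sub)

lemma cbounded_linear_scaled:
  assumes "cbounded_linear f" shows "cbounded_linear (\<lambda>x. c *\<^sub>C f x)"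
  using assms by (auto simp: cbounded_linear_iff scaleC_scaleC mult.commute
      intro: bounded_linear_compose[OF scaleC.bounded_linear_right])

lemma cbounded_linear_scaledR:
  assumes "cbounded_linear f" shows "cbounded_linear (\<lambda>x. c *\<^sub>R f x)"
  using cbounded_linear_scaled[OF assms, of "complex_of_real c"] by (simp add: scaleR_scaleC)

lemma cbounded_linear_ident: "cbounded_linear (\<lambda>x. x)"
  by (auto simp: cbounded_linear_iff)

lemma cbounded_linear_inv:
  assumes f: "cbounded_linear f" and bij: "bij f" and bd: "\<And>x. norm x \<le> M * norm (f x)"
  shows "cbounded_linear (inv f)"
proof (rule cbounded_linearI[where M = M])
  have fi: "f (inv f y) = y" for y
    using bij by (simp add: bij_is_surj surj_f_inv_f)
  have iff: "inv f y = x \<longleftrightarrow> y = f x" for x y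
    using bij fi by (metis bij_inv_eq_iff)
  interpret f: bounded_linear f by (rule cbounded_linear_bounded_linear[OF f])
  show "inv f (x + y) = inv f x + inv f y" for x y
    by (simp add: iff f.add fi)
  show "inv f (c *\<^sub>C x) = c *\<^sub>C inv f x" for c x
    by (simp add: iff cbounded_linear_scaleC[OF f] fi)
  show "norm (inv f x) \<le> norm x * M" for x
    using bd[of "inv f x"] by (simp add: fi mult.commute)
qed

section \<open>Hilbert spaces\<close>

text \<open>The subspace may fail to be closed, so the representing vector lies in its closure. In
  this form one minimisation yields both the Riesz theorem and the density criterion
  \<open>dense_range\<close>.\<close>

lemma Riesz_representation_subspace:
  fixes \<phi> :: "'a::chilbert_space \<Rightarrow> complex"
  assumes W: "W \<noteq> {}" "\<And>x y. x \<in> W \<Longrightarrow> y \<in> W \<Longrightarrow> x + y \<in> W" "\<And>c x. x \<in> W \<Longrightarrow> c *\<^sub>C x \<in> W"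
    and add: "\<And>x y. \<phi> (x + y) = \<phi> x + \<phi> y" and sc: "\<And>c x. \<phi> (c *\<^sub>C x) = c * \<phi> x"
    and bd: "\<And>x. cmod (\<phi> x) \<le> M * norm x"
  shows "\<exists>z\<in>closure W. \<forall>x\<in>W. \<phi> x = cinner x z"
proof -
  have WR: "r *\<^sub>R x \<in> W" if "x \<in> W" for r x using W(3)[OF that] by (simp add: scaleR_scaleC)
  \<comment> \<open>the representing vector minimises this quadratic functional\<close>
  define J where "J x = (norm x)\<^sup>2 - 2 * Re (\<phi> x)" for x
  have sR: "\<phi> (r *\<^sub>R x) = r *\<^sub>R \<phi> x" for r x
    by (simp add: scaleR_scaleC sc scaleR_conv_of_real)
  have lower: "J x \<ge> - M\<^sup>2" for x
  proof -
    have "Re (\<phi> x) \<le> M * norm x"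
      using bd[of x] complex_Re_le_cmod order_trans by blast
    moreover have "(norm x)\<^sup>2 - 2 * (M * norm x) + M\<^sup>2 = (norm x - M)\<^sup>2"
      by (simp add: power2_diff)
    ultimately show ?thesis
      unfolding J_def using zero_le_power2[of "norm x - M"] by linarith
  qed
  define m where "m = Inf (J ` W)"
  have bdd: "bdd_below (J ` W)"
    using lower by (intro bdd_belowI[of _ "- M\<^sup>2"]) auto
  have mJ: "m \<le> J x" if "x \<in> W" for x
    unfolding m_def using that by (intro cInf_lower[OF _ bdd]) simp
  have "\<exists>x\<in>W. J x < m + 1 / real (Suc n)" for n
  proof -
    have "Inf (J ` W) < m + 1 / real (Suc n)"
      unfolding m_def by simp
    thus ?thesis using cInf_lessD[of "J ` W" "m + 1 / real (Suc n)"] W(1) by auto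
  qed
  then obtain X where XW: "\<And>n. X n \<in> W" and X: "\<And>n. J (X n) < m + 1 / real (Suc n)" by metis
  \<comment> \<open>The parallelogram law, in which the linear part of \<open>J\<close> cancels. It
    makes a minimising sequence Cauchy.\<close>
  have para: "(norm (x - y))\<^sup>2 / 2 = J x + J y - 2 * J ((1/2) *\<^sub>R (x + y))" for x y
    unfolding J_def sR add
    by (simp add: norm_diff_square power_divide)
      (simp add: field_simps norm_add_square)
  have para': "(norm (X n - X k))\<^sup>2 \<le> 2 / real (Suc n) + 2 / real (Suc k)" for n k
    using para[of "X n" "X k"] X[of n] X[of k] mJ[OF WR[OF W(2)[OF XW[of n] XW[of k]]], of "1/2"] by simp
  have "Cauchy X"
  proof (rule metric_CauchyI)
    fix e :: real assume e: "e > 0"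
    obtain N where N: "real (Suc N) > 4 / e\<^sup>2"
      by (meson less_le_trans of_nat_le_iff reals_Archimedean2 lessI less_imp_le)
    show "\<exists>M. \<forall>m\<ge>M. \<forall>n\<ge>M. dist (X m) (X n) < e"
    proof (intro exI allI impI)
      fix n k assume nk: "n \<ge> N" "k \<ge> N"
      have "2 / real (Suc n) \<le> 2 / real (Suc N)" "2 / real (Suc k) \<le> 2 / real (Suc N)"
        using nk by (auto intro!: divide_left_mono)
      with para'[of n k] have "(norm (X n - X k))\<^sup>2 \<le> 4 / real (Suc N)" by simp
      also have "\<dots> < e\<^sup>2"
        using N e by (simp add: field_simps)
      finally show "dist (X n) (X k) < e"
        using e by (simp add: dist_norm power2_less_imp_less)
    qed
  qed
  then obtain z where z: "X \<longlonglongrightarrow> z"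
    using Cauchy_convergent_iff convergent_def by blast
  have blphi: "bounded_linear \<phi>"
    using add sR bd by (intro bounded_linear_intro[of _ M]) (auto simp: mult.commute)
  have "(\<lambda>n. J (X n)) \<longlonglongrightarrow> J z"
    unfolding J_def by (intro tendsto_intros z bounded_linear.tendsto[OF blphi])
  moreover have "(\<lambda>n. J (X n)) \<longlonglongrightarrow> m"
  proof (rule tendsto_sandwich)
    show "\<forall>\<^sub>F n in sequentially. m \<le> J (X n)" using mJ XW by simp
    show "\<forall>\<^sub>F n in sequentially. J (X n) \<le> m + 1 / real (Suc n)" using X by (intro always_eventually allI less_imp_le)
    show "(\<lambda>n. m + 1 / real (Suc n)) \<longlonglongrightarrow> m"
      using tendsto_add[OF tendsto_const[of m] LIMSEQ_inverse_real_of_nat]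
      by (simp add: inverse_eq_divide)
  qed simp
  ultimately have Jz: "J z = m" by (rule LIMSEQ_unique)
  have zW: "z \<in> closure W" using XW z by (auto simp: closure_sequential)
  have re: "Re (\<phi> x) = Re (cinner x z)" if xW: "x \<in> W" for x
  proof (rule ccontr)
    assume ne: "Re (\<phi> x) \<noteq> Re (cinner x z)"
    define d where "d = Re (\<phi> x) - Re (cinner x z)"
    have dn: "d \<noteq> 0" using ne by (simp add: d_def)
    have ineq: "0 \<le> r\<^sup>2 * (norm x)\<^sup>2 - 2 * r * d" for r
    proof -
      have "(\<lambda>n. J (X n + r *\<^sub>R x)) \<longlonglongrightarrow> J (z + r *\<^sub>R x)"
        unfolding J_def by (intro tendsto_intros z bounded_linear.tendsto[OF blphi])
      moreover have "m \<le> J (X n + r *\<^sub>R x)" for n using XW WR[OF xW] W(2) by (intro mJ) auto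
      ultimately have "J z \<le> J (z + r *\<^sub>R x)" unfolding Jz by (intro LIMSEQ_le_const) auto
      thus ?thesis
        unfolding J_def d_def add sR norm_add_square
        by (simp add: cinner.scaleR_right Re_cinner_commute[of z x] power_mult_distrib algebra_simps)
    qed
    have "x \<noteq> 0" using dn add[of 0 0] by (auto simp: d_def cinner.zero_left)
    \<comment> \<open>This r minimises the right-hand side of \<open>ineq\<close> and makes it
      negative.\<close>
    with ineq[of "d / (norm x)\<^sup>2"] have "0 \<le> - (d\<^sup>2 / (norm x)\<^sup>2)"
      by (simp add: power2_eq_square field_simps)
    with dn \<open>x \<noteq> 0\<close> show False by (simp add: divide_le_0_iff)
  qed
  have "\<phi> x = cinner x z" if "x \<in> W" for x
  proof (rule complex_eqI)
    show "Im (\<phi> x) = Im (cinner x z)"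
      using re[OF W(3)[OF that, of "\<i>"]] by (simp add: sc cinner_scaleC_left)
  qed (rule re[OF that])
  thus ?thesis using zW by blast
qed

lemma Riesz_representation:
  fixes \<phi> :: "'a::chilbert_space \<Rightarrow> complex"
  assumes "\<And>x y. \<phi> (x + y) = \<phi> x + \<phi> y" "\<And>c x. \<phi> (c *\<^sub>C x) = c * \<phi> x"
    and "\<And>x. cmod (\<phi> x) \<le> M * norm x"
  shows "\<exists>z. \<forall>x. \<phi> x = cinner x z"
  using Riesz_representation_subspace[of UNIV \<phi> M] assms by auto

text \<open>The functional \<open>cinner _ x\<close> is represented on the range by some z in its
  closure, the orthogonal projection of x. Then x - z is orthogonal to the range, hence
  zero.\<close>

lemma dense_range:
  fixes f :: "'b::complex_inner \<Rightarrow> 'a::chilbert_space"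
  assumes f: "cbounded_linear f" and orth: "\<And>y. (\<And>w. cinner (f w) y = 0) \<Longrightarrow> y = 0"
  shows "closure (range f) = UNIV"
proof -
  interpret f: bounded_linear f by (rule cbounded_linear_bounded_linear[OF f])
  have "x \<in> closure (range f)" for x
  proof -
    have "\<exists>z\<in>closure (range f). \<forall>w\<in>range f. cinner w x = cinner w z"
    proof (rule Riesz_representation_subspace[where M = "norm x"])
      show "cmod (cinner y x) \<le> norm x * norm y" for y
        using cinner_Cauchy_Schwarz[of y x] by (simp add: mult.commute)
    qed (auto simp: cinner_add_left cinner_scaleC_left simp flip: f.add cbounded_linear_scaleC[OF f])
    then obtain z where z: "z \<in> closure (range f)" "\<And>w. cinner (f w) x = cinner (f w) z" by blast
    have "x - z = 0" by (rule orth) (simp add: cinner.diff_right z(2))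
    with z(1) show ?thesis by simp
  qed
  thus ?thesis by blast
qed

lemma adjoint_exists:
  fixes f :: "'a::chilbert_space \<Rightarrow> 'b::complex_inner"
  assumes f: "cbounded_linear f"
  shows "\<exists>g. cbounded_linear g \<and> (\<forall>x y. cinner (f x) y = cinner x (g y))"
proof -
  interpret f: bounded_linear f by (rule cbounded_linear_bounded_linear[OF f])
  obtain M where M: "M > 0" "\<And>x. norm (f x) \<le> M * norm x"
    using cbounded_linear_pos_bound[OF f] by blast
  have "\<exists>z. \<forall>x. cinner (f x) y = cinner x z" for y
  proof (rule Riesz_representation[where M = "M * norm y"])
    show "cmod (cinner (f x) y) \<le> M * norm y * norm x" for x
    proof -
      have "cmod (cinner (f x) y) \<le> norm (f x) * norm y" by (rule cinner_Cauchy_Schwarz)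
      also have "\<dots> \<le> (M * norm x) * norm y" by (intro mult_right_mono M) auto
      finally show ?thesis by (simp add: mult_ac)
    qed
  qed (auto simp: f.add cinner.add_left cbounded_linear_scaleC[OF f] cinner_scaleC_left)
  then obtain g where g: "\<And>x y. cinner (f x) y = cinner x (g y)" by metis
  have "cbounded_linear g"
  proof (rule cbounded_linearI[where M = M])
    show "g (x + y) = g x + g y" for x y
      by (rule cinner_ext_left, subst (1 2) cinner_commute)
        (simp add: g[symmetric] cinner.add_right)
    show "g (c *\<^sub>C x) = c *\<^sub>C g x" for c x
      by (rule cinner_ext_left, subst (1 2) cinner_commute)
        (simp add: g[symmetric] cinner_scaleC_right)
    show "norm (g y) \<le> norm y * M" for y
    proof (rule norm_le_by_cinner)
      fix w :: 'a assume "norm w \<le> 1"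
      have "cmod (cinner (g y) w) = cmod (cinner (f w) y)"
        by (subst cinner_commute) (simp add: g)
      also have "\<dots> \<le> norm (f w) * norm y" by (rule cinner_Cauchy_Schwarz)
      also have "\<dots> \<le> (M * 1) * norm y"
        by (rule mult_right_mono[OF order_trans[OF M(2)]]) (use \<open>norm w \<le> 1\<close> M in auto)
      finally show "cmod (cinner (g y) w) \<le> norm y * M" by (simp add: mult_ac)
    qed (use M in auto)
  qed
  with g show ?thesis by blast
qed

lemma Lax_Milgram:
  fixes B :: "'a::chilbert_space \<Rightarrow> 'a"
  assumes B: "cbounded_linear B" and c: "c > 0"
    and coer: "\<And>u. Re (cinner (B u) u) \<ge> c * (norm u)\<^sup>2"
  shows "bij B" and "cbounded_linear (inv B)" and "norm (inv B x) \<le> norm x / c"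
proof -
  interpret B: bounded_linear B by (rule cbounded_linear_bounded_linear[OF B])
  obtain M where M: "M > 0" "\<And>x. norm (B x) \<le> M * norm x"
    using cbounded_linear_pos_bound[OF B] by blast
  have lower: "c * norm u \<le> norm (B u)" for u
  proof (cases "u = 0")
    case False
    have "c * (norm u)\<^sup>2 \<le> norm (B u) * norm u"
      using coer[of u] Re_cinner_le[of "B u" u] by linarith
    thus ?thesis using False by (simp add: power2_eq_square)
  qed simp
  have inj: "inj B"
  proof (rule injI)
    fix x y assume "B x = B y"
    with lower[of "x - y"] c show "x = y"
      by (simp add: B.diff mult_le_0_iff)
  qed
  have "\<exists>x. B x = y" for y
  proof -
    \<comment> \<open>\<open>x \<mapsto> x - \<rho> (B x - y)\<close> is a contraction for small \<open>\<rho>\<close>\<close>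
    define \<rho> where "\<rho> = c / (M\<^sup>2 + c\<^sup>2)"
    have den: "M\<^sup>2 + c\<^sup>2 > 0" using c by (simp add: add_nonneg_pos)
    have \<rho>: "\<rho> > 0" using c den by (simp add: \<rho>_def)
    \<comment> \<open>A real number because the summand \<open>c\<^sup>2\<close> in the denominator
      of \<open>\<rho>\<close> forces \<open>c * \<rho> \<le> 1\<close>.\<close>
    define k where "k = sqrt (1 - c * \<rho>)"
    have c\<rho>: "c * \<rho> \<le> 1" "c * \<rho> > 0"
      using den c \<rho> by (auto simp: \<rho>_def power2_eq_square field_simps)
    have k: "0 \<le> k" "k < 1"
      using c\<rho> by (auto simp: k_def)
    have con: "norm (x - \<rho> *\<^sub>R B x) \<le> k * norm x" for x
    proof -
      have "(norm (x - \<rho> *\<^sub>R B x))\<^sup>2 = (norm x)\<^sup>2 - 2 * \<rho> * Re (cinner (B x) x) + \<rho>\<^sup>2 * (norm (B x))\<^sup>2"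
        by (simp add: norm_diff_square cinner.scaleR_right Re_cinner_commute[of x] power_mult_distrib)
      also have "\<dots> \<le> (norm x)\<^sup>2 - 2 * \<rho> * (c * (norm x)\<^sup>2) + \<rho>\<^sup>2 * (M * norm x)\<^sup>2"
        using coer[of x] M(2)[of x] \<rho> by (intro add_mono diff_mono mult_left_mono power_mono) auto
      also have "\<dots> = (1 - 2 * \<rho> * c + \<rho>\<^sup>2 * M\<^sup>2) * (norm x)\<^sup>2"
        by (simp add: algebra_simps power2_eq_square)
      also have "\<dots> \<le> (1 - c * \<rho>) * (norm x)\<^sup>2"
      proof -
        have "\<rho> * (M\<^sup>2 + c\<^sup>2) = c" using den by (simp add: \<rho>_def)
        hence "\<rho> * M\<^sup>2 \<le> c" using \<rho> by (metis add_increasing2 distrib_left mult_left_mono order_refl zero_le_power2 less_imp_le le_add_same_cancel1)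
        hence "\<rho> * (\<rho> * M\<^sup>2) \<le> \<rho> * c" using \<rho> by simp
        thus ?thesis by (intro mult_right_mono) (auto simp: power2_eq_square algebra_simps)
      qed
      also have "\<dots> = (k * norm x)\<^sup>2"
        using c\<rho> by (simp add: k_def power_mult_distrib)
      finally show ?thesis by (rule power2_le_imp_le) (use k in auto)
    qed
    have "\<exists>!x. x - \<rho> *\<^sub>R (B x - y) = x"
    proof (rule banach_fix_type[of k])
      show "\<forall>x. \<forall>y'. dist (x - \<rho> *\<^sub>R (B x - y)) (y' - \<rho> *\<^sub>R (B y' - y)) \<le> k * dist x y'"
      proof (intro allI)
        fix x y' :: 'a
        have "(x - \<rho> *\<^sub>R (B x - y)) - (y' - \<rho> *\<^sub>R (B y' - y)) = (x - y') - \<rho> *\<^sub>R B (x - y')"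
          by (simp add: B.diff algebra_simps)
        thus "dist (x - \<rho> *\<^sub>R (B x - y)) (y' - \<rho> *\<^sub>R (B y' - y)) \<le> k * dist x y'"
          using con[of "x - y'"] by (simp only: dist_norm)
      qed
    qed (use k in auto)
    then obtain x where "\<rho> *\<^sub>R (B x - y) = 0" by auto
    thus ?thesis using \<rho> by auto
  qed
  hence "surj B" by (metis surjI)
  with inj show bij: "bij B" by (simp add: bij_def)
  have bd: "norm x \<le> (1 / c) * norm (B x)" for x
    using lower[of x] c by (simp add: field_simps)
  show "cbounded_linear (inv B)"
    by (rule cbounded_linear_inv[OF B bij bd])
  show "norm (inv B x) \<le> norm x / c"
    using bd[of "inv B x"] bij by (simp add: bij_is_surj surj_f_inv_f)
qed

section \<open>Uniform boundedness and limits of operator families\<close>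

lemma uniform_boundedness:
  fixes F :: "'i \<Rightarrow> 'a::banach \<Rightarrow> 'b::real_normed_vector"
  assumes lin: "\<And>i. i \<in> I \<Longrightarrow> bounded_linear (F i)"
    and pw: "\<And>x. \<exists>c. \<forall>i\<in>I. norm (F i x) \<le> c"
  shows "\<exists>M. \<forall>i\<in>I. \<forall>x. norm (F i x) \<le> M * norm x"
proof -
  define B where "B n = {x. \<forall>i\<in>I. norm (F i x) \<le> real n}" for n
  have clB: "closed (B n)" for n
  proof -
    have "B n = (\<Inter>i\<in>I. {x. norm (F i x) \<le> real n})" by (auto simp: B_def)
    thus ?thesis
      using linear_continuous_on[OF lin] by (auto intro!: closed_Collect_le continuous_intros)
  qed
  have "x \<in> \<Union>(range B)" for x
  proof -
    obtain c where "\<forall>i\<in>I. norm (F i x) \<le> c" using pw by blast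
    moreover obtain n where "c \<le> real n" by (meson real_arch_simple)
    ultimately have "x \<in> B n" by (auto simp: B_def intro: order_trans)
    thus ?thesis by blast
  qed
  hence "interior (\<Union>(range B)) \<noteq> {}" by (metis UNIV_eq_I UNIV_not_empty interior_UNIV)
  \<comment> \<open>Baire's theorem: the countably many closed sets \<open>B n\<close> cover the
    space, so one of them has interior.\<close>
  hence "\<not> (\<forall>X\<in>range B. closed X \<and> interior X = {})"
    using Met_TC.metric_Baire_category_alt[of "range B"] by (auto simp: complete_UNIV)
  then obtain n x where "x \<in> interior (B n)" using clB by auto
  then obtain r where r: "r > 0" "cball x r \<subseteq> B n" by (auto simp: mem_interior_cball)
  have "norm (F i y) \<le> (2 * real n / r) * norm y" if i: "i \<in> I" for i y
  proof (cases "y = 0")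
    case False
    interpret F: bounded_linear "F i" by (rule lin[OF i])
    \<comment> \<open>A multiple of y of length r: both \<open>x + h\<close> and \<open>x\<close>
      lie in the ball inside \<open>B n\<close>, so \<open>F i h\<close> is bounded by 2n.\<close>
    define h where "h = (r / norm y) *\<^sub>R y"
    have "x + h \<in> B n" "x \<in> B n"
      using r False by (auto intro!: subsetD[OF r(2)] simp: h_def dist_norm)
    hence "norm (F i (x + h)) \<le> real n" "norm (F i x) \<le> real n" using i by (auto simp: B_def)
    hence "norm (F i h) \<le> 2 * real n"
      using norm_triangle_ineq4[of "F i (x + h)" "F i x"] by (simp add: F.add)
    thus ?thesis using False r(1) by (simp add: h_def F.scaleR field_simps)
  qed (simp add: linear_simps[OF lin[OF i]])
  thus ?thesis by blast
qed

lemma Cauchy_at_top: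
  fixes f :: "real \<Rightarrow> 'a::complete_space"
  assumes "\<And>e. e > 0 \<Longrightarrow> \<exists>N. \<forall>m\<ge>N. \<forall>n\<ge>N. dist (f m) (f n) < e"
  shows "\<exists>l. (f \<longlongrightarrow> l) at_top"
proof -
  have "cauchy_filter (filtermap f at_top)"
    unfolding cauchy_filter_metric_filtermap
  proof (intro allI impI)
    fix e :: real assume "e > 0"
    then obtain N where "\<forall>m\<ge>N. \<forall>n\<ge>N. dist (f m) (f n) < e" using assms by blast
    thus "\<exists>P. eventually P at_top \<and> (\<forall>x y. P x \<and> P y \<longrightarrow> dist (f x) (f y) < e)"
      by (intro exI[of _ "\<lambda>n. n \<ge> N"]) (auto simp: eventually_ge_at_top)
  qed
  from cauchy_filter_complete_converges[OF this complete_UNIV] show ?thesis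
    by (auto simp: filterlim_def filtermap_bot_iff)
qed

text \<open>The truncated integrals met later obey a uniform operator bound, but their convergence
  can be checked directly only on a dense set. The uniform bound carries it over to the whole
  space.\<close>

lemma convergent_on_dense:
  fixes F :: "real \<Rightarrow> 'a::real_normed_vector \<Rightarrow> 'b::banach"
  assumes lin: "\<And>n. n \<ge> 0 \<Longrightarrow> bounded_linear (F n)"
    and bd: "\<And>n x. n \<ge> 0 \<Longrightarrow> norm (F n x) \<le> M * norm x"
    and dense: "closure D = UNIV"
    and conv: "\<And>x. x \<in> D \<Longrightarrow> \<exists>l. ((\<lambda>n. F n x) \<longlongrightarrow> l) at_top"
  shows "\<exists>L. bounded_linear L \<and> (\<forall>x. ((\<lambda>n. F n x) \<longlongrightarrow> L x) at_top)"
proof -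
  have "\<exists>l. ((\<lambda>n. F n x) \<longlongrightarrow> l) at_top" for x
  proof (rule Cauchy_at_top)
    fix e :: real assume e: "e > 0"
    define K where "K = \<bar>M\<bar> + 1"
    have K: "K > 0" "M \<le> K" by (auto simp: K_def)
    have "x \<in> closure D" "e / (4 * K) > 0" using dense e K by simp_all
    then obtain d where d: "d \<in> D" "norm (d - x) < e / (4 * K)"
      unfolding closure_approachable dist_norm by blast
    obtain l where "((\<lambda>n. F n d) \<longlongrightarrow> l) at_top" using conv[OF d(1)] by blast
    hence "\<forall>\<^sub>F n in at_top. dist (F n d) l < e / 4" using e by (intro tendstoD) auto
    then obtain B where B: "\<And>n. n \<ge> B \<Longrightarrow> dist (F n d) l < e / 4"
      by (auto simp: eventually_at_top_linorder)
    have near: "dist (F n x) (F n d) < e / 4" if "n \<ge> 0" for n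
    proof -
      interpret F: bounded_linear "F n" by (rule lin[OF that])
      have "dist (F n x) (F n d) \<le> M * norm (x - d)" using bd[OF that, of "x - d"] by (simp add: F.diff dist_norm)
      also have "\<dots> \<le> K * norm (d - x)" using K by (subst norm_minus_commute) (intro mult_right_mono, auto)
      also have "\<dots> < e / 4" using d(2) K by (simp add: field_simps)
      finally show ?thesis .
    qed
    show "\<exists>N. \<forall>m\<ge>N. \<forall>n\<ge>N. dist (F m x) (F n x) < e"
    proof (intro exI allI impI)
      fix m n assume mn: "max B 0 \<le> m" "max B 0 \<le> n"
      have "dist (F m x) (F n x) \<le> dist (F m x) (F m d) + dist (F m d) l + (dist (F n x) (F n d) + dist (F n d) l)"
        using dist_triangle[of "F m x" "F n x" "F m d"] dist_triangle[of "F m d" "F n x" l]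
          dist_triangle[of l "F n x" "F n d"] by (simp add: dist_commute)
      thus "dist (F m x) (F n x) < e" using near[of m] near[of n] B[of m] B[of n] mn by simp
    qed
  qed
  then obtain L where L: "\<And>x. ((\<lambda>n. F n x) \<longlongrightarrow> L x) at_top" by metis
  have "bounded_linear L"
  proof (rule bounded_linear_intro[where K = M])
    fix x y r
    show "L (x + y) = L x + L y"
    proof (rule tendsto_unique[OF _ L])
      have "\<forall>\<^sub>F n in at_top. F n x + F n y = F n (x + y)"
        using linear_simps(1)[OF lin] by (intro eventually_at_top_linorderI[of 0]) simp
      thus "((\<lambda>n. F n (x + y)) \<longlongrightarrow> L x + L y) at_top"
        by (rule Lim_transform_eventually[OF tendsto_add[OF L L]])
    qed simp
    show "L (r *\<^sub>R x) = r *\<^sub>R L x"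
    proof (rule tendsto_unique[OF _ L])
      have "\<forall>\<^sub>F n in at_top. r *\<^sub>R F n x = F n (r *\<^sub>R x)"
        using linear_simps(5)[OF lin] by (intro eventually_at_top_linorderI[of 0]) simp
      thus "((\<lambda>n. F n (r *\<^sub>R x)) \<longlongrightarrow> r *\<^sub>R L x) at_top"
        by (rule Lim_transform_eventually[OF tendsto_scaleR[OF tendsto_const L]])
    qed simp
    show "norm (L x) \<le> norm x * M"
    proof (rule tendsto_upperbound[OF tendsto_norm[OF L]])
      show "\<forall>\<^sub>F n in at_top. norm (F n x) \<le> norm x * M"
        using bd by (intro eventually_at_top_linorderI[of 0]) (simp add: mult.commute)
    qed simp
  qed
  with L show ?thesis by blast
qed

section \<open>Improper integrals\<close>

lemma integral_inverse_quadratic: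
  assumes "0 \<le> N" "c > 0"
  shows "((\<lambda>s. 1 / (c\<^sup>2 + s\<^sup>2)) has_integral arctan (N / c) / c) {0..N}"
proof -
  have "((\<lambda>s. 1 / (c\<^sup>2 + s\<^sup>2)) has_integral (arctan (N / c) / c - arctan (0 / c) / c)) {0..N}"
  proof (rule fundamental_theorem_of_calculus)
    fix x
    have "((\<lambda>s. arctan (s / c) / c) has_real_derivative inverse (1 + (x / c)\<^sup>2) * (1 / c) / c) (at x within {0..N})"
      by (rule derivative_eq_intros refl | use assms in simp)+
    also have "inverse (1 + (x / c)\<^sup>2) * (1 / c) / c = 1 / (c\<^sup>2 + x\<^sup>2)"
    proof -
      have "c\<^sup>2 + x\<^sup>2 > 0" using assms by (simp add: add_pos_nonneg)
      moreover have "1 + (x / c)\<^sup>2 = (c\<^sup>2 + x\<^sup>2) / c\<^sup>2" using assms by (simp add: field_simps)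
      ultimately show ?thesis using assms by (simp add: power2_eq_square)
    qed
    finally show "((\<lambda>s. arctan (s / c) / c) has_vector_derivative 1 / (c\<^sup>2 + x\<^sup>2)) (at x within {0..N})"
      by (simp add: has_real_derivative_iff_has_vector_derivative)
  qed (use assms in auto)
  thus ?thesis by simp
qed

lemma norm_integral_inverse_quadratic:
  fixes G :: "real \<Rightarrow> 'a::banach"
  assumes cont: "continuous_on {0..N} G" and bd: "\<And>s. 0 \<le> s \<Longrightarrow> norm (G s) \<le> M / (c\<^sup>2 + s\<^sup>2)"
    and "c > 0" "0 \<le> N"
  shows "norm (integral {0..N} G) \<le> M * (pi / (2 * c))"
proof -
  have hi: "((\<lambda>s. M * (1 / (c\<^sup>2 + s\<^sup>2))) has_integral M * (arctan (N / c) / c)) {0..N}"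
    by (intro has_integral_mult_right integral_inverse_quadratic assms)
  have "0 \<le> M"
  proof -
    have "0 \<le> M / (c\<^sup>2 + 0\<^sup>2)" using bd[of 0] norm_ge_zero[of "G 0"] by linarith
    thus ?thesis using \<open>c > 0\<close> by (simp add: zero_le_divide_iff)
  qed
  have "norm (integral {0..N} G) \<le> integral {0..N} (\<lambda>s. M * (1 / (c\<^sup>2 + s\<^sup>2)))"
    by (rule integral_norm_bound_integral[OF integrable_continuous_real[OF cont]])
      (use hi bd in \<open>auto simp: has_integral_integrable\<close>)
  also have "\<dots> = M * (arctan (N / c) / c)" using hi by (rule integral_unique)
  also have "\<dots> \<le> M * (pi / (2 * c))"
    using \<open>0 \<le> M\<close> \<open>c > 0\<close> less_imp_le[OF arctan_ubound[of "N / c"]]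
    by (intro mult_left_mono) (auto simp: field_simps)
  finally show ?thesis .
qed

lemma integral_at_top_convergent:
  fixes G :: "real \<Rightarrow> 'a::banach"
  assumes cont: "continuous_on {0..} G" and bd: "\<And>s. 0 \<le> s \<Longrightarrow> norm (G s) \<le> M / (1 + s\<^sup>2)"
  shows "\<exists>I. ((\<lambda>N. integral {0..N} G) \<longlongrightarrow> I) at_top"
proof (rule Cauchy_at_top)
  have M: "0 \<le> M" using order_trans[OF norm_ge_zero bd[of 0]] by simp
  have ii: "G integrable_on {a..b}" if "0 \<le> a" for a b
    by (rule integrable_continuous_real[OF continuous_on_subset[OF cont]]) (use that in auto)
  \<comment> \<open>The bound has a multiple of arctan as antiderivative, whose convergence at
    infinity makes the truncated integrals Cauchy.\<close>
  have diff: "norm (integral {0..b} G - integral {0..a} G) \<le> M * (arctan b - arctan a)" if ab: "0 \<le> a" "a \<le> b" for a b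
  proof -
    have hi: "((\<lambda>s. M / (1 + s\<^sup>2)) has_integral M * arctan b - M * arctan a) {a..b}"
    proof (rule fundamental_theorem_of_calculus)
      fix x
      show "((\<lambda>s. M * arctan s) has_vector_derivative M / (1 + x\<^sup>2)) (at x within {a..b})"
        unfolding has_real_derivative_iff_has_vector_derivative[symmetric]
        by (auto intro!: derivative_eq_intros simp: field_simps)
    qed (use ab in auto)
    have "integral {0..b} G - integral {0..a} G = integral {a..b} G"
      using Henstock_Kurzweil_Integration.integral_combine[OF ab ii[of 0 b]] by (simp add: algebra_simps)
    also have "norm \<dots> \<le> integral {a..b} (\<lambda>s. M / (1 + s\<^sup>2))"
      by (rule integral_norm_bound_integral[OF ii]) (use ab hi bd in \<open>auto simp: has_integral_integrable\<close>)
    finally show ?thesis using integral_unique[OF hi] by (simp add: right_diff_distrib)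
  qed
  fix e :: real assume e: "e > 0"
  have "((\<lambda>a. M * (pi / 2 - arctan a)) \<longlongrightarrow> 0) at_top"
    by (rule tendsto_eq_intros tendsto_arctan_at_top refl | simp)+
  then obtain B where B: "\<And>a. a \<ge> B \<Longrightarrow> M * (pi / 2 - arctan a) < e"
    using order_tendstoD(2)[OF _ e] by (force simp: eventually_at_top_linorder)
  have *: "dist (integral {0..m} G) (integral {0..n} G) < e" if "max B 0 \<le> n" "n \<le> m" for m n
  proof -
    have "M * (arctan m - arctan n) \<le> M * (pi / 2 - arctan n)"
      using M less_imp_le[OF arctan_ubound[of m]] by (intro mult_left_mono) auto
    thus ?thesis using diff[of n m] B[of n] that by (simp add: dist_norm)
  qed
  show "\<exists>N. \<forall>m\<ge>N. \<forall>n\<ge>N. dist (integral {0..m} G) (integral {0..n} G) < e"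
  proof (intro exI allI impI)
    fix m n assume "max B 0 \<le> m" "max B 0 \<le> n"
    thus "dist (integral {0..m} G) (integral {0..n} G) < e"
      using *[of n m] *[of m n] by (cases "n \<le> m") (auto simp: dist_commute)
  qed
qed

text \<open>Substitution t = s^2: the weight t^(-1/2) dt becomes 2 ds, which removes the singularity
  at 0. For this reason all later work is done in the variable s.\<close>

lemma has_integral_powr_half:
  fixes G :: "real \<Rightarrow> 'a::banach"
  assumes cont: "continuous_on {0..} G" and lim: "((\<lambda>N. integral {0..N} G) \<longlongrightarrow> I) at_top"
  shows "((\<lambda>t. t powr (-1/2) *\<^sub>R G (sqrt t)) has_integral 2 *\<^sub>R I) {0<..}"
proof -
  define f where "f = (\<lambda>t. t powr (-1/2) *\<^sub>R G (sqrt t))"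
  define \<Phi> where "\<Phi> N = integral {0..N} G" for N
  have c0: "continuous_on {0..N} G" for N
    by (rule continuous_on_subset[OF cont]) auto
  have fin: "(f has_integral 2 *\<^sub>R \<Phi> (sqrt b)) {0..b}" if b: "b > 0" for b
  proof -
    have "(f has_integral (2 *\<^sub>R \<Phi> (sqrt b) - 2 *\<^sub>R \<Phi> (sqrt 0))) {0..b}"
    \<comment> \<open>The antiderivative is continuous at 0 while \<open>f\<close> may be unbounded
      there, so differentiability is asked only in the interior.\<close>
    proof (rule fundamental_theorem_of_calculus_interior_strong[where S = "{}"])
      have "continuous_on {0..sqrt b} \<Phi>"
        unfolding \<Phi>_def by (intro indefinite_integral_continuous_1 integrable_continuous_real c0)
      thus "continuous_on {0..b} (\<lambda>t. 2 *\<^sub>R \<Phi> (sqrt t))"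
        by (intro continuous_on_scaleR continuous_on_const
            continuous_on_compose2[of "{0..sqrt b}" \<Phi> "{0..b}" sqrt]
            continuous_on_real_sqrt continuous_on_id) auto
      fix t assume "t \<in> {0<..<b} - {}"
      hence t: "0 < t" "t < b" by auto
      have "(\<Phi> has_vector_derivative G (sqrt t)) (at (sqrt t) within {0..sqrt b})"
        unfolding \<Phi>_def by (rule integral_has_vector_derivative[OF c0]) (use t in auto)
      hence d1: "(\<Phi> has_vector_derivative G (sqrt t)) (at (sqrt t))"
        using at_within_Icc_at[of 0 "sqrt t" "sqrt b"] t by simp
      have d2: "(sqrt has_vector_derivative inverse (sqrt t) / 2) (at t)"
        using DERIV_real_sqrt[OF t(1)] by (simp add: has_real_derivative_iff_has_vector_derivative)
      have "((\<Phi> \<circ> sqrt) has_vector_derivative (inverse (sqrt t) / 2) *\<^sub>R G (sqrt t)) (at t)"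
        by (rule vector_diff_chain_at[OF d2 d1])
      hence "((\<lambda>t. 2 *\<^sub>R \<Phi> (sqrt t)) has_vector_derivative 2 *\<^sub>R ((inverse (sqrt t) / 2) *\<^sub>R G (sqrt t))) (at t)"
        by (auto simp: o_def intro!: derivative_eq_intros)
      moreover have "t powr (-1/2) = inverse (sqrt t)"
        using t by (simp add: powr_minus powr_half_sqrt)
      ultimately show "((\<lambda>t. 2 *\<^sub>R \<Phi> (sqrt t)) has_vector_derivative f t) (at t)"
        by (simp add: f_def)
    qed (use b in auto)
    thus ?thesis by (simp add: \<Phi>_def)
  qed
  \<comment> \<open>\<open>0 powr _\<close> is 0 by definition, so restricting the integrand to
    positive arguments does not change its value at the endpoint 0.\<close>
  have f0: "f 0 = 0" by (simp add: f_def)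
  have "(f has_integral 2 *\<^sub>R I) {0<..}"
  proof (subst has_integral_alt, subst if_not_P)
    show "\<not> (\<exists>a b::real. {0<..} = cbox a b)"
    proof
      assume "\<exists>a b::real. {0<..} = cbox a b"
      then obtain a b :: real where "{0<..} = {a..b}" by auto
      moreover have "max (b + 1) 1 \<in> {0::real<..}" by auto
      ultimately show False by auto
    qed
    show "\<forall>e>0. \<exists>B>0. \<forall>a b. ball 0 B \<subseteq> cbox a b \<longrightarrow>
      (\<exists>z. ((\<lambda>x. if x \<in> {0<..} then f x else 0) has_integral z) (cbox a b) \<and> norm (z - 2 *\<^sub>R I) < e)"
    proof (intro allI impI)
      fix e :: real assume e: "e > 0"
      have "((\<lambda>b. 2 *\<^sub>R \<Phi> (sqrt b)) \<longlongrightarrow> 2 *\<^sub>R I) at_top"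
        unfolding \<Phi>_def
        by (intro tendsto_intros filterlim_compose[OF lim sqrt_at_top])
      hence "\<forall>\<^sub>F b in at_top. dist (2 *\<^sub>R \<Phi> (sqrt b)) (2 *\<^sub>R I) < e" using e by (rule tendstoD)
      then obtain B where B: "\<And>b. b \<ge> B \<Longrightarrow> norm (2 *\<^sub>R \<Phi> (sqrt b) - 2 *\<^sub>R I) < e"
        by (auto simp: eventually_at_top_linorder dist_norm)
      show "\<exists>B>0. \<forall>a b. ball 0 B \<subseteq> cbox a b \<longrightarrow>
        (\<exists>z. ((\<lambda>x. if x \<in> {0<..} then f x else 0) has_integral z) (cbox a b) \<and> norm (z - 2 *\<^sub>R I) < e)"
      proof (intro exI[of _ "2 * max B 1"] conjI allI impI)
        fix a b :: real assume sub: "ball 0 (2 * max B 1) \<subseteq> cbox a b"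
        have "max B 1 \<in> ball 0 (2 * max B 1)" "- max B 1 \<in> ball (0::real) (2 * max B 1)"
          by (auto simp: dist_norm)
        with sub have "max B 1 \<in> cbox a b" "- max B 1 \<in> cbox a b" by blast+
        hence ab: "b \<ge> B" "b \<ge> 1" "a \<le> 0" by auto
        have "((\<lambda>x. if x \<in> {0..b} then f x else 0) has_integral 2 *\<^sub>R \<Phi> (sqrt b)) {a..b}"
          by (subst has_integral_restrict) (use ab fin in auto)
        hence "((\<lambda>x. if x \<in> {0<..} then f x else 0) has_integral 2 *\<^sub>R \<Phi> (sqrt b)) {a..b}"
          by (rule has_integral_eq[rotated]) (use f0 in \<open>auto simp: less_le\<close>)
        with B[OF ab(1)] show "\<exists>z. ((\<lambda>x. if x \<in> {0<..} then f x else 0) has_integral z) (cbox a b) \<and>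
            norm (z - 2 *\<^sub>R I) < e" by auto
      qed auto
    qed
  qed
  thus ?thesis by (simp add: f_def)
qed

text \<open>Caratheodory's form of the derivative suits resolvent identities: they present the
  increment as (y - x) times a function that is visibly continuous.\<close>

lemma has_vector_derivative_Caratheodory:
  assumes "\<And>y. y \<in> S \<Longrightarrow> f y - f x = (y - x) *\<^sub>R g y" and "continuous (at x within S) g"
  shows "(f has_vector_derivative g x) (at x within S)"
  unfolding has_vector_derivative_def has_derivative_within
proof (intro conjI)
  have "((\<lambda>y. norm (g y - g x)) \<longlongrightarrow> 0) (at x within S)"
    using assms(2) by (metis LIM_zero continuous_within tendsto_norm_zero)
  hence "((\<lambda>y. norm ((1 / norm (y - x)) *\<^sub>R (f y - (f x + (y - x) *\<^sub>R g x)))) \<longlongrightarrow> 0) (at x within S)"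
  proof (rule Lim_transform_eventually)
    show "\<forall>\<^sub>F y in at x within S. norm (g y - g x) = norm ((1 / norm (y - x)) *\<^sub>R (f y - (f x + (y - x) *\<^sub>R g x)))"
      unfolding eventually_at
    proof (intro exI[of _ 1] conjI ballI impI)
      fix y assume y: "y \<in> S" "y \<noteq> x \<and> dist y x < 1"
      have "f y - (f x + (y - x) *\<^sub>R g x) = (y - x) *\<^sub>R (g y - g x)"
        using assms(1)[OF y(1)] by (simp add: algebra_simps)
      thus "norm (g y - g x) = norm ((1 / norm (y - x)) *\<^sub>R (f y - (f x + (y - x) *\<^sub>R g x)))"
        using y by simp
    qed simp
  qed
  thus "((\<lambda>y. (1 / norm (y - x)) *\<^sub>R (f y - (f x + (y - x) *\<^sub>R g x))) \<longlongrightarrow> 0) (at x within S)"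
    by (rule tendsto_norm_zero_cancel)
qed (rule bounded_linear_scaleR_left)

section \<open>The square root of a pseudo-resolvent\<close>

notation blinfun_compose (infixl "\<odot>" 72)

interpretation blinfun_compose: bounded_bilinear
  "(\<odot>) :: ('b::real_normed_vector \<Rightarrow>\<^sub>L 'c::real_normed_vector) \<Rightarrow>
     ('a::real_normed_vector \<Rightarrow>\<^sub>L 'b) \<Rightarrow> ('a \<Rightarrow>\<^sub>L 'c)"
  by (rule bounded_bilinear_blinfun_compose)

lemma blinfun_compose_assoc: "(A \<odot> B) \<odot> C = A \<odot> (B \<odot> C)"
  by (auto intro!: blinfun_eqI)

text \<open>\<open>R t\<close> stands for (t + L)^(-1), and \<open>R 0\<close> for the inverse of L.
  Only the resolvent identity and the decay enter, so the unbounded operator itself never has to be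
  handled.\<close>

locale pseudo_resolvent =
  fixes R :: "real \<Rightarrow> ('a::banach \<Rightarrow>\<^sub>L 'a)" and M :: real
  assumes resolvent_identity:
      "\<And>s t. 0 \<le> s \<Longrightarrow> 0 \<le> t \<Longrightarrow> R s - R t = (t - s) *\<^sub>R (R s \<odot> R t)"
    and resolvent_bound: "\<And>t. 0 \<le> t \<Longrightarrow> norm (R t) \<le> M / (1 + t)"
begin

lemma M_nonneg: "0 \<le> M"
  using order_trans[OF norm_ge_zero resolvent_bound[of 0]] by simp

lemma resolvent_bound': "0 \<le> t \<Longrightarrow> norm (R t) \<le> M"
  using resolvent_bound[of t] M_nonneg
  by (smt (verit) divide_left_mono div_by_1 mult_pos_pos)

lemma resolvent_commute:
  assumes "0 \<le> s" "0 \<le> t" shows "R s \<odot> R t = R t \<odot> R s"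
proof (cases "s = t")
  case False
  have "(t - s) *\<^sub>R (R s \<odot> R t) = (t - s) *\<^sub>R (R t \<odot> R s)"
    using resolvent_identity[OF assms] resolvent_identity[OF assms(2,1)]
    by (smt (verit) minus_diff_eq scaleR_minus_left)
  thus ?thesis using False by simp
qed simp

lemma continuous_on_resolvent: "continuous_on {0..} R"
proof -
  have "dist (R s) (R t) \<le> M * M * dist s t" if "s \<ge> 0" "t \<ge> 0" for s t
  proof -
    have "norm (R s - R t) \<le> \<bar>t - s\<bar> * (norm (R s) * norm (R t))"
      unfolding resolvent_identity[OF that] norm_scaleR
      by (intro mult_left_mono norm_blinfun_compose) auto
    also have "\<dots> \<le> \<bar>t - s\<bar> * (M * M)"
      using resolvent_bound'[OF that(1)] resolvent_bound'[OF that(2)] M_nonneg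
      by (intro mult_left_mono mult_mono) auto
    finally show ?thesis by (simp add: dist_norm mult_ac dist_real_def abs_minus_commute)
  qed
  hence "(M * M)-lipschitz_on {0..} R"
    using M_nonneg by (auto simp: lipschitz_on_def)
  thus ?thesis by (rule lipschitz_on_continuous_on)
qed

lemma continuous_on_resolvent_comp:
  "continuous_on S f \<Longrightarrow> (\<And>x. x \<in> S \<Longrightarrow> 0 \<le> f x) \<Longrightarrow> continuous_on S (\<lambda>x. R (f x))"
  by (rule continuous_on_compose2[OF continuous_on_resolvent]) auto

text \<open>Truncation of (pi/2) (l + L)^(-1/2), written with t = s^2. The shift l serves the
  passage to infinity in \<open>inv_sqrt_square\<close>.\<close>

definition partial :: "real \<Rightarrow> real \<Rightarrow> ('a \<Rightarrow>\<^sub>L 'a)" where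
  "partial N l = integral {0..N} (\<lambda>s. R (l + s\<^sup>2))"

lemma continuous_integrand: "0 \<le> l \<Longrightarrow> continuous_on S (\<lambda>s. R (l + s\<^sup>2))"
  by (intro continuous_on_resolvent_comp continuous_intros) auto

lemma integrable_integrand: "0 \<le> l \<Longrightarrow> (\<lambda>s. R (l + s\<^sup>2)) integrable_on {0..N}"
  by (intro integrable_continuous_real continuous_integrand)

lemma partial_commute:
  assumes "0 \<le> l" and "\<And>t. 0 \<le> t \<Longrightarrow> B \<odot> R t = R t \<odot> B"
  shows "B \<odot> partial N l = partial N l \<odot> B"
proof -
  have "B \<odot> partial N l = integral {0..N} ((\<lambda>X. B \<odot> X) \<circ> (\<lambda>s. R (l + s\<^sup>2)))"
    unfolding partial_def
    by (rule integral_linear[OF integrable_integrand[OF assms(1)]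
        blinfun_compose.bounded_linear_right, symmetric])
  also have "(\<lambda>X. B \<odot> X) \<circ> (\<lambda>s. R (l + s\<^sup>2)) = (\<lambda>X. X \<odot> B) \<circ> (\<lambda>s. R (l + s\<^sup>2))"
    using assms by (auto simp: o_def)
  also have "integral {0..N} \<dots> = partial N l \<odot> B"
    unfolding partial_def
    by (rule integral_linear[OF integrable_integrand[OF assms(1)]
        blinfun_compose.bounded_linear_left])
  finally show ?thesis .
qed

lemma partial_bound:
  assumes "0 \<le> l" "0 \<le> N" shows "norm (partial N l) \<le> M * (pi / (2 * sqrt (1 + l)))"
  unfolding partial_def
proof (rule norm_integral_inverse_quadratic)
  show "continuous_on {0..N} (\<lambda>s. R (l + s\<^sup>2))" by (rule continuous_integrand[OF assms(1)])
  show "norm (R (l + s\<^sup>2)) \<le> M / ((sqrt (1 + l))\<^sup>2 + s\<^sup>2)" for s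
    using resolvent_bound[of "l + s\<^sup>2"] assms by (simp add: add.assoc)
qed (use assms in auto)

text \<open>Integrating the derivative of s R(l + s^2), and using the resolvent identity, gives two
  relations for the integral of s^2 R(l + s^2)^2; eliminating it leaves this. Up to the boundary
  term it is the differential equation D' = - R(l) D / 2 satisfied by (l + L)^(-1/2).\<close>

lemma two_integral_square:
  assumes "0 \<le> l" "0 \<le> N"
  shows "2 *\<^sub>R integral {0..N} (\<lambda>s. R (l + s\<^sup>2) \<odot> R (l + s\<^sup>2)) =
    R l \<odot> partial N l + N *\<^sub>R (R l \<odot> R (l + N\<^sup>2))"
proof -
  let ?R = "\<lambda>s. R (l + s\<^sup>2)"
  let ?S = "integral {0..N} (\<lambda>s. s\<^sup>2 *\<^sub>R (?R s \<odot> ?R s))"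
  let ?J = "integral {0..N} (\<lambda>s. ?R s \<odot> ?R s)"
  note ci = continuous_integrand[OF assms(1)]
  have iRR: "(\<lambda>s. ?R s \<odot> ?R s) integrable_on {0..N}"
    and iS: "(\<lambda>s. s\<^sup>2 *\<^sub>R (?R s \<odot> ?R s)) integrable_on {0..N}"
    by (intro integrable_continuous_real continuous_intros ci blinfun_compose.continuous_on)+
  have dR: "(?R has_vector_derivative (- (2 * s)) *\<^sub>R (?R s \<odot> ?R s)) (at s within T)" for s T
  proof -
    have "(?R has_vector_derivative (\<lambda>y. (- (y + s)) *\<^sub>R (?R y \<odot> ?R s)) s) (at s within T)"
    proof (rule has_vector_derivative_Caratheodory[where g = "\<lambda>y. (- (y + s)) *\<^sub>R (?R y \<odot> ?R s)"])
      show "?R y - ?R s = (y - s) *\<^sub>R (- (y + s)) *\<^sub>R (?R y \<odot> ?R s)" for y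
        using resolvent_identity[of "l + y\<^sup>2" "l + s\<^sup>2"] assms
        by (simp add: algebra_simps power2_eq_square)
      have "continuous_on UNIV (\<lambda>y. (- (y + s)) *\<^sub>R (?R y \<odot> ?R s))"
        by (intro continuous_intros ci blinfun_compose.continuous_on)
      thus "continuous (at s within T) (\<lambda>y. (- (y + s)) *\<^sub>R (?R y \<odot> ?R s))"
        by (simp add: continuous_on_eq_continuous_at continuous_at_imp_continuous_at_within)
    qed
    thus ?thesis by simp
  qed
  have "((\<lambda>s. ?R s - 2 *\<^sub>R (s\<^sup>2 *\<^sub>R (?R s \<odot> ?R s))) has_integral (N *\<^sub>R ?R N - 0 *\<^sub>R ?R 0)) {0..N}"
  proof (rule fundamental_theorem_of_calculus)
    fix s
    show "((\<lambda>s. s *\<^sub>R ?R s) has_vector_derivative ?R s - 2 *\<^sub>R (s\<^sup>2 *\<^sub>R (?R s \<odot> ?R s))) (at s within {0..N})"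
      by (rule has_vector_derivative_eq_rhs[OF has_vector_derivative_scaleR[OF DERIV_ident dR]])
        (simp add: power2_eq_square)
  qed (use assms in auto)
  moreover have "((\<lambda>s. ?R s - 2 *\<^sub>R (s\<^sup>2 *\<^sub>R (?R s \<odot> ?R s))) has_integral (partial N l - 2 *\<^sub>R ?S)) {0..N}"
    unfolding partial_def
    by (intro has_integral_diff has_integral_cmul integrable_integral integrable_integrand iS assms)
  ultimately have e1: "N *\<^sub>R ?R N = partial N l - 2 *\<^sub>R ?S"
    using has_integral_unique by (metis (no_types, lifting) diff_zero scaleR_zero_left)
  have "R l \<odot> ?S = integral {0..N} ((\<lambda>X. R l \<odot> X) \<circ> (\<lambda>s. s\<^sup>2 *\<^sub>R (?R s \<odot> ?R s)))"
    by (rule integral_linear[OF iS blinfun_compose.bounded_linear_right, symmetric])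
  also have "(\<lambda>X. R l \<odot> X) \<circ> (\<lambda>s. s\<^sup>2 *\<^sub>R (?R s \<odot> ?R s)) = (\<lambda>s. R l \<odot> ?R s - ?R s \<odot> ?R s)"
  proof
    fix s
    have "s\<^sup>2 *\<^sub>R (R l \<odot> ?R s) = R l - ?R s"
      using resolvent_identity[of l "l + s\<^sup>2"] assms by simp
    hence "(s\<^sup>2 *\<^sub>R (R l \<odot> ?R s)) \<odot> ?R s = R l \<odot> ?R s - ?R s \<odot> ?R s"
      by (simp add: blinfun_compose.diff_left)
    thus "((\<lambda>X. R l \<odot> X) \<circ> (\<lambda>s. s\<^sup>2 *\<^sub>R (?R s \<odot> ?R s))) s = R l \<odot> ?R s - ?R s \<odot> ?R s"
      by (simp add: blinfun_compose.scaleR_left blinfun_compose.scaleR_right blinfun_compose_assoc)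
  qed
  also have "integral {0..N} \<dots> = integral {0..N} ((\<lambda>X. R l \<odot> X) \<circ> ?R) - ?J"
    unfolding o_def
    by (intro Henstock_Kurzweil_Integration.integral_diff iRR integrable_continuous_real
        continuous_intros ci blinfun_compose.continuous_on)
  also have "integral {0..N} ((\<lambda>X. R l \<odot> X) \<circ> ?R) = R l \<odot> partial N l"
    unfolding partial_def
    by (rule integral_linear[OF integrable_integrand[OF assms(1)] blinfun_compose.bounded_linear_right])
  finally have e2: "R l \<odot> ?S = R l \<odot> partial N l - ?J" .
  have "N *\<^sub>R (R l \<odot> ?R N) = R l \<odot> (N *\<^sub>R ?R N)"
    by (simp add: blinfun_compose.scaleR_right)
  also have "\<dots> = R l \<odot> partial N l - 2 *\<^sub>R (R l \<odot> partial N l - ?J)"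
    unfolding e1 blinfun_compose.diff_right blinfun_compose.scaleR_right e2 ..
  finally show ?thesis by (simp add: algebra_simps scaleR_2)
qed

lemma partial_has_vector_derivative:
  assumes "0 \<le> l"
  shows "(partial N has_vector_derivative - integral {0..N} (\<lambda>s. R (l + s\<^sup>2) \<odot> R (l + s\<^sup>2))) (at l within {0..})"
proof -
  have "((\<lambda>x. integral (cbox 0 N) (\<lambda>s. R (x + s\<^sup>2))) has_vector_derivative
      integral (cbox 0 N) (\<lambda>s. - (R (l + s\<^sup>2) \<odot> R (l + s\<^sup>2)))) (at l within {0..})"
  proof (rule leibniz_rule_vector_derivative)
    fix x s :: real assume x: "x \<in> {0..}"
    have "((\<lambda>x. R (x + s\<^sup>2)) has_vector_derivative (\<lambda>y. - (R (y + s\<^sup>2) \<odot> R (x + s\<^sup>2))) x) (at x within {0..})"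
    proof (rule has_vector_derivative_Caratheodory[where g = "\<lambda>y. - (R (y + s\<^sup>2) \<odot> R (x + s\<^sup>2))"])
      show "R (y + s\<^sup>2) - R (x + s\<^sup>2) = (y - x) *\<^sub>R - (R (y + s\<^sup>2) \<odot> R (x + s\<^sup>2))" if "y \<in> {0..}" for y
        using resolvent_identity[of "y + s\<^sup>2" "x + s\<^sup>2"] x that
        by (simp flip: scaleR_minus_left)
      have "continuous_on {0..} (\<lambda>y. - (R (y + s\<^sup>2) \<odot> R (x + s\<^sup>2)))"
        by (intro continuous_intros blinfun_compose.continuous_on continuous_on_resolvent_comp) auto
      thus "continuous (at x within {0..}) (\<lambda>y. - (R (y + s\<^sup>2) \<odot> R (x + s\<^sup>2)))"
        using x by (simp add: continuous_on_eq_continuous_within)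
    qed
    thus "((\<lambda>x. R (x + s\<^sup>2)) has_vector_derivative - (R (x + s\<^sup>2) \<odot> R (x + s\<^sup>2))) (at x within {0..})"
      by simp
  next
    show "(\<lambda>s. R (x + s\<^sup>2)) integrable_on cbox 0 N" if "x \<in> {0..}" for x
      using integrable_integrand that by simp
    show "continuous_on ({0..} \<times> cbox 0 N) (\<lambda>(x, t). - (R (x + t\<^sup>2) \<odot> R (x + t\<^sup>2)))"
      unfolding split_beta
      by (intro continuous_intros blinfun_compose.continuous_on continuous_on_resolvent_comp) auto
  qed (use assms in auto)
  thus ?thesis by (simp add: partial_def[abs_def])
qed

text \<open>\<open>(\<lambda> + L) D(\<lambda>)\<^sup>2\<close> does not depend on \<open>\<lambda>\<close>; for the truncated integrals it is constant up to \<open>O(1/N)\<close>.\<close>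

lemma partial_square_almost_constant:
  assumes L: "0 \<le> L" and N: "1 \<le> N"
  defines "E \<equiv> \<lambda>l. partial N l \<odot> partial N l + l *\<^sub>R (R 0 \<odot> (partial N l \<odot> partial N l))"
  shows "norm (E L - E 0) \<le> L * ((1 + L * M) * (M * M * M * pi / 2)) / N"
proof -
  let ?J = "\<lambda>l. integral {0..N} (\<lambda>s. R (l + s\<^sup>2) \<odot> R (l + s\<^sup>2))"
  let ?D = "partial N" and ?K = "R 0"
  \<comment> \<open>The boundary term at s = N. It is O(1/N) since the norm of
    \<open>R (l + N\<^sup>2)\<close> is O(1/N^2).\<close>
  define \<beta> where "\<beta> l = N *\<^sub>R (R l \<odot> R (l + N\<^sup>2))" for l
  define G where "G l = \<beta> l \<odot> ?D l + ?D l \<odot> \<beta> l" for l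
  define E' where "E' l = - (1/2) *\<^sub>R (G l + l *\<^sub>R (?K \<odot> G l))" for l
  have der: "(E has_vector_derivative E' l) (at l within {0..})" if l: "0 \<le> l" for l
  proof -
    note d = partial_has_vector_derivative[OF l, of N]
    let ?F' = "- (?J l \<odot> ?D l + ?D l \<odot> ?J l)"
    have dF: "((\<lambda>l. ?D l \<odot> ?D l) has_vector_derivative ?F') (at l within {0..})"
      by (rule has_vector_derivative_eq_rhs[OF blinfun_compose.has_vector_derivative[OF d d]])
        (simp add: blinfun_compose.minus_left blinfun_compose.minus_right add.commute)
    have dE: "(E has_vector_derivative (?F' + (l *\<^sub>R (?K \<odot> ?F') + 1 *\<^sub>R (?K \<odot> (?D l \<odot> ?D l)))))
        (at l within {0..})"
      unfolding E_def
      by (intro has_vector_derivative_add dF has_vector_derivative_scaleR[OF DERIV_ident]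
          bounded_linear.has_vector_derivative[OF blinfun_compose.bounded_linear_right])
    have J2: "?J l = (1/2) *\<^sub>R (R l \<odot> ?D l + \<beta> l)"
      using two_integral_square[OF l, of N] N unfolding \<beta>_def
      by (metis (no_types, lifting) dual_order.trans divide_self_if mult.commute scaleR_one scaleR_scaleR
          times_divide_eq_right zero_le_one zero_neq_numeral mult_1)
    have comm: "?D l \<odot> R l = R l \<odot> ?D l"
      using partial_commute[OF l, of "R l" N] resolvent_commute l by simp
    have F': "?F' = - (R l \<odot> (?D l \<odot> ?D l)) - (1/2) *\<^sub>R G l"
    proof -
      have "?D l \<odot> (R l \<odot> ?D l) = R l \<odot> (?D l \<odot> ?D l)"
        by (metis blinfun_compose_assoc comm)
      thus ?thesis
        unfolding J2 G_def
        by (simp add: blinfun_compose.scaleR_left blinfun_compose.scaleR_right blinfun_compose.add_left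
            blinfun_compose.add_right blinfun_compose_assoc algebra_simps)
          (simp flip: scaleR_add_left)
    qed
    \<comment> \<open>The cancellation: \<open>E l\<close> is (1 + l \<open>R 0\<close>) applied to
      the square of \<open>?D l\<close>, and (1 + l \<open>R 0\<close>) \<open>R l\<close> =
      \<open>R 0\<close>, so in the derivative only the terms with \<open>\<beta>\<close>
      survive.\<close>
    have KR: "R l + l *\<^sub>R (?K \<odot> R l) = ?K"
      using resolvent_identity[of 0 l] l by (simp add: algebra_simps)
    have "?F' + (l *\<^sub>R (?K \<odot> ?F') + 1 *\<^sub>R (?K \<odot> (?D l \<odot> ?D l))) =
       - ((R l + l *\<^sub>R (?K \<odot> R l)) \<odot> (?D l \<odot> ?D l)) + ?K \<odot> (?D l \<odot> ?D l)
       - (1/2) *\<^sub>R (G l + l *\<^sub>R (?K \<odot> G l))"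
      unfolding F'
      by (simp add: blinfun_compose.scaleR_left blinfun_compose.scaleR_right blinfun_compose.add_left
            blinfun_compose.add_right blinfun_compose.diff_right blinfun_compose.minus_right
            blinfun_compose_assoc algebra_simps)
    also have "\<dots> = E' l" unfolding KR E'_def by simp
    finally show ?thesis using dE by simp
  qed
  have E'b: "norm (E' l) \<le> (1 + L * M) * (M * M * M * pi / 2) / N" if l: "0 \<le> l" "l \<le> L" for l
  proof -
    have nD: "norm (?D l) \<le> M * (pi / 2)"
    proof -
      have "norm (?D l) \<le> M * (pi / (2 * sqrt (1 + l)))" using partial_bound l N by simp
      also have "\<dots> \<le> M * (pi / 2)" using l M_nonneg by (intro mult_left_mono divide_left_mono) auto
      finally show ?thesis .
    qed
    have "norm (\<beta> l) \<le> N * (M * (M / N\<^sup>2))"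
    proof -
      have "norm (R (l + N\<^sup>2)) \<le> M / (1 + (l + N\<^sup>2))" using l by (intro resolvent_bound) auto
      also have "\<dots> \<le> M / N\<^sup>2" using l N M_nonneg by (intro divide_left_mono mult_pos_pos add_pos_nonneg) auto
      finally have "norm (R l \<odot> R (l + N\<^sup>2)) \<le> M * (M / N\<^sup>2)"
        using resolvent_bound'[of l] l M_nonneg
        by (intro order_trans[OF norm_blinfun_compose] mult_mono) auto
      from mult_left_mono[OF this, of N] show ?thesis using N by (simp add: \<beta>_def)
    qed
    also have "\<dots> = M * M / N" using N by (simp add: power2_eq_square)
    finally have nb: "norm (\<beta> l) \<le> M * M / N" .
    have nG: "norm (G l) \<le> 2 * (M * M * M * pi / 2 / N)"
    proof -
      have "norm (\<beta> l \<odot> ?D l) \<le> (M * M / N) * (M * (pi / 2))"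
        using nb nD M_nonneg N by (intro order_trans[OF norm_blinfun_compose] mult_mono) auto
      moreover have "norm (?D l \<odot> \<beta> l) \<le> (M * (pi / 2)) * (M * M / N)"
        using nb nD M_nonneg N by (intro order_trans[OF norm_blinfun_compose] mult_mono) auto
      ultimately have "norm (G l) \<le> (M * M / N) * (M * (pi / 2)) + (M * (pi / 2)) * (M * M / N)"
        unfolding G_def by (rule order_trans[OF norm_triangle_ineq add_mono])
      thus ?thesis by (simp add: field_simps)
    qed
    have "norm (E' l) = (1/2) * norm (G l + l *\<^sub>R (?K \<odot> G l))" by (simp add: E'_def)
    also have "\<dots> \<le> (1/2) * (norm (G l) + L * (M * norm (G l)))"
    proof -
      have "norm (?K \<odot> G l) \<le> M * norm (G l)"
        using resolvent_bound'[of 0] by (intro order_trans[OF norm_blinfun_compose] mult_right_mono) auto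
      hence "norm (l *\<^sub>R (?K \<odot> G l)) \<le> L * (M * norm (G l))"
        using l by (auto intro!: mult_mono)
      thus ?thesis by (intro mult_left_mono order_trans[OF norm_triangle_ineq]) auto
    qed
    also have "\<dots> = (1 + L * M) * (norm (G l) / 2)" by (simp add: algebra_simps)
    also have "\<dots> \<le> (1 + L * M) * (M * M * M * pi / 2 / N)"
      using nG L M_nonneg by (intro mult_left_mono) auto
    finally show ?thesis by simp
  qed
  have "norm (E L - E 0) \<le> ((1 + L * M) * (M * M * M * pi / 2) / N) * norm (L - 0)"
  proof (rule differentiable_bound[where S = "{0..L}" and f' = "\<lambda>l h. h *\<^sub>R E' l"])
    fix l assume l: "l \<in> {0..L}"
    show "(E has_derivative (\<lambda>h. h *\<^sub>R E' l)) (at l within {0..L})"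
      using der[of l] l has_vector_derivative_within_subset[of E "E' l" l "{0..}" "{0..L}"]
      by (auto simp: has_vector_derivative_def)
    show "onorm (\<lambda>h. h *\<^sub>R E' l) \<le> (1 + L * M) * (M * M * M * pi / 2) / N"
    proof (rule onorm_le)
      show "norm (h *\<^sub>R E' l) \<le> (1 + L * M) * (M * M * M * pi / 2) / N * norm h" for h
        using mult_right_mono[OF E'b[of l], of "norm h"] l by (simp add: mult.commute)
    qed
  qed (use L in auto)
  thus ?thesis using L by (simp add: mult_ac)
qed

lemma limit_exists:
  assumes "0 \<le> l" shows "\<exists>D. ((\<lambda>N. partial N l) \<longlongrightarrow> D) at_top"
  unfolding partial_def
proof (rule integral_at_top_convergent)
  show "continuous_on {0..} (\<lambda>s. R (l + s\<^sup>2))" by (rule continuous_integrand[OF assms])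
  show "norm (R (l + s\<^sup>2)) \<le> M / (1 + s\<^sup>2)" for s
    using resolvent_bound[of "l + s\<^sup>2"] assms M_nonneg
    by (smt (verit) divide_left_mono mult_pos_pos zero_le_power2)
qed

definition full :: "real \<Rightarrow> ('a \<Rightarrow>\<^sub>L 'a)" where
  "full l = (SOME D. ((\<lambda>N. partial N l) \<longlongrightarrow> D) at_top)"

lemma tendsto_full: "0 \<le> l \<Longrightarrow> ((\<lambda>N. partial N l) \<longlongrightarrow> full l) at_top"
  unfolding full_def by (rule someI_ex[OF limit_exists])

lemma full_square:
  assumes "0 \<le> L"
  shows "full 0 \<odot> full 0 = full L \<odot> full L + L *\<^sub>R (R 0 \<odot> (full L \<odot> full L))"
proof -
  define E where "E N l = partial N l \<odot> partial N l + l *\<^sub>R (R 0 \<odot> (partial N l \<odot> partial N l))" for N l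
  have lim: "((\<lambda>N. E N l) \<longlongrightarrow> full l \<odot> full l + l *\<^sub>R (R 0 \<odot> (full l \<odot> full l))) at_top" if "0 \<le> l" for l
    unfolding E_def by (intro tendsto_intros blinfun_compose.tendsto tendsto_full that)
  have "((\<lambda>N. E N L - E N 0) \<longlongrightarrow> 0) at_top"
  proof (rule Lim_null_comparison)
    show "\<forall>\<^sub>F N in at_top. norm (E N L - E N 0) \<le> L * ((1 + L * M) * (M * M * M * pi / 2)) / N"
      using partial_square_almost_constant[OF assms] unfolding E_def
      by (intro eventually_at_top_linorderI[of 1]) blast
    show "((\<lambda>N. L * ((1 + L * M) * (M * M * M * pi / 2)) / N) \<longlongrightarrow> 0) at_top"
      by (intro real_tendsto_divide_at_top[OF tendsto_const] filterlim_ident)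
  qed
  moreover have "((\<lambda>N. E N L - E N 0) \<longlongrightarrow> (full L \<odot> full L + L *\<^sub>R (R 0 \<odot> (full L \<odot> full L)))
      - (full 0 \<odot> full 0 + 0 *\<^sub>R (R 0 \<odot> (full 0 \<odot> full 0)))) at_top"
    by (intro tendsto_diff lim assms) auto
  ultimately have "(full L \<odot> full L + L *\<^sub>R (R 0 \<odot> (full L \<odot> full L)))
      - (full 0 \<odot> full 0 + 0 *\<^sub>R (R 0 \<odot> (full 0 \<odot> full 0))) = 0"
    by (intro tendsto_unique) auto
  thus ?thesis by simp
qed

lemma full_commute:
  assumes "0 \<le> l" and "\<And>t. 0 \<le> t \<Longrightarrow> B \<odot> R t = R t \<odot> B"
  shows "B \<odot> full l = full l \<odot> B"
proof (rule tendsto_unique)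
  show "((\<lambda>N. B \<odot> partial N l) \<longlongrightarrow> B \<odot> full l) at_top"
    by (intro blinfun_compose.tendsto tendsto_full tendsto_const assms)
  show "((\<lambda>N. B \<odot> partial N l) \<longlongrightarrow> full l \<odot> B) at_top"
    by (subst partial_commute[OF assms], assumption)
      (intro blinfun_compose.tendsto tendsto_full tendsto_const assms)
qed simp

text \<open>R(l + s^2) \<open>R 0\<close> equals (\<open>R 0\<close> - R(l + s^2)) / (l + s^2). The
  first part integrates to pi / (2 sqrt l) times \<open>R 0\<close>, the second is smaller by a
  factor of order 1/l. The factor \<open>R 0\<close> matters: for an unbounded operator B, sqrt l (l
  + B)^(-1/2) does not tend to the identity in norm.\<close>

lemma full_times_approx:
  assumes l: "0 < l"
  shows "norm (full l \<odot> R 0 - (pi / (2 * sqrt l)) *\<^sub>R R 0) \<le> (M / l) * (pi / (2 * sqrt l))"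
proof (rule tendsto_upperbound)
  show "((\<lambda>N. norm (partial N l \<odot> R 0 - (arctan (N / sqrt l) / sqrt l) *\<^sub>R R 0))
      \<longlongrightarrow> norm (full l \<odot> R 0 - (pi / (2 * sqrt l)) *\<^sub>R R 0)) at_top"
  proof -
    have "LIM N at_top. N / sqrt l :> at_top"
      using l by (intro filterlim_tendsto_pos_mult_at_top[OF tendsto_const _ filterlim_ident, of "1 / sqrt l", simplified mult.commute[of "1 / sqrt l"], simplified]) auto
    hence "((\<lambda>N. arctan (N / sqrt l)) \<longlongrightarrow> pi / 2) at_top"
      by (rule filterlim_compose[OF tendsto_arctan_at_top])
    hence "((\<lambda>N. arctan (N / sqrt l) / sqrt l) \<longlongrightarrow> pi / 2 / sqrt l) at_top"
      using l by (intro tendsto_intros) auto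
    moreover have "((\<lambda>N. partial N l \<odot> R 0) \<longlongrightarrow> full l \<odot> R 0) at_top"
      using l by (intro blinfun_compose.tendsto tendsto_full tendsto_const) auto
    ultimately have "((\<lambda>N. norm (partial N l \<odot> R 0 - (arctan (N / sqrt l) / sqrt l) *\<^sub>R R 0))
      \<longlongrightarrow> norm (full l \<odot> R 0 - (pi / 2 / sqrt l) *\<^sub>R R 0)) at_top"
      by (intro tendsto_norm tendsto_diff tendsto_scaleR tendsto_const)
    thus ?thesis by simp
  qed
  show "\<forall>\<^sub>F N in at_top. norm (partial N l \<odot> R 0 - (arctan (N / sqrt l) / sqrt l) *\<^sub>R R 0)
      \<le> (M / l) * (pi / (2 * sqrt l))"
  proof (rule eventually_at_top_linorderI[of 0])
    fix N :: real assume N: "0 \<le> N"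
    let ?R = "\<lambda>s. R (l + s\<^sup>2)"
    have ls: "l + s\<^sup>2 > 0" for s using l by (simp add: add_pos_nonneg)
    have c1: "continuous_on {0..N} (\<lambda>s. (1 / (l + s\<^sup>2)) *\<^sub>R ?R s)"
      using ls l by (intro continuous_intros continuous_integrand) (auto simp: less_imp_neq[THEN not_sym])
    have h1: "((\<lambda>s. 1 / (l + s\<^sup>2)) has_integral arctan (N / sqrt l) / sqrt l) {0..N}"
      using integral_inverse_quadratic[OF N, of "sqrt l"] l by simp
    have "partial N l \<odot> R 0 = integral {0..N} ((\<lambda>X. X \<odot> R 0) \<circ> ?R)"
      unfolding partial_def using l
      by (intro integral_linear[OF integrable_integrand blinfun_compose.bounded_linear_left, symmetric]) auto
    also have "(\<lambda>X. X \<odot> R 0) \<circ> ?R = (\<lambda>s. (1 / (l + s\<^sup>2)) *\<^sub>R R 0 - (1 / (l + s\<^sup>2)) *\<^sub>R ?R s)"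
    proof
      fix s
      have "?R s - R 0 = (0 - (l + s\<^sup>2)) *\<^sub>R (?R s \<odot> R 0)"
        using ls[of s] by (intro resolvent_identity) auto
      hence "R 0 - ?R s = (l + s\<^sup>2) *\<^sub>R (?R s \<odot> R 0)" by (simp add: algebra_simps)
      hence "?R s \<odot> R 0 = (1 / (l + s\<^sup>2)) *\<^sub>R (R 0 - ?R s)" using ls[of s] by simp
      thus "((\<lambda>X. X \<odot> R 0) \<circ> ?R) s = (1 / (l + s\<^sup>2)) *\<^sub>R R 0 - (1 / (l + s\<^sup>2)) *\<^sub>R ?R s"
        by (simp add: scaleR_diff_right)
    qed
    also have "integral {0..N} \<dots> = (arctan (N / sqrt l) / sqrt l) *\<^sub>R R 0 - integral {0..N} (\<lambda>s. (1 / (l + s\<^sup>2)) *\<^sub>R ?R s)"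
      by (rule integral_unique[OF has_integral_diff])
        (use h1 in \<open>auto intro!: has_integral_scaleR_left integrable_integral integrable_continuous_real c1\<close>)
    finally have "norm (partial N l \<odot> R 0 - (arctan (N / sqrt l) / sqrt l) *\<^sub>R R 0) =
        norm (integral {0..N} (\<lambda>s. (1 / (l + s\<^sup>2)) *\<^sub>R ?R s))" by (simp add: norm_minus_commute)
    also have "\<dots> \<le> (M / l) * (pi / (2 * sqrt l))"
    proof (rule norm_integral_inverse_quadratic[OF c1])
      fix s :: real
      have "norm (?R s) \<le> M / l"
      proof -
        have "norm (?R s) \<le> M / (1 + (l + s\<^sup>2))" using ls[of s] by (intro resolvent_bound) auto
        also have "\<dots> \<le> M / l" using l M_nonneg by (intro divide_left_mono mult_pos_pos add_pos_nonneg) auto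
        finally show ?thesis .
      qed
      hence "norm ((1 / (l + s\<^sup>2)) *\<^sub>R ?R s) \<le> (1 / (l + s\<^sup>2)) * (M / l)"
        using ls[of s] mult_left_mono[of "norm (?R s)" "M / l" "1 / (l + s\<^sup>2)"] by simp
      thus "norm ((1 / (l + s\<^sup>2)) *\<^sub>R ?R s) \<le> (M / l) / ((sqrt l)\<^sup>2 + s\<^sup>2)" using l by (simp add: mult.commute)
    qed (use l N in auto)
    finally show "norm (partial N l \<odot> R 0 - (arctan (N / sqrt l) / sqrt l) *\<^sub>R R 0) \<le> (M / l) * (pi / (2 * sqrt l))" .
  qed
qed simp

definition inv_sqrt :: "'a \<Rightarrow>\<^sub>L 'a" where
  "inv_sqrt = (2 / pi) *\<^sub>R full 0"

lemma inv_sqrt_commute: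
  assumes "\<And>t. 0 \<le> t \<Longrightarrow> B \<odot> R t = R t \<odot> B"
  shows "B \<odot> inv_sqrt = inv_sqrt \<odot> B"
  unfolding inv_sqrt_def using full_commute[OF order_refl assms]
  by (simp add: blinfun_compose.scaleR_left blinfun_compose.scaleR_right)

text \<open>By \<open>full_square\<close> the square of \<open>full 0\<close> can be computed at any
  parameter L. For large L, \<open>full L\<close> is close to pi / (2 sqrt L) on the range of
  \<open>R 0\<close>, and the total error is O(1/L).\<close>

theorem inv_sqrt_square: "inv_sqrt \<odot> inv_sqrt = R 0"
proof -
  have bound: "norm (full 0 \<odot> full 0 - (pi\<^sup>2 / 4) *\<^sub>R R 0) \<le> (pi\<^sup>2 / 4 * (2 * M\<^sup>2 + M)) / L" if L: "L > 0" for L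
  proof -
    define c where "c = pi / (2 * sqrt L)"
    have c: "c > 0" "L * c\<^sup>2 = pi\<^sup>2 / 4" using L by (auto simp: c_def power_divide power_mult_distrib)
    define W where "W = full L \<odot> R 0 - c *\<^sub>R R 0"
    have W: "norm W \<le> (M / L) * c" unfolding W_def c_def by (rule full_times_approx[OF L])
    have nF: "norm (full L) \<le> M * c"
    proof (rule tendsto_upperbound)
      show "((\<lambda>N. norm (partial N L)) \<longlongrightarrow> norm (full L)) at_top"
        using L by (intro tendsto_intros tendsto_full) auto
      show "\<forall>\<^sub>F N in at_top. norm (partial N L) \<le> M * c"
      proof (rule eventually_at_top_linorderI[of 0])
        fix N :: real assume "0 \<le> N"
        hence "norm (partial N L) \<le> M * (pi / (2 * sqrt (1 + L)))" using L by (intro partial_bound) auto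
        also have "\<dots> \<le> M * c" unfolding c_def using L M_nonneg by (intro mult_left_mono divide_left_mono) auto
        finally show "norm (partial N L) \<le> M * c" .
      qed
    qed simp
    have comm: "R 0 \<odot> full L = full L \<odot> R 0"
      using L by (intro full_commute resolvent_commute) auto
    have "L *\<^sub>R (R 0 \<odot> (full L \<odot> full L)) - (pi\<^sup>2 / 4) *\<^sub>R R 0 = L *\<^sub>R (W \<odot> full L) + (L * c) *\<^sub>R W"
    proof -
      have "R 0 \<odot> (full L \<odot> full L) = (full L \<odot> R 0) \<odot> full L"
        by (metis blinfun_compose_assoc comm)
      moreover have "W \<odot> full L = (full L \<odot> R 0) \<odot> full L - c *\<^sub>R (full L \<odot> R 0)"
        unfolding W_def by (simp add: blinfun_compose.diff_left blinfun_compose.scaleR_left comm)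
      moreover have "(L * c) *\<^sub>R W = (L * c) *\<^sub>R (full L \<odot> R 0) - (L * c\<^sup>2) *\<^sub>R R 0"
        unfolding W_def by (simp add: algebra_simps power2_eq_square)
      ultimately show ?thesis unfolding c(2) by (simp only: scaleR_diff_right) simp
    qed
    hence "full 0 \<odot> full 0 - (pi\<^sup>2 / 4) *\<^sub>R R 0 = full L \<odot> full L + (L *\<^sub>R (W \<odot> full L) + (L * c) *\<^sub>R W)"
      using full_square[of L] L by (simp add: algebra_simps)
    also have "norm \<dots> \<le> (M * c) * (M * c) + (L * (((M / L) * c) * (M * c)) + (L * c) * ((M / L) * c))"
    proof (intro norm_triangle_mono)
      show "norm (full L \<odot> full L) \<le> (M * c) * (M * c)"
        using nF M_nonneg c by (intro order_trans[OF norm_blinfun_compose] mult_mono) auto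
      have "norm (W \<odot> full L) \<le> ((M / L) * c) * (M * c)"
        using nF W M_nonneg c L by (intro order_trans[OF norm_blinfun_compose] mult_mono) auto
      from mult_left_mono[OF this, of L]
      show "norm (L *\<^sub>R (W \<odot> full L)) \<le> L * (((M / L) * c) * (M * c))"
        using L by simp
      show "norm ((L * c) *\<^sub>R W) \<le> (L * c) * ((M / L) * c)"
        using mult_left_mono[OF W, of "L * c"] L c by simp
    qed
    also have "\<dots> = c\<^sup>2 * (2 * M\<^sup>2 + M)" using L by (simp add: field_simps power2_eq_square)
    also have "c\<^sup>2 = pi\<^sup>2 / 4 / L" using c(2) L by (simp add: field_simps)
    finally show ?thesis by simp
  qed
  have "norm (full 0 \<odot> full 0 - (pi\<^sup>2 / 4) *\<^sub>R R 0) \<le> 0"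
  proof (rule tendsto_lowerbound)
    show "((\<lambda>L. (pi\<^sup>2 / 4 * (2 * M\<^sup>2 + M)) / L) \<longlongrightarrow> 0) at_top"
      by (intro real_tendsto_divide_at_top[OF tendsto_const] filterlim_ident)
    show "\<forall>\<^sub>F L in at_top. norm (full 0 \<odot> full 0 - (pi\<^sup>2 / 4) *\<^sub>R R 0) \<le> (pi\<^sup>2 / 4 * (2 * M\<^sup>2 + M)) / L"
      using bound by (intro eventually_at_top_linorderI[of 1]) simp
  qed simp
  hence "full 0 \<odot> full 0 = (pi\<^sup>2 / 4) *\<^sub>R R 0" by simp
  thus ?thesis
    by (simp add: inv_sqrt_def blinfun_compose.scaleR_left blinfun_compose.scaleR_right power2_eq_square)
qed

lemma tendsto_inv_sqrt:
  "((\<lambda>N. integral {0..N} (\<lambda>s. R (s\<^sup>2) f)) \<longlongrightarrow> (pi / 2) *\<^sub>R inv_sqrt f) at_top"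
proof -
  have "integral {0..N} (\<lambda>s. R (s\<^sup>2) f) = partial N 0 f" for N
    unfolding partial_def
    using integral_linear[OF integrable_integrand[of 0 N] blinfun.bounded_linear_left[of f]]
    by (simp add: o_def)
  moreover have "((\<lambda>N. partial N 0 f) \<longlongrightarrow> full 0 f) at_top"
    by (intro blinfun.tendsto tendsto_full tendsto_const) simp
  ultimately show ?thesis by (simp add: inv_sqrt_def blinfun.scaleR_left)
qed

lemma has_integral_inv_sqrt:
  "((\<lambda>t. t powr (-1/2) *\<^sub>R R t f) has_integral pi *\<^sub>R inv_sqrt f) {0<..}"
proof -
  have "continuous_on {0..} (\<lambda>s. R (s\<^sup>2) f)"
    using continuous_integrand[of 0 "{0..}"] by (auto intro!: continuous_intros)
  from has_integral_powr_half[OF this tendsto_inv_sqrt]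
  have "((\<lambda>t. t powr (-1/2) *\<^sub>R R ((sqrt t)\<^sup>2) f) has_integral pi *\<^sub>R inv_sqrt f) {0<..}" by simp
  thus ?thesis by (rule has_integral_eq[rotated]) simp
qed

end

section \<open>Polynomials of operators and von Neumann's inequality\<close>

lemma poly_op_altdef:
  fixes C :: "'a::complex_inner \<Rightarrow> 'a"
  assumes "degree p \<le> n"
  shows "poly_op p C x = (\<Sum>i\<le>n. coeff p i *\<^sub>C (C ^^ i) x)"
  unfolding poly_op_def
  by (rule sum.mono_neutral_left) (use assms in \<open>auto simp: coeff_eq_0 scaleC.zero_left\<close>)

lemma bounded_linear_funpow:
  assumes "bounded_linear (C :: 'a::real_normed_vector \<Rightarrow> 'a)" shows "bounded_linear (C ^^ n)"
proof (induction n)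
  case (Suc n)
  show ?case using bounded_linear_compose[OF assms Suc] by (simp add: o_def)
qed (simp add: id_def)

lemma bounded_linear_poly_op:
  fixes C :: "'a::complex_inner \<Rightarrow> 'a"
  assumes "cbounded_linear C" shows "bounded_linear (poly_op p C)"
  unfolding poly_op_def[abs_def]
  by (intro bounded_linear_sum bounded_linear_compose[OF scaleC.bounded_linear_right]
      bounded_linear_funpow cbounded_linear_bounded_linear assms)

lemma poly_op_0: "poly_op 0 C x = (0::'a::complex_inner)"
  by (simp add: poly_op_def scaleC.zero_left)

lemma poly_op_pCons:
  fixes C :: "'a::complex_inner \<Rightarrow> 'a"
  assumes "cbounded_linear C"
  shows "poly_op (pCons a p) C x = a *\<^sub>C x + C (poly_op p C x)"
proof -
  interpret C: bounded_linear C by (rule cbounded_linear_bounded_linear[OF assms])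
  have "poly_op (pCons a p) C x = (\<Sum>i\<le>Suc (degree p). coeff (pCons a p) i *\<^sub>C (C ^^ i) x)"
    by (rule poly_op_altdef) (simp add: degree_pCons_le)
  also have "\<dots> = a *\<^sub>C x + (\<Sum>i\<le>degree p. coeff p i *\<^sub>C C ((C ^^ i) x))"
    by (subst sum.atMost_Suc_shift) simp
  finally show ?thesis
    by (simp add: poly_op_def C.sum cbounded_linear_scaleC[OF assms])
qed

lemma poly_op_add:
  fixes C :: "'a::complex_inner \<Rightarrow> 'a"
  shows "poly_op (p + q) C x = poly_op p C x + poly_op q C x"
proof -
  let ?n = "max (degree p) (degree q)"
  have "poly_op (p + q) C x = (\<Sum>i\<le>?n. coeff (p + q) i *\<^sub>C (C ^^ i) x)"
    by (rule poly_op_altdef) (rule degree_add_le_max)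
  thus ?thesis
    by (simp add: poly_op_altdef[of p ?n] poly_op_altdef[of q ?n] scaleC.add_left sum.distrib)
qed

lemma poly_op_smult:
  fixes C :: "'a::complex_inner \<Rightarrow> 'a"
  shows "poly_op (smult c p) C x = c *\<^sub>C poly_op p C x"
  by (subst poly_op_altdef[of _ "degree p"])
    (simp_all add: poly_op_def degree_smult_le scaleC.sum_right scaleC_scaleC)

lemma poly_op_mult:
  fixes C :: "'a::complex_inner \<Rightarrow> 'a"
  assumes "cbounded_linear C"
  shows "poly_op (p * q) C x = poly_op p C (poly_op q C x)"
proof (induction p)
  case (pCons a p)
  interpret C: bounded_linear C by (rule cbounded_linear_bounded_linear[OF assms])
  show ?case
    by (simp add: poly_op_add poly_op_smult poly_op_pCons[OF assms] pCons.IH mult_pCons_left scaleC.zero_left)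
qed (simp add: poly_op_0)

lemma poly_op_sum:
  fixes C :: "'a::complex_inner \<Rightarrow> 'a"
  shows "poly_op (sum p A) C x = (\<Sum>i\<in>A. poly_op (p i) C x)"
  by (induction A rule: infinite_finite_induct) (simp_all add: poly_op_0 poly_op_add)

lemma poly_op_monom:
  fixes C :: "'a::complex_inner \<Rightarrow> 'a"
  shows "poly_op (monom c n) C x = c *\<^sub>C (C ^^ n) x"
proof -
  have "poly_op (monom c n) C x = (\<Sum>i\<le>n. coeff (monom c n) i *\<^sub>C (C ^^ i) x)"
    by (rule poly_op_altdef) (rule degree_monom_le)
  also have "\<dots> = (\<Sum>i\<le>n. if i = n then c *\<^sub>C (C ^^ n) x else 0)"
    by (intro sum.cong) (auto simp: scaleC.zero_left)
  finally show ?thesis by simp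
qed

lemma bdd_above_poly_disc: "bdd_above ((\<lambda>z. cmod (poly p z)) ` cball 0 1)"
  by (intro compact_imp_bounded[THEN bounded_imp_bdd_above] compact_continuous_image continuous_intros) simp

lemma poly_le_SUP_disc: "cmod z \<le> 1 \<Longrightarrow> cmod (poly p z) \<le> (SUP z\<in>cball 0 1. cmod (poly p z))"
  by (rule cSUP_upper[OF _ bdd_above_poly_disc]) simp

section \<open>Finite Fourier transform and von Neumann's inequality\<close>

lemma root_of_unity_orthogonality:
  fixes N n m :: nat
  assumes "n < N" "m < N"
  defines "\<omega> \<equiv> exp (2 * of_real pi * \<i> / of_nat N)"
  shows "(\<Sum>k<N. \<omega> ^ (k * n) * cnj (\<omega> ^ (k * m))) = (if n = m then of_nat N else 0)"
proof -
  have w1: "\<omega> * cnj \<omega> = 1"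
  proof -
    have "cmod \<omega> = 1" by (simp add: \<omega>_def norm_exp_eq_Re)
    thus ?thesis by (simp add: complex_norm_square[symmetric])
  qed
  have N: "N > 0" using assms by simp
  have pw: "\<omega> ^ k = exp (2 * of_real pi * \<i> * of_nat k / of_nat N)" for k
    by (simp add: \<omega>_def exp_of_nat_mult[symmetric] mult_ac)
  have wN: "\<omega> ^ N = 1" unfolding pw using N by simp
  have main: "(\<Sum>k<N. \<omega> ^ (k * n) * cnj (\<omega> ^ (k * m))) = 0" if "m < n" "n < N" for n m
  proof -
    have t: "\<omega> ^ (k * n) * cnj (\<omega> ^ (k * m)) = (\<omega> ^ (n - m)) ^ k" for k
    proof -
      have "\<omega> ^ (k * n) = \<omega> ^ (k * m) * \<omega> ^ (k * (n - m))"
        using that by (simp add: power_add[symmetric] distrib_left[symmetric])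
      moreover have "\<omega> ^ (k * m) * cnj (\<omega> ^ (k * m)) = 1"
        by (simp add: power_mult_distrib[symmetric] w1)
      ultimately show ?thesis by (simp add: power_mult[symmetric] mult_ac)
    qed
    have ne: "\<omega> ^ (n - m) \<noteq> 1"
    proof
      assume "\<omega> ^ (n - m) = 1"
      hence "N dvd (n - m)" unfolding pw using N complex_root_unity_eq_1[of N "n - m"] by simp
      thus False using that by (auto dest: dvd_imp_le)
    qed
    have "(\<omega> ^ (n - m)) ^ N = 1" by (metis mult.commute power_mult power_one wN)
    thus ?thesis unfolding t using geometric_sum[OF ne, of N] by simp
  qed
  show ?thesis
  proof (cases n m rule: linorder_cases)
    case less
    have "(\<Sum>k<N. \<omega> ^ (k * n) * cnj (\<omega> ^ (k * m))) = cnj (\<Sum>k<N. \<omega> ^ (k * m) * cnj (\<omega> ^ (k * n)))"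
      by (simp add: mult.commute)
    also have "\<dots> = 0" using main[OF less assms(2)] by (simp only: complex_cnj_zero)
    finally show ?thesis using less by simp
  next
    case equal
    thus ?thesis by (simp add: power_mult_distrib[symmetric] w1)
  next
    case greater
    thus ?thesis using main[OF greater assms(1)] by simp
  qed
qed

lemma finite_Parseval:
  fixes g :: "nat \<Rightarrow> 'a::complex_inner" and N :: nat
  defines "\<omega> \<equiv> exp (2 * of_real pi * \<i> / of_nat N)"
  shows "(\<Sum>k<N. (norm (\<Sum>n<N. \<omega> ^ (k * n) *\<^sub>C g n))\<^sup>2) = N * (\<Sum>n<N. (norm (g n))\<^sup>2)"
proof -
  have "complex_of_real (\<Sum>k<N. (norm (\<Sum>n<N. \<omega> ^ (k * n) *\<^sub>C g n))\<^sup>2) =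
      (\<Sum>k<N. \<Sum>n<N. \<Sum>m<N. (\<omega> ^ (k * n) * cnj (\<omega> ^ (k * m))) * cinner (g n) (g m))"
    unfolding of_real_sum cinner_self[symmetric]
    unfolding cinner.sum_left unfolding cinner.sum_right
    by (simp add: cinner_scaleC_left cinner_scaleC_right mult_ac)
  also have "\<dots> = (\<Sum>n<N. \<Sum>k<N. \<Sum>m<N. (\<omega> ^ (k * n) * cnj (\<omega> ^ (k * m))) * cinner (g n) (g m))"
    by (rule sum.swap)
  also have "\<dots> = (\<Sum>n<N. \<Sum>m<N. \<Sum>k<N. (\<omega> ^ (k * n) * cnj (\<omega> ^ (k * m))) * cinner (g n) (g m))"
    by (intro sum.cong refl sum.swap)
  also have "\<dots> = (\<Sum>n<N. \<Sum>m<N. (if n = m then of_nat N else 0) * cinner (g n) (g m))"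
    using root_of_unity_orthogonality[of _ N] unfolding \<omega>_def
    by (intro sum.cong refl) (simp add: sum_distrib_right[symmetric])
  also have "\<dots> = (\<Sum>n<N. of_nat N * cinner (g n) (g n))"
  proof (intro sum.cong refl)
    fix n assume "n \<in> {..<N}"
    have "(\<Sum>m<N. (if n = m then of_nat N else 0) * cinner (g n) (g m)) =
      (\<Sum>m<N. if n = m then of_nat N * cinner (g n) (g n) else 0)" by (intro sum.cong) auto
    thus "(\<Sum>m<N. (if n = m then of_nat N else 0) * cinner (g n) (g m)) = of_nat N * cinner (g n) (g n)"
      using \<open>n \<in> {..<N}\<close> by simp
  qed
  also have "\<dots> = complex_of_real (N * (\<Sum>n<N. (norm (g n))\<^sup>2))"
    by (simp add: cinner_self sum_distrib_left)
  finally show ?thesis by (simp only: of_real_eq_iff)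
qed

text \<open>With the defect form \<open>q(y) = \<parallel>y\<parallel>\<^sup>2 - \<parallel>G y\<parallel>\<^sup>2 \<ge> 0\<close>, a strict contraction acts on the orbit
  \<open>(G\<^sup>n x)\<^sub>n\<close> as the backward shift, and \<open>\<Sum> q(G\<^sup>n y) = \<parallel>y\<parallel>\<^sup>2\<close>. The inequality is Parseval's identity
  for \<open>q\<close> on a long finite piece of the orbit.\<close>

lemma von_Neumann_strict:
  fixes G :: "'a::complex_inner \<Rightarrow> 'a"
  assumes G: "cbounded_linear G" and con: "\<And>x. norm (G x) \<le> r * norm x" and r: "0 \<le> r" "r < 1"
    and S: "\<And>z. cmod z = 1 \<Longrightarrow> cmod (poly p z) \<le> S"
  shows "norm (poly_op p G x) \<le> S * norm x"
proof -
  interpret G: bounded_linear G by (rule cbounded_linear_bounded_linear[OF G])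
  interpret P: bounded_linear "poly_op p G" by (rule bounded_linear_poly_op[OF G])
  define d where "d = degree p"
  define q where "q y = (norm y)\<^sup>2 - (norm (G y))\<^sup>2" for y
  have q0: "q y \<ge> 0" for y
  proof -
    have "norm (G y) \<le> norm y" using con[of y] r mult_right_mono[of r 1 "norm y"] by simp
    thus ?thesis by (simp add: q_def power_mono)
  qed
  have qs: "q (c *\<^sub>C y) = (cmod c)\<^sup>2 * q y" for c y
    by (simp add: q_def cbounded_linear_scaleC[OF G] norm_scaleC power_mult_distrib algebra_simps)
  have S0: "S \<ge> 0" using S[of 1] norm_ge_zero[of "poly p 1"] by (simp del: norm_ge_zero)
  have tel: "(\<Sum>n<k. q ((G ^^ n) y)) = (norm y)\<^sup>2 - (norm ((G ^^ k) y))\<^sup>2" for k y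
    by (induction k) (auto simp: q_def)
  have comm: "poly_op p G ((G ^^ n) y) = (G ^^ n) (poly_op p G y)" for n y
    using poly_op_mult[OF G, of p "monom 1 n" y] poly_op_mult[OF G, of "monom 1 n" p y]
    by (simp add: poly_op_monom scaleC_one mult.commute)
  have main: "(norm (poly_op p G x))\<^sup>2 - (norm ((G ^^ k) (poly_op p G x)))\<^sup>2 \<le> S\<^sup>2 * (norm x)\<^sup>2" for k
  proof -
    \<comment> \<open>The orbit piece has M terms, and convolving it with the d + 1 coefficients of
      p lengthens it by d. With N = M + d the cyclic convolution has no wrap-around.\<close>
    define M where "M = k + d"
    define N where "N = M + d"
    define \<omega> where "\<omega> = exp (2 * of_real pi * \<i> / of_nat N)"
    have w1: "cmod (\<omega> ^ j) = 1" for j by (simp add: \<omega>_def norm_exp_eq_Re norm_power)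
    \<comment> \<open>The orbit in reversed order, so that convolution with the coefficients applies
      p(G): a lower index means a higher power of G.\<close>
    define X where "X n = (if n < M then (G ^^ (M - 1 - n)) x else 0)" for n
    define Z where "Z m = (\<Sum>i\<le>d. coeff p i *\<^sub>C (if i \<le> m then X (m - i) else 0))" for m
    \<comment> \<open>\<open>q\<close> is a difference of squared norms of two linear images, so
      Parseval's identity holds for it too.\<close>
    have parq: "(\<Sum>j<N. q (\<Sum>n<N. \<omega> ^ (j * n) *\<^sub>C g n)) = N * (\<Sum>n<N. q (g n))" for g :: "nat \<Rightarrow> 'a"
      unfolding q_def sum_subtractf G.sum cbounded_linear_scaleC[OF G]
      using finite_Parseval[of N g] finite_Parseval[of N "\<lambda>n. G (g n)"]
      by (simp add: \<omega>_def right_diff_distrib)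
    have conv: "(\<Sum>m<N. \<omega> ^ (j * m) *\<^sub>C Z m) = poly p (\<omega> ^ j) *\<^sub>C (\<Sum>n<N. \<omega> ^ (j * n) *\<^sub>C X n)" for j
    proof -
      have "(\<Sum>m<N. \<omega> ^ (j * m) *\<^sub>C Z m) =
          (\<Sum>i\<le>d. \<Sum>m<N. coeff p i *\<^sub>C (\<omega> ^ (j * m) *\<^sub>C (if i \<le> m then X (m - i) else 0)))"
        unfolding Z_def scaleC.sum_right by (subst sum.swap) (simp add: scaleC_scaleC mult.commute)
      also have "\<dots> = (\<Sum>i\<le>d. (coeff p i * (\<omega> ^ j) ^ i) *\<^sub>C (\<Sum>n<N. \<omega> ^ (j * n) *\<^sub>C X n))"
      proof (intro sum.cong refl)
        fix i assume i: "i \<in> {..d}"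
        have "(\<Sum>m<N. \<omega> ^ (j * m) *\<^sub>C (if i \<le> m then X (m - i) else 0)) =
            (\<Sum>m\<in>{i..<i+M}. \<omega> ^ (j * m) *\<^sub>C X (m - i))"
          by (rule sum.mono_neutral_cong_right)
            (use i in \<open>auto simp: N_def X_def scaleC.zero_right\<close>)
        also have "\<dots> = (\<Sum>n<M. \<omega> ^ (j * (n + i)) *\<^sub>C X n)"
          using sum.shift_bounds_nat_ivl[of "\<lambda>m. \<omega> ^ (j * m) *\<^sub>C X (m - i)" 0 i M]
          by (simp add: add.commute lessThan_atLeast0)
        also have "\<dots> = (\<omega> ^ j) ^ i *\<^sub>C (\<Sum>n<M. \<omega> ^ (j * n) *\<^sub>C X n)"
          by (simp add: scaleC.sum_right scaleC_scaleC power_mult[symmetric] power_add[symmetric] algebra_simps)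
        also have "(\<Sum>n<M. \<omega> ^ (j * n) *\<^sub>C X n) = (\<Sum>n<N. \<omega> ^ (j * n) *\<^sub>C X n)"
          by (rule sum.mono_neutral_left) (auto simp: N_def X_def scaleC.zero_right)
        finally show "(\<Sum>m<N. coeff p i *\<^sub>C (\<omega> ^ (j * m) *\<^sub>C (if i \<le> m then X (m - i) else 0))) =
            (coeff p i * (\<omega> ^ j) ^ i) *\<^sub>C (\<Sum>n<N. \<omega> ^ (j * n) *\<^sub>C X n)"
          unfolding scaleC.sum_right[symmetric] by (simp only: scaleC_scaleC)
      qed
      also have "\<dots> = poly p (\<omega> ^ j) *\<^sub>C (\<Sum>n<N. \<omega> ^ (j * n) *\<^sub>C X n)"
        by (simp add: poly_altdef d_def scaleC.sum_left[symmetric])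
      finally show ?thesis .
    qed
    show ?thesis
    proof (cases "k = 0")
      case False
      hence Np: "N > 0" by (simp add: N_def M_def)
      have "real N * (\<Sum>m<N. q (Z m)) = (\<Sum>j<N. (cmod (poly p (\<omega> ^ j)))\<^sup>2 * q (\<Sum>n<N. \<omega> ^ (j * n) *\<^sub>C X n))"
        unfolding parq[symmetric] conv qs ..
      also have "\<dots> \<le> (\<Sum>j<N. S\<^sup>2 * q (\<Sum>n<N. \<omega> ^ (j * n) *\<^sub>C X n))"
        by (intro sum_mono mult_right_mono power_mono S w1 q0) auto
      also have "\<dots> = real N * (S\<^sup>2 * (\<Sum>n<N. q (X n)))"
        by (simp add: sum_distrib_left[symmetric] parq)
      finally have le: "(\<Sum>m<N. q (Z m)) \<le> S\<^sup>2 * (\<Sum>n<N. q (X n))"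
        using Np by simp
      have "(\<Sum>n<N. q (X n)) = (\<Sum>n<M. q ((G ^^ (M - 1 - n)) x))"
        by (rule sum.mono_neutral_cong_right) (auto simp: N_def X_def q_def G.zero)
      also have "\<dots> = (\<Sum>n<M. q ((G ^^ n) x))"
        using sum.nat_diff_reindex[of "\<lambda>n. q ((G ^^ n) x)" M] by simp
      also have "\<dots> \<le> (norm x)\<^sup>2" unfolding tel by simp
      finally have up: "(\<Sum>n<N. q (X n)) \<le> (norm x)\<^sup>2" .
      \<comment> \<open>For these k indices the convolution stays inside the orbit piece, free of
        edge effects.\<close>
      have Zp: "Z m = poly_op p G ((G ^^ (M - 1 - m)) x)" if "m \<in> {d..<M}" for m
      proof -
        have "coeff p i *\<^sub>C (if i \<le> m then X (m - i) else 0) = coeff p i *\<^sub>C (G ^^ i) ((G ^^ (M - 1 - m)) x)"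
          if "i \<in> {..d}" for i
        proof -
          have im: "i \<le> m" "m - i < M" and e: "M - 1 - (m - i) = i + (M - 1 - m)"
            using that \<open>m \<in> {d..<M}\<close> by auto
          have "X (m - i) = (G ^^ (i + (M - 1 - m))) x" using im(2) unfolding X_def e by simp
          thus ?thesis using im(1) by (simp add: funpow_add)
        qed
        thus ?thesis unfolding Z_def poly_op_def d_def[symmetric] by (intro sum.cong) auto
      qed
      have "(\<Sum>n<k. q ((G ^^ n) (poly_op p G x))) = (\<Sum>n<k. q (poly_op p G ((G ^^ (k - Suc n)) x)))"
        unfolding comm[symmetric]
        using sum.nat_diff_reindex[of "\<lambda>n. q (poly_op p G ((G ^^ n) x))" k] by simp
      also have "\<dots> = (\<Sum>m\<in>{d..<M}. q (Z m))"
      proof -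
        have "q (poly_op p G ((G ^^ (k - Suc n)) x)) = q (Z (n + d))" if "n < k" for n
          using Zp[of "n + d"] that by (simp add: M_def)
        thus ?thesis
          using sum.shift_bounds_nat_ivl[of "\<lambda>m. q (Z m)" 0 d k]
          by (simp add: M_def lessThan_atLeast0)
      qed
      also have "\<dots> \<le> (\<Sum>m<N. q (Z m))"
        by (rule sum_mono2) (auto simp: N_def q0)
      finally have "(norm (poly_op p G x))\<^sup>2 - (norm ((G ^^ k) (poly_op p G x)))\<^sup>2 \<le> (\<Sum>m<N. q (Z m))"
        unfolding tel .
      also note le
      also have "S\<^sup>2 * (\<Sum>n<N. q (X n)) \<le> S\<^sup>2 * (norm x)\<^sup>2"
        by (intro mult_left_mono up) auto
      finally show ?thesis .
    qed simp
  qed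
  \<comment> \<open>Strictness enters here: the norm subtracted in \<open>main\<close> tends to 0 as
    k grows.\<close>
  have pw: "norm ((G ^^ k) y) \<le> r ^ k * norm y" for k y
  proof (induction k)
    case (Suc k)
    have "norm ((G ^^ Suc k) y) \<le> r * norm ((G ^^ k) y)" using con by simp
    also have "\<dots> \<le> r * (r ^ k * norm y)" using r Suc by (intro mult_left_mono)
    finally show ?case by (simp add: mult_ac)
  qed simp
  have "(norm (poly_op p G x))\<^sup>2 \<le> S\<^sup>2 * (norm x)\<^sup>2"
  proof (rule tendsto_upperbound)
    have "(\<lambda>k. (norm ((G ^^ k) (poly_op p G x)))) \<longlonglongrightarrow> 0"
    proof (rule Lim_null_comparison)
      show "\<forall>\<^sub>F k in sequentially. norm (norm ((G ^^ k) (poly_op p G x))) \<le> r ^ k * norm (poly_op p G x)"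
        using pw by simp
      show "(\<lambda>k. r ^ k * norm (poly_op p G x)) \<longlonglongrightarrow> 0"
        using r by (intro tendsto_mult_left_zero LIMSEQ_power_zero) simp
    qed
    hence "(\<lambda>k. (norm (poly_op p G x))\<^sup>2 - (norm ((G ^^ k) (poly_op p G x)))\<^sup>2) \<longlonglongrightarrow> (norm (poly_op p G x))\<^sup>2 - 0\<^sup>2"
      by (intro tendsto_intros)
    thus "(\<lambda>k. (norm (poly_op p G x))\<^sup>2 - (norm ((G ^^ k) (poly_op p G x)))\<^sup>2) \<longlonglongrightarrow> (norm (poly_op p G x))\<^sup>2"
      by simp
  qed (use main in auto)
  hence "(norm (poly_op p G x))\<^sup>2 \<le> (S * norm x)\<^sup>2" by (simp add: power_mult_distrib)
  thus ?thesis by (rule power2_le_imp_le) (use S0 in auto)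
qed

text \<open>The strict case is applied to r G, and r increases to 1; for fixed p and x the
  polynomial is continuous in r.\<close>

theorem von_Neumann_inequality:
  fixes G :: "'a::complex_inner \<Rightarrow> 'a"
  assumes G: "cbounded_linear G" and con: "\<And>x. norm (G x) \<le> norm x"
  shows "norm (poly_op p G x) \<le> (SUP z\<in>cball 0 1. cmod (poly p z)) * norm x"
proof (rule tendsto_upperbound)
  let ?S = "SUP z\<in>cball 0 1. cmod (poly p z)"
  have pw: "((\<lambda>x. r *\<^sub>R G x) ^^ i) x = r ^ i *\<^sub>R (G ^^ i) x" for r i
  proof (induction i)
    case (Suc i)
    interpret G: bounded_linear G by (rule cbounded_linear_bounded_linear[OF G])
    show ?case by (simp add: Suc.IH G.scaleR)
  qed simp
  have "((\<lambda>r. norm (\<Sum>i\<le>degree p. coeff p i *\<^sub>C (r ^ i *\<^sub>R (G ^^ i) x))) \<longlongrightarrow>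
      norm (\<Sum>i\<le>degree p. coeff p i *\<^sub>C (1 ^ i *\<^sub>R (G ^^ i) x))) (at_left 1)"
    by (intro tendsto_intros scaleC.tendsto)
  thus "((\<lambda>r. norm (poly_op p (\<lambda>x. r *\<^sub>R G x) x)) \<longlongrightarrow> norm (poly_op p G x)) (at_left 1)"
    by (simp add: poly_op_def pw)
  show "\<forall>\<^sub>F r in at_left 1. norm (poly_op p (\<lambda>x. r *\<^sub>R G x) x) \<le> ?S * norm x"
    unfolding eventually_at_left_field
  proof (intro exI[of _ 0] conjI allI impI)
    fix r :: real assume r: "r > 0" "r < 1"
    show "norm (poly_op p (\<lambda>x. r *\<^sub>R G x) x) \<le> ?S * norm x"
    proof (rule von_Neumann_strict[where r = r])
      show "cbounded_linear (\<lambda>x. r *\<^sub>R G x)" by (rule cbounded_linear_scaledR[OF G])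
      show "norm (r *\<^sub>R G x) \<le> r * norm x" for x using con r by simp
      show "cmod (poly p z) \<le> ?S" if "cmod z = 1" for z using that by (intro poly_le_SUP_disc) simp
    qed (use r in auto)
  qed simp
qed simp

section \<open>Coercive operators relative to an embedding\<close>

text \<open>With \<open>Q = js j\<close> and \<open>L\<close> the operator on \<open>'h\<close> induced by the form \<open>\<langle>A u, v\<rangle>\<close>, one has
  \<open>(t + L)\<^sup>-\<^sup>1 = j (A + t Q)\<^sup>-\<^sup>1 js\<close>.\<close>

locale coercive_operator =
  fixes A :: "'v::chilbert_space \<Rightarrow> 'v" and j :: "'v \<Rightarrow> 'h::chilbert_space"
    and js :: "'h \<Rightarrow> 'v" and c :: real
  assumes A: "cbounded_linear A" and j: "cbounded_linear j" and js: "cbounded_linear js"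
    and adj: "\<And>u f. cinner (j u) f = cinner u (js f)"
    and c: "c > 0" and coer: "\<And>u. Re (cinner (A u) u) \<ge> c * (norm u)\<^sup>2"
begin

sublocale A: bounded_linear A by (rule cbounded_linear_bounded_linear[OF A])
sublocale j: bounded_linear j by (rule cbounded_linear_bounded_linear[OF j])
sublocale js: bounded_linear js by (rule cbounded_linear_bounded_linear[OF js])

definition Q :: "'v \<Rightarrow> 'v" where "Q u = js (j u)"

lemma cbounded_Q: "cbounded_linear Q"
  unfolding Q_def[abs_def] by (rule cbounded_linear_compose[OF js j])

sublocale Q: bounded_linear Q by (rule cbounded_linear_bounded_linear[OF cbounded_Q])

lemma adj': "cinner (js f) u = cinner f (j u)"
  by (metis adj cinner_commute)

lemma cinner_Q: "cinner (Q u) v = cinner (j u) (j v)"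
  by (simp add: Q_def adj')

lemma cinner_Q_right: "cinner u (Q v) = cinner (j u) (j v)"
  by (simp add: Q_def adj)

definition U :: "real \<Rightarrow> 'v \<Rightarrow> 'v" where
  "U t = inv (\<lambda>u. A u + t *\<^sub>R Q u)"

context
  fixes t :: real assumes t: "0 \<le> t"
begin

lemma cbounded_AQ: "cbounded_linear (\<lambda>u. A u + t *\<^sub>R Q u)"
  by (intro cbounded_linear_add A cbounded_linear_scaledR cbounded_Q)

lemma coer_AQ: "Re (cinner (A u + t *\<^sub>R Q u) u) \<ge> c * (norm u)\<^sup>2 + t * (norm (j u))\<^sup>2"
  using coer[of u] by (simp add: cinner.add_left cinner.scaleR_left cinner_Q cinner_self_Re)

lemma coer_AQ': "Re (cinner (A u + t *\<^sub>R Q u) u) \<ge> c * (norm u)\<^sup>2"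
  using coer_AQ[of u] t by (smt (verit) mult_nonneg_nonneg zero_le_power2)

lemmas lax = Lax_Milgram[OF cbounded_AQ c coer_AQ']

lemma cbounded_U: "cbounded_linear (U t)"
  unfolding U_def by (rule lax(2))

lemma norm_U: "norm (U t x) \<le> norm x / c"
  unfolding U_def by (rule lax(3))

lemma AQ_U: "A (U t x) + t *\<^sub>R Q (U t x) = x"
  using lax(1) unfolding U_def bij_def by (auto dest: surj_f_inv_f)

lemma U_AQ: "U t (A u + t *\<^sub>R Q u) = u"
  using lax(1) unfolding U_def bij_def by (auto dest: inv_f_f)

end

lemma bounded_linear_U: "0 \<le> t \<Longrightarrow> bounded_linear (U t)"
  by (rule cbounded_linear_bounded_linear[OF cbounded_U])

lemma U_add: "0 \<le> t \<Longrightarrow> U t (x + y) = U t x + U t y"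
  and U_diff: "0 \<le> t \<Longrightarrow> U t (x - y) = U t x - U t y"
  and U_scaleR: "0 \<le> t \<Longrightarrow> U t (r *\<^sub>R x) = r *\<^sub>R U t x"
  using bounded_linear_U[of t] by (auto simp: linear_simps)

lemma U_A: assumes "0 \<le> t" shows "U t (A u) = u - t *\<^sub>R U t (Q u)"
  using U_AQ[OF assms, of u] by (simp add: U_add U_scaleR assms algebra_simps)

lemma A_U: assumes "0 \<le> t" shows "A (U t x) = x - t *\<^sub>R Q (U t x)"
  using AQ_U[OF assms, of x] by (simp add: algebra_simps)

text \<open>Both sides are U Q - t U Q U Q, because A is (A + t Q) - t Q. This lets the factor A
  change sides, as the two square functions require.\<close>

lemma U_A_U_Q: assumes "0 \<le> t" shows "U t (A (U t (Q x))) = U t (Q (U t (A x)))"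
  using assms by (simp add: U_A U_diff U_scaleR Q.diff Q.scaleR)

lemma U_identity:
  assumes "0 \<le> s" "0 \<le> t" shows "U s x - U t x = (t - s) *\<^sub>R U s (Q (U t x))"
proof -
  have "U s x = U s (A (U t x) + s *\<^sub>R Q (U t x) + (t - s) *\<^sub>R Q (U t x))"
    using AQ_U[OF assms(2), of x] by (simp add: algebra_simps)
  also have "\<dots> = U t x + (t - s) *\<^sub>R U s (Q (U t x))"
    by (simp add: U_add[OF assms(1), of "A (U t x) + s *\<^sub>R Q (U t x)"] U_scaleR U_AQ assms)
  finally show ?thesis by simp
qed

text \<open>Testing (A + t Q) u = \<open>js f\<close> with u itself bounds
  \<open>c * (norm u)\<^sup>2 + t * (norm (j u))\<^sup>2\<close> by
  \<open>norm f * norm (j u)\<close>, which contains both estimates.\<close>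

lemma U_js_bounds:
  assumes t: "0 \<le> t"
  shows "t * norm (j (U t (js f))) \<le> norm f" and "c * t * (norm (U t (js f)))\<^sup>2 \<le> (norm f)\<^sup>2"
proof -
  let ?u = "U t (js f)"
  have "Re (cinner (js f) ?u) \<ge> c * (norm ?u)\<^sup>2 + t * (norm (j ?u))\<^sup>2"
    using coer_AQ[OF t, of ?u] by (simp add: AQ_U[OF t])
  moreover have "Re (cinner (js f) ?u) \<le> norm f * norm (j ?u)"
    unfolding adj' using Re_cinner_le abs_le_D1 by blast
  ultimately have *: "c * (norm ?u)\<^sup>2 + t * (norm (j ?u))\<^sup>2 \<le> norm f * norm (j ?u)" by linarith
  hence **: "t * (norm (j ?u))\<^sup>2 \<le> norm f * norm (j ?u)"
    using c by (smt (verit) mult_nonneg_nonneg zero_le_power2)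
  show first: "t * norm (j ?u) \<le> norm f"
  proof (cases "norm (j ?u) = 0")
    case False
    hence pos: "norm (j ?u) > 0" by simp
    have "(t * norm (j ?u)) * norm (j ?u) \<le> norm f * norm (j ?u)"
      using ** by (simp only: power2_eq_square mult.assoc)
    thus ?thesis using pos by (simp only: mult_le_cancel_right_pos)
  qed simp
  have "c * t * (norm ?u)\<^sup>2 = t * (c * (norm ?u)\<^sup>2)" by simp
  also have "\<dots> \<le> t * (norm f * norm (j ?u))"
    using * t by (intro mult_left_mono) (smt (verit) mult_nonneg_nonneg zero_le_power2, simp)
  also have "\<dots> = norm f * (t * norm (j ?u))" by simp
  also have "\<dots> \<le> norm f * norm f" by (intro mult_left_mono first) simp
  finally show "c * t * (norm ?u)\<^sup>2 \<le> (norm f)\<^sup>2" by (simp add: power2_eq_square)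
qed

section \<open>Differentiation in s = sqrt t, in operator norm\<close>

definition P :: "real \<Rightarrow> 'v \<Rightarrow>\<^sub>L 'v" where "P s = Blinfun (U (s\<^sup>2))"
definition q :: "'v \<Rightarrow>\<^sub>L 'v" where "q = Blinfun Q"

lemma P_apply [simp]: "P s x = U (s\<^sup>2) x"
  unfolding P_def by (simp add: bounded_linear_Blinfun_apply bounded_linear_U)

lemma q_apply [simp]: "q x = Q x"
  unfolding q_def by (simp add: bounded_linear_Blinfun_apply Q.bounded_linear_axioms)

lemma norm_P: "norm (P s) \<le> 1 / c"
  by (rule norm_blinfun_bound) (use c norm_U[of "s\<^sup>2"] in auto)

lemma P_identity: "P s - P r = (r\<^sup>2 - s\<^sup>2) *\<^sub>R (P s \<odot> q \<odot> P r)"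
  by (rule blinfun_eqI) (simp add: blinfun.diff_left blinfun.scaleR_left U_identity)

lemma continuous_on_P: "continuous_on S P"
proof -
  have "isCont P s" for s
    unfolding isCont_def
  proof (rule LIM_zero_cancel, rule Lim_null_comparison)
    show "\<forall>\<^sub>F x in at s. norm (P x - P s) \<le> \<bar>s\<^sup>2 - x\<^sup>2\<bar> * (1 / c * norm q * (1 / c))"
    proof (intro always_eventually allI)
      fix x
      have "norm (P x \<odot> q \<odot> P s) \<le> (1 / c * norm q) * (1 / c)"
        using norm_P[of x] norm_P[of s] c
        by (intro order_trans[OF norm_blinfun_compose] mult_mono order_trans[OF norm_blinfun_compose]
            mult_right_mono) auto
      thus "norm (P x - P s) \<le> \<bar>s\<^sup>2 - x\<^sup>2\<bar> * (1 / c * norm q * (1 / c))"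
        unfolding P_identity norm_scaleR real_norm_def by (intro mult_left_mono) auto
    qed
    show "((\<lambda>x. \<bar>s\<^sup>2 - x\<^sup>2\<bar> * (1 / c * norm q * (1 / c))) \<longlongrightarrow> 0) (at s)"
      by (rule tendsto_eq_intros refl | simp)+
  qed
  thus ?thesis by (simp add: continuous_at_imp_continuous_on)
qed

lemma P_has_vector_derivative:
  "(P has_vector_derivative (- (2 * s)) *\<^sub>R (P s \<odot> (q \<odot> P s))) (at s within T)"
proof -
  have "(P has_vector_derivative (- (s + s)) *\<^sub>R (P s \<odot> q \<odot> P s)) (at s within T)"
  proof (rule has_vector_derivative_Caratheodory[where g = "\<lambda>y. (- (y + s)) *\<^sub>R (P y \<odot> q \<odot> P s)"])
    show "P y - P s = (y - s) *\<^sub>R (- (y + s)) *\<^sub>R (P y \<odot> q \<odot> P s)" for y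
      unfolding P_identity by (simp add: algebra_simps power2_eq_square)
    have "continuous_on UNIV (\<lambda>y. (- (y + s)) *\<^sub>R (P y \<odot> q \<odot> P s))"
      by (intro continuous_intros continuous_on_P blinfun_compose.continuous_on)
    thus "continuous (at s within T) (\<lambda>y. (- (y + s)) *\<^sub>R (P y \<odot> q \<odot> P s))"
      by (simp add: continuous_on_eq_continuous_at continuous_at_imp_continuous_at_within)
  qed
  thus ?thesis by (simp add: blinfun_compose_assoc)
qed

lemma continuous_on_U_square: "continuous_on S g \<Longrightarrow> continuous_on S (\<lambda>s. U (s\<^sup>2) (g s))"
  using blinfun.continuous_on[OF continuous_on_P, of S g] by simp

text \<open>The scalar identity behind this is \<open>1/(s\<^sup>2 + z) = 16 s\<^sup>4 z/(s\<^sup>2 + z)\<^sup>4 + d/ds(\<dots>)\<close>.\<close>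

lemma integral_U_by_parts:
  fixes b :: 'v
  defines "e1 \<equiv> \<lambda>s. U (s\<^sup>2) (Q (U (s\<^sup>2) b))"
  defines "e2 \<equiv> \<lambda>s. U (s\<^sup>2) (Q (e1 s))"
  assumes N: "0 \<le> N"
  shows "integral {0..N} (\<lambda>s. U (s\<^sup>2) b) =
     N *\<^sub>R U (N\<^sup>2) b + (2/3 * N ^ 3) *\<^sub>R e1 N - (8/3 * N ^ 5) *\<^sub>R e2 N
     + 16 *\<^sub>R integral {0..N} (\<lambda>s. s ^ 4 *\<^sub>R U (s\<^sup>2) (A (U (s\<^sup>2) (Q (e1 s)))))"
proof -
  define E1 where "E1 s = P s \<odot> (q \<odot> P s)" for s
  define E2 where "E2 s = P s \<odot> (q \<odot> E1 s)" for s
  define E3 where "E3 s = P s \<odot> (q \<odot> E2 s)" for s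
  note d0 = P_has_vector_derivative[folded E1_def]
  have comp: "((\<lambda>s. P s \<odot> (q \<odot> F s)) has_vector_derivative
      P s \<odot> (q \<odot> F') + ((- (2 * s)) *\<^sub>R E1 s) \<odot> (q \<odot> F s)) (at s within T)"
    if "(F has_vector_derivative F') (at s within T)" for F F' s T
    by (intro blinfun_compose.has_vector_derivative d0
        bounded_linear.has_vector_derivative[OF blinfun_compose.bounded_linear_right] that)
  have d1: "(E1 has_vector_derivative (- (4 * s)) *\<^sub>R E2 s) (at s within T)" for s T
    unfolding E1_def[abs_def]
    by (rule has_vector_derivative_eq_rhs[OF comp[OF d0]])
      (simp only: E1_def E2_def blinfun_compose_assoc blinfun_compose.scaleR_left
        blinfun_compose.scaleR_right scaleR_add_left[symmetric], simp)
  have d2: "(E2 has_vector_derivative (- (6 * s)) *\<^sub>R E3 s) (at s within T)" for s T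
    unfolding E2_def[abs_def]
    by (rule has_vector_derivative_eq_rhs[OF comp[OF d1]])
      (simp only: E1_def E2_def E3_def blinfun_compose_assoc blinfun_compose.scaleR_left
        blinfun_compose.scaleR_right scaleR_add_left[symmetric], simp)
  \<comment> \<open>The coefficient 2/3 cancels the \<open>E1\<close> term of the derivative. Then
    8/3 is the only value for which the \<open>E2\<close> and \<open>E3\<close> terms combine to a
    multiple of \<open>E2 s b - s\<^sup>2 *\<^sub>R E3 s b\<close>, which carries a factor
    A.\<close>
  let ?B = "\<lambda>s. s *\<^sub>R P s b + ((2/3 * s ^ 3) *\<^sub>R E1 s b - (8/3 * s ^ 5) *\<^sub>R E2 s b)"
  have db: "((\<lambda>s. F s b) has_vector_derivative F' b) (at s within T)"
    if "(F has_vector_derivative F') (at s within T)" for F :: "real \<Rightarrow> 'v \<Rightarrow>\<^sub>L 'v" and F' s T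
    by (rule bounded_linear.has_vector_derivative[OF blinfun.bounded_linear_left that])
  have "((\<lambda>s. P s b - (16 * s ^ 4) *\<^sub>R (E2 s b - s\<^sup>2 *\<^sub>R E3 s b)) has_integral (?B N - ?B 0)) {0..N}"
  proof (rule fundamental_theorem_of_calculus)
    fix s
    show "(?B has_vector_derivative P s b - (16 * s ^ 4) *\<^sub>R (E2 s b - s\<^sup>2 *\<^sub>R E3 s b)) (at s within {0..N})"
    proof (rule has_vector_derivative_eq_rhs)
      show "(?B has_vector_derivative
        (s *\<^sub>R (((- (2 * s)) *\<^sub>R E1 s) b) + 1 *\<^sub>R P s b) +
        (((2/3 * s ^ 3) *\<^sub>R (((- (4 * s)) *\<^sub>R E2 s) b) + (2 * s\<^sup>2) *\<^sub>R E1 s b) -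
         ((8/3 * s ^ 5) *\<^sub>R (((- (6 * s)) *\<^sub>R E3 s) b) + (40/3 * s ^ 4) *\<^sub>R E2 s b))) (at s within {0..N})"
        by (intro has_vector_derivative_add has_vector_derivative_diff has_vector_derivative_scaleR db d0 d1 d2)
          (auto intro!: derivative_eq_intros)
        have "2/3 * s ^ 3 * (4 * s) + 40/3 * s ^ 4 = 16 * s ^ 4" "8/3 * s ^ 5 * (6 * s) = 16 * s ^ 4 * s\<^sup>2"
          "s * (2 * s) = 2 * s\<^sup>2"
          by (simp_all add: power2_eq_square power3_eq_cube power4_eq_xxxx numeral_eq_Suc)
        note h = this
        have "(2/3 * s ^ 3) *\<^sub>R (- (4 * s)) *\<^sub>R E2 s b - (40/3 * s ^ 4) *\<^sub>R E2 s b = - ((16 * s ^ 4) *\<^sub>R E2 s b)"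
          unfolding h(1)[symmetric] by (simp add: algebra_simps)
        moreover have "(8/3 * s ^ 5) *\<^sub>R (- (6 * s)) *\<^sub>R E3 s b = - ((16 * s ^ 4) *\<^sub>R s\<^sup>2 *\<^sub>R E3 s b)"
          unfolding scaleR_scaleR h(2)[symmetric] by simp
        moreover have "s *\<^sub>R (- (2 * s)) *\<^sub>R E1 s b = - ((2 * s\<^sup>2) *\<^sub>R E1 s b)"
          unfolding scaleR_scaleR h(3)[symmetric] by simp
        ultimately show "(s *\<^sub>R (((- (2 * s)) *\<^sub>R E1 s) b) + 1 *\<^sub>R P s b) +
        (((2/3 * s ^ 3) *\<^sub>R (((- (4 * s)) *\<^sub>R E2 s) b) + (2 * s\<^sup>2) *\<^sub>R E1 s b) -
         ((8/3 * s ^ 5) *\<^sub>R (((- (6 * s)) *\<^sub>R E3 s) b) + (40/3 * s ^ 4) *\<^sub>R E2 s b)) =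
          P s b - (16 * s ^ 4) *\<^sub>R (E2 s b - s\<^sup>2 *\<^sub>R E3 s b)"
          by (simp only: blinfun.scaleR_left scaleR_diff_right scaleR_one) (simp add: algebra_simps)
    qed
  qed (use N in auto)
  moreover have "E1 s b = e1 s" "E2 s b = e2 s" "E3 s b = U (s\<^sup>2) (Q (e2 s))" for s
    by (simp_all add: E1_def E2_def E3_def e1_def e2_def)
  moreover have "e2 s - s\<^sup>2 *\<^sub>R U (s\<^sup>2) (Q (e2 s)) = U (s\<^sup>2) (A (U (s\<^sup>2) (Q (e1 s))))" for s
    by (simp add: e2_def U_A)
  ultimately have 1: "((\<lambda>s. U (s\<^sup>2) b - (16 * s ^ 4) *\<^sub>R U (s\<^sup>2) (A (U (s\<^sup>2) (Q (e1 s)))))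
      has_integral (N *\<^sub>R U (N\<^sup>2) b + ((2/3 * N ^ 3) *\<^sub>R e1 N - (8/3 * N ^ 5) *\<^sub>R e2 N))) {0..N}"
    by simp
  have ct: "continuous_on {0..N} (\<lambda>s. U (s\<^sup>2) (A (U (s\<^sup>2) (Q (e1 s)))))"
    unfolding e1_def by (intro continuous_on_U_square A.continuous_on Q.continuous_on continuous_intros)
  have 2: "((\<lambda>s. 16 *\<^sub>R (s ^ 4 *\<^sub>R U (s\<^sup>2) (A (U (s\<^sup>2) (Q (e1 s))))))
      has_integral 16 *\<^sub>R integral {0..N} (\<lambda>s. s ^ 4 *\<^sub>R U (s\<^sup>2) (A (U (s\<^sup>2) (Q (e1 s)))))) {0..N}"
    by (intro has_integral_cmul integrable_integral integrable_continuous_real continuous_intros ct)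
  from integral_unique[OF has_integral_add[OF 1 2]] show ?thesis by (simp add: algebra_simps)
qed

text \<open>The norm of s^2 (s^2 + L)^(-1) f in \<open>'h\<close> never exceeds that of f, and the
  derivative of its square dominates 4 c times the integrand, by coercivity.\<close>

lemma energy_estimate:
  assumes N: "0 \<le> N"
  shows "integral {0..N} (\<lambda>s. s ^ 5 * (norm (U (s\<^sup>2) (Q (U (s\<^sup>2) (js f)))))\<^sup>2) \<le> (norm f)\<^sup>2 / (4 * c)"
proof -
  define z where "z s = U (s\<^sup>2) (Q (U (s\<^sup>2) (js f)))" for s
  define u where "u s = U (s\<^sup>2) (js f)" for s
  define p where "p s = u s - s\<^sup>2 *\<^sub>R z s" for s
  define w where "w s = s\<^sup>2 *\<^sub>R j (u s)" for s
  define \<phi>' where "\<phi>' s = 4 * s ^ 3 * Re (cinner (j (p s)) (j (u s)))" for s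
  have cz: "continuous_on S z" and cu: "continuous_on S u" for S
    unfolding z_def u_def by (intro continuous_on_U_square Q.continuous_on continuous_intros)+
  have du: "(u has_vector_derivative (- (2 * s)) *\<^sub>R z s) (at s within T)" for s T
    using bounded_linear.has_vector_derivative[OF blinfun.bounded_linear_left P_has_vector_derivative,
        of "js f" s T]
    by (simp add: u_def[abs_def] z_def blinfun.scaleR_left blinfun.minus_left)
  have dw: "(w has_vector_derivative (2 * s) *\<^sub>R j (p s)) (at s within T)" for s T
  proof -
    have "(w has_vector_derivative (s\<^sup>2 *\<^sub>R j ((- (2 * s)) *\<^sub>R z s) + (2 * s) *\<^sub>R j (u s))) (at s within T)"
      unfolding w_def[abs_def]
      by (intro has_vector_derivative_scaleR j.has_vector_derivative du)
        (auto intro!: derivative_eq_intros)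
    thus ?thesis by (simp add: p_def j.diff j.scaleR j.neg algebra_simps)
  qed
  have d\<phi>: "((\<lambda>s. (norm (w s))\<^sup>2) has_vector_derivative \<phi>' s) (at s within T)" for s T
  proof -
    have "((\<lambda>s. Re (cinner (w s) (w s))) has_vector_derivative
        Re (cinner (w s) ((2 * s) *\<^sub>R j (p s)) + cinner ((2 * s) *\<^sub>R j (p s)) (w s))) (at s within T)"
      by (intro bounded_linear.has_vector_derivative[OF bounded_linear_Re] cinner.has_vector_derivative dw)
    moreover have "Re (cinner (w s) ((2 * s) *\<^sub>R j (p s)) + cinner ((2 * s) *\<^sub>R j (p s)) (w s)) = \<phi>' s"
      using Re_cinner_commute[of "j (u s)" "j (p s)"]
      by (simp add: w_def \<phi>'_def cinner.scaleR_left cinner.scaleR_right power2_eq_square power3_eq_cube)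
    ultimately show ?thesis by (simp add: cinner_self_Re)
  qed
  have int: "(\<phi>' has_integral ((norm (w N))\<^sup>2 - (norm (w 0))\<^sup>2)) {0..N}"
    by (rule fundamental_theorem_of_calculus) (use N d\<phi> in auto)
  have le: "4 * c * (s ^ 5 * (norm (z s))\<^sup>2) \<le> \<phi>' s" if "0 \<le> s" for s
  proof -
    \<comment> \<open>This is where coercivity can act: the pairing of \<open>j (p s)\<close> with
      \<open>j (z s)\<close> becomes the form at \<open>z s\<close>.\<close>
    have Az: "A (z s) = Q (p s)"
      by (simp add: z_def p_def u_def A_U Q.diff Q.scaleR)
    have "cinner (j (p s)) (j (u s)) = cinner (j (p s)) (j (p s)) + s\<^sup>2 *\<^sub>R cinner (j (p s)) (j (z s))"
      by (simp add: p_def j.diff j.scaleR cinner.diff_right cinner.scaleR_right)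
    also have "cinner (j (p s)) (j (z s)) = cinner (A (z s)) (z s)"
      by (simp add: Az cinner_Q)
    finally have "Re (cinner (j (p s)) (j (u s))) = (norm (j (p s)))\<^sup>2 + s\<^sup>2 * Re (cinner (A (z s)) (z s))"
      by (simp add: cinner_self_Re)
    also have "\<dots> \<ge> s\<^sup>2 * (c * (norm (z s))\<^sup>2)"
      using mult_left_mono[OF coer[of "z s"], of "s\<^sup>2"] by (simp add: add_increasing)
    finally have "4 * s ^ 3 * (s\<^sup>2 * (c * (norm (z s))\<^sup>2)) \<le> \<phi>' s"
      unfolding \<phi>'_def using that by (intro mult_left_mono) auto
    moreover have "s ^ 5 = s ^ 3 * s\<^sup>2" by (simp add: power_add[symmetric])
    ultimately show ?thesis by (simp only: mult_ac)
  qed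
  have iz: "(\<lambda>s. s ^ 5 * (norm (z s))\<^sup>2) integrable_on {0..N}"
    by (intro integrable_continuous_real continuous_intros cz)
  have "4 * c * integral {0..N} (\<lambda>s. s ^ 5 * (norm (z s))\<^sup>2) = integral {0..N} (\<lambda>s. 4 * c * (s ^ 5 * (norm (z s))\<^sup>2))"
    by (simp add: integral_mult_right)
  also have "\<dots> \<le> integral {0..N} \<phi>'"
    by (rule integral_le) (use iz int le in \<open>auto simp: has_integral_integrable intro!: integrable_on_mult_right\<close>)
  also have "\<dots> = (norm (w N))\<^sup>2 - (norm (w 0))\<^sup>2" using int by (rule integral_unique)
  also have "\<dots> \<le> (norm f)\<^sup>2"
    using U_js_bounds(1)[of "N\<^sup>2" f] by (simp add: w_def u_def power_mono)
  finally show ?thesis using c by (simp add: z_def field_simps)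
qed

section \<open>The pseudo-resolvent on \<open>'h\<close> and its square root\<close>

definition Rh :: "real \<Rightarrow> 'h \<Rightarrow>\<^sub>L 'h" where "Rh t = Blinfun (\<lambda>f. j (U t (js f)))"
text \<open>The product bounds \<open>Rh t\<close> uniformly and the summand 1 bounds t times
  \<open>Rh t\<close>; their sum gives the decay in t.\<close>

definition Mh :: real where "Mh = norm (Blinfun j) * (norm (Blinfun js) / c) + 1"

lemma Rh_apply: "0 \<le> t \<Longrightarrow> Rh t f = j (U t (js f))"
  unfolding Rh_def
  by (simp add: bounded_linear_Blinfun_apply
      bounded_linear_compose[OF j.bounded_linear_axioms bounded_linear_compose[OF bounded_linear_U js.bounded_linear_axioms]])

sublocale H: pseudo_resolvent Rh Mh
proof
  fix s t :: real assume st: "0 \<le> s" "0 \<le> t"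
  show "Rh s - Rh t = (t - s) *\<^sub>R (Rh s \<odot> Rh t)"
  proof (rule blinfun_eqI)
    fix f
    have "j (U s (js f)) - j (U t (js f)) = j (U s (js f) - U t (js f))" by (simp add: j.diff)
    thus "(Rh s - Rh t) f = ((t - s) *\<^sub>R (Rh s \<odot> Rh t)) f"
      using st by (simp add: blinfun.diff_left blinfun.scaleR_left Rh_apply U_identity j.scaleR Q_def)
  qed
next
  fix t :: real assume t: "0 \<le> t"
  show "norm (Rh t) \<le> Mh / (1 + t)"
  proof (rule norm_blinfun_bound)
    show "0 \<le> Mh / (1 + t)" using c t by (auto simp: Mh_def intro!: divide_nonneg_nonneg add_nonneg_nonneg mult_nonneg_nonneg)
    fix f
    have "norm (j (U t (js f))) \<le> norm (Blinfun j) * norm (U t (js f))"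
      using norm_blinfun[of "Blinfun j" "U t (js f)"] by (simp add: bounded_linear_Blinfun_apply j.bounded_linear_axioms)
    also have "\<dots> \<le> norm (Blinfun j) * (norm (Blinfun js) * norm f / c)"
    proof (intro mult_left_mono)
      have "norm (js f) \<le> norm (Blinfun js) * norm f"
        using norm_blinfun[of "Blinfun js" f] by (simp add: bounded_linear_Blinfun_apply js.bounded_linear_axioms)
      thus "norm (U t (js f)) \<le> norm (Blinfun js) * norm f / c"
        using norm_U[OF t, of "js f"] c by (smt (verit) divide_right_mono)
    qed simp
    finally have "norm (j (U t (js f))) + t * norm (j (U t (js f))) \<le> Mh * norm f"
      using U_js_bounds(1)[OF t, of f] by (simp add: Mh_def algebra_simps)
    thus "norm (Rh t f) \<le> Mh / (1 + t) * norm f"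
      using t by (simp add: Rh_apply field_simps)
  qed
qed

text \<open>Elements of the \<open>blinfun\<close> type are real linear. Complex linearity follows
  because multiplication by a complex scalar commutes with every \<open>Rh t\<close>, hence with the
  integral.\<close>

lemma cbounded_inv_sqrt: "cbounded_linear H.inv_sqrt"
  unfolding cbounded_linear_iff
proof (intro conjI allI)
  show "H.inv_sqrt (z *\<^sub>C x) = z *\<^sub>C H.inv_sqrt x" for z x
  proof -
    let ?Z = "Blinfun (\<lambda>x::'h. z *\<^sub>C x)"
    have Z: "?Z y = z *\<^sub>C y" for y by (simp add: bounded_linear_Blinfun_apply scaleC.bounded_linear_right)
    have "?Z \<odot> H.inv_sqrt = H.inv_sqrt \<odot> ?Z"
    proof (rule H.inv_sqrt_commute)
      fix t :: real assume t: "0 \<le> t"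
      show "?Z \<odot> Rh t = Rh t \<odot> ?Z"
        by (rule blinfun_eqI) (simp add: Z Rh_apply t cbounded_linear_scaleC[OF js]
            cbounded_linear_scaleC[OF j] cbounded_linear_scaleC[OF cbounded_U[OF t]])
    qed
    from arg_cong[OF this, of "\<lambda>B. blinfun_apply B x"] show ?thesis by (simp add: Z)
  qed
qed (rule blinfun.bounded_linear_right)

end

section \<open>Positive operators and their square roots\<close>

lemma positive_op_inverse:
  fixes S :: "'a::chilbert_space \<Rightarrow> 'a"
  assumes "positive_op S"
  shows "positive_op (inv S)" and "S (inv S x) = x" and "inv S (S x) = x"
proof -
  obtain c where c: "c > 0" "\<And>u. Re (cinner (S u) u) \<ge> c * (norm u)\<^sup>2"
    using assms by (auto simp: positive_op_def)
  have S: "cbounded_linear S" and sa: "\<And>u v. cinner (S u) v = cinner u (S v)"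
    using assms by (auto simp: positive_op_def selfadjoint_op_def)
  note lax = Lax_Milgram[OF S c]
  show SS: "S (inv S x) = x" for x using lax(1) by (simp add: bij_is_surj surj_f_inv_f)
  show "inv S (S x) = x" using lax(1) by (simp add: bij_is_inj)
  obtain K where K: "K > 0" "\<And>x. norm (S x) \<le> K * norm x"
    using cbounded_linear_pos_bound[OF S] by blast
  \<comment> \<open>With w = \<open>inv S u\<close> the left side is the form of S at w, at least c
    times the squared norm of w, and the norm of u is at most K times that of w.\<close>
  have "Re (cinner (inv S u) u) \<ge> (c / K\<^sup>2) * (norm u)\<^sup>2" for u
  proof -
    have "norm u \<le> K * norm (inv S u)" using K(2)[of "inv S u"] by (simp add: SS)
    hence "(norm u)\<^sup>2 \<le> K\<^sup>2 * (norm (inv S u))\<^sup>2"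
      by (metis norm_ge_zero power_mono power_mult_distrib)
    hence "(c / K\<^sup>2) * (norm u)\<^sup>2 \<le> (c / K\<^sup>2) * (K\<^sup>2 * (norm (inv S u))\<^sup>2)"
      using c K by (intro mult_left_mono) auto
    also have "\<dots> = c * (norm (inv S u))\<^sup>2" using K by simp
    also have "\<dots> \<le> Re (cinner (S (inv S u)) (inv S u))" by (rule c)
    finally show ?thesis by (simp add: SS Re_cinner_commute)
  qed
  moreover have "cinner (inv S u) v = cinner u (inv S v)" for u v
    using sa[of "inv S u" "inv S v"] by (simp add: SS)
  ultimately show "positive_op (inv S)"
    unfolding positive_op_def selfadjoint_op_def using lax(2) c K by (auto intro!: exI[of _ "c / K\<^sup>2"])
qed

text \<open>Take \<open>inv S\<close> as the coercive operator and the identity as the embedding.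
  The operator L is then \<open>inv S\<close>, so \<open>H.inv_sqrt\<close> is the square root of
  S.\<close>

lemma positive_op_sqrt:
  fixes S :: "'a::chilbert_space \<Rightarrow> 'a"
  assumes S: "positive_op S"
  shows "\<exists>D D' :: 'a \<Rightarrow> 'a. cbounded_linear D \<and> cbounded_linear D' \<and> (\<forall>x. D (D' x) = x) \<and> (\<forall>x. D' (D x) = x)
    \<and> (\<forall>x. (norm (D x))\<^sup>2 = Re (cinner (S x) x))"
proof -
  note inv = positive_op_inverse[OF S]
  obtain c where c: "c > 0" "\<And>u. Re (cinner (inv S u) u) \<ge> c * (norm u)\<^sup>2"
    using inv(1) by (auto simp: positive_op_def)
  have iS: "cbounded_linear (inv S)" and isa: "\<And>u v. cinner (inv S u) v = cinner u (inv S v)"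
    using inv(1) by (auto simp: positive_op_def selfadjoint_op_def)
  interpret coercive_operator "inv S" "\<lambda>x. x" "\<lambda>x. x" c
    by unfold_locales (use c iS cbounded_linear_ident in auto)
  have Q: "Q u = u" for u by (simp add: Q_def)
  have R0: "Rh 0 x = S x" for x
  proof -
    have "U 0 x = S x"
      using U_AQ[OF order_refl, of "S x"] unfolding inv(3) scaleR_zero_left add_0_right .
    thus ?thesis unfolding Rh_apply[OF order_refl] .
  qed
  have Usa: "cinner (U t x) y = cinner x (U t y)" if "0 \<le> t" for t x y
  proof -
    have "cinner (U t x) (inv S (U t y) + t *\<^sub>R Q (U t y)) = cinner (inv S (U t x) + t *\<^sub>R Q (U t x)) (U t y)"
      by (simp add: Q cinner.add_left cinner.add_right cinner.scaleR_left cinner.scaleR_right isa)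
    thus ?thesis by (simp only: AQ_U[OF that])
  qed
  let ?D = "blinfun_apply H.inv_sqrt"
  have DD: "?D (?D x) = S x" for x
    using arg_cong[OF H.inv_sqrt_square, of "\<lambda>B. blinfun_apply B x"] by (simp add: R0)
  have Dsa: "cinner (?D x) y = cinner x (?D y)" for x y
  proof -
    have ii: "(\<lambda>s. Rh (s\<^sup>2) z) integrable_on {0..N}" for z N
      using H.continuous_integrand[of 0 "{0..N}"]
      by (auto intro!: integrable_continuous_real continuous_intros)
    have eq: "cinner (integral {0..N} (\<lambda>s. Rh (s\<^sup>2) x)) y = cinner x (integral {0..N} (\<lambda>s. Rh (s\<^sup>2) y))" for N
    proof -
      have "cinner (integral {0..N} (\<lambda>s. Rh (s\<^sup>2) x)) y = integral {0..N} (\<lambda>s. cinner (Rh (s\<^sup>2) x) y)"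
        using integral_linear[OF ii cinner.bounded_linear_left] by (simp add: o_def)
      also have "\<dots> = integral {0..N} (\<lambda>s. cinner x (Rh (s\<^sup>2) y))"
        by (simp add: Rh_apply Usa)
      also have "\<dots> = cinner x (integral {0..N} (\<lambda>s. Rh (s\<^sup>2) y))"
        using integral_linear[OF ii cinner.bounded_linear_right] by (simp add: o_def)
      finally show ?thesis .
    qed
    have "cinner ((pi / 2) *\<^sub>R ?D x) y = cinner x ((pi / 2) *\<^sub>R ?D y)"
    proof (rule tendsto_unique)
      show "((\<lambda>N. cinner (integral {0..N} (\<lambda>s. Rh (s\<^sup>2) x)) y) \<longlongrightarrow> cinner ((pi / 2) *\<^sub>R ?D x) y) at_top"
        by (intro cinner.tendsto H.tendsto_inv_sqrt tendsto_const)
      show "((\<lambda>N. cinner (integral {0..N} (\<lambda>s. Rh (s\<^sup>2) x)) y) \<longlongrightarrow> cinner x ((pi / 2) *\<^sub>R ?D y)) at_top"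
        unfolding eq by (intro cinner.tendsto H.tendsto_inv_sqrt tendsto_const)
    qed simp
    thus ?thesis by (simp add: cinner.scaleR_left cinner.scaleR_right)
  qed
  let ?D' = "\<lambda>x. ?D (inv S x)"
  have D1: "?D (?D' x) = x" for x by (simp add: DD inv)
  have inj: "x = y" if "?D x = ?D y" for x y
    using that DD inv(3) by metis
  have D2: "?D' (?D x) = x" for x
    by (rule inj) (rule D1)
  have "(norm (?D x))\<^sup>2 = Re (cinner (S x) x)" for x
    unfolding cinner_self_Re[symmetric] by (simp add: Dsa DD Re_cinner_commute[of x])
  moreover have "cbounded_linear ?D'"
    by (rule cbounded_linear_compose[OF cbounded_inv_sqrt iS])
  ultimately show ?thesis using cbounded_inv_sqrt D1 D2 by blast
qed

section \<open>The Kato property from square function estimates\<close>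

text \<open>The later bounds rest on 2 a b \<le> a^2 + b^2 and are therefore not homogeneous; this
  restores homogeneity.\<close>

lemma unit_ball_bound:
  fixes F :: "'a::real_normed_vector \<Rightarrow> 'b::real_normed_vector"
  assumes sc: "\<And>r x. F (r *\<^sub>R x) = r *\<^sub>R F x" and b: "\<And>x. norm x \<le> 1 \<Longrightarrow> norm (F x) \<le> M"
  shows "norm (F x) \<le> M * norm x"
proof (cases "x = 0")
  case True
  thus ?thesis using sc[of 0 x] by simp
next
  case False
  have "norm (F (inverse (norm x) *\<^sub>R x)) \<le> M" by (rule b) (use False in simp)
  thus ?thesis using False by (simp add: sc field_simps)
qed

locale form_pair =
  fixes T :: "'v::chilbert_space \<Rightarrow> 'v" and j :: "'v \<Rightarrow> 'h::chilbert_space" and js :: "'h \<Rightarrow> 'v"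
  assumes T: "selfadjoint_op T" and jb: "cbounded_linear j" and jsb: "cbounded_linear js"
    and jadj: "\<And>u f. cinner (j u) f = cinner u (js f)"
    and inj: "inj j" and dense: "closure (range j) = UNIV"
begin

definition A :: "'v \<Rightarrow> 'v" where "A u = u + \<i> *\<^sub>C T u"
definition As :: "'v \<Rightarrow> 'v" where "As u = u - \<i> *\<^sub>C T u"

lemma T_bounded: "cbounded_linear T" and T_sym: "cinner (T u) v = cinner u (T v)"
  using T by (auto simp: selfadjoint_op_def)

lemma T_real: "Im (cinner (T u) u) = 0"
  using arg_cong[OF trans[OF T_sym cinner_commute], of Im u u] by simp

lemma Re_cinner_A: "Re (cinner (A u) u) = (norm u)\<^sup>2" and Re_cinner_As: "Re (cinner (As u) u) = (norm u)\<^sup>2"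
  by (simp_all add: A_def As_def cinner.add_left cinner.diff_left cinner_scaleC_left cinner_self_Re T_real)

lemma A_bounded: "cbounded_linear A" and As_bounded: "cbounded_linear As"
  unfolding A_def[abs_def] As_def[abs_def]
  by (intro cbounded_linear_add cbounded_linear_diff cbounded_linear_ident cbounded_linear_scaled T_bounded)+

sublocale coercive_operator A j js 1
  by unfold_locales (auto simp: A_bounded jb jsb jadj Re_cinner_A)

sublocale adj: coercive_operator As j js 1
  by unfold_locales (auto simp: As_bounded jb jsb jadj Re_cinner_As)

text \<open>On V, U Q is (t + L)^(-1) and U A is L (t + L)^(-1), so \<open>W t\<close> is L (t +
  L)^(-2); \<open>Ws t\<close> is its adjoint for the inner product of V.\<close>

abbreviation W where "W t v \<equiv> U t (Q (U t (A v)))"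
abbreviation Ws where "Ws t v \<equiv> As (adj.U t (Q (adj.U t v)))"

lemma cinner_A: "cinner (A u) v = cinner u (As v)"
  by (simp add: A_def As_def cinner.add_left cinner.diff_right cinner_scaleC_left cinner_scaleC_right T_sym)

lemma cinner_Q_swap: "cinner (Q u) v = cinner u (Q v)"
  by (simp add: cinner_Q cinner_Q_right)

lemma cinner_U:
  assumes t: "0 \<le> t" shows "cinner (U t x) y = cinner x (adj.U t y)"
proof -
  have "cinner (U t x) (As (adj.U t y) + t *\<^sub>R Q (adj.U t y)) = cinner (A (U t x) + t *\<^sub>R Q (U t x)) (adj.U t y)"
    by (simp add: cinner.add_left cinner.add_right cinner.scaleR_left cinner.scaleR_right cinner_A cinner_Q_swap)
  thus ?thesis by (simp only: AQ_U[OF t] adj.AQ_U[OF t])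
qed

lemma j_eq_0: "j u = 0 \<Longrightarrow> u = 0"
  using injD[OF inj, of u 0] by (simp add: j.zero)

lemma js_eq_0: assumes "js f = 0" shows "f = 0"
proof -
  have "closed {h. cinner f h = 0}"
    by (intro closed_Collect_eq continuous_intros cinner.continuous_on)
  moreover have "range j \<subseteq> {h. cinner f h = 0}"
    using assms by (auto simp: cinner.zero_left simp flip: adj')
  ultimately have "closure (range j) \<subseteq> {h. cinner f h = 0}" by (simp add: closure_minimal)
  hence "cinner f f = 0" using dense by auto
  thus ?thesis by (simp add: cinner_eq_zero_iff)
qed

lemma js_inject: "js f = js g \<Longrightarrow> f = g"
  using js_eq_0[of "f - g"] by (simp add: js.diff)

lemma Q_eq_0: "Q u = 0 \<Longrightarrow> u = 0"
  unfolding Q_def by (rule j_eq_0[OF js_eq_0])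

lemma inv_sqrt_twice: "H.inv_sqrt (H.inv_sqrt f) = j (U 0 (js f))"
  using arg_cong[OF H.inv_sqrt_square, of "\<lambda>B. blinfun_apply B f"] by (simp add: Rh_apply)

text \<open>The adjoint, Q times the inverse of \<open>As\<close>, is injective.\<close>

lemma dense_range_UQ: "closure (range (\<lambda>v. U 0 (Q v))) = UNIV"
proof (rule dense_range)
  show "cbounded_linear (\<lambda>v. U 0 (Q v))"
    by (intro cbounded_linear_compose[OF cbounded_U cbounded_Q]) simp
  fix y assume "\<And>w. cinner (U 0 (Q w)) y = 0"
  hence "cinner (Q (adj.U 0 y)) w = 0" for w
    by (metis cinner_Q_swap cinner_U cinner_commute complex_cnj_zero order_refl)
  hence "Q (adj.U 0 y) = 0" by (intro cinner_ext_left) (simp add: cinner.zero_left)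
  hence "adj.U 0 y = 0" by (rule Q_eq_0)
  thus "y = 0" using adj.AQ_U[of 0 y] by (simp add: adj.A.zero)
qed

definition \<alpha> :: real where "\<alpha> = (SOME K. K > 0 \<and> (\<forall>x. norm (A x) \<le> K * norm x \<and> norm (Q x) \<le> K * norm x))"

lemma \<alpha>: "\<alpha> > 0" "norm (A x) \<le> \<alpha> * norm x" "norm (Q x) \<le> \<alpha> * norm x"
proof -
  obtain K where K: "K > 0" "\<And>x. norm (A x) \<le> K * norm x" using cbounded_linear_pos_bound[OF A_bounded] by blast
  obtain K' where K': "K' > 0" "\<And>x. norm (Q x) \<le> K' * norm x" using cbounded_linear_pos_bound[OF cbounded_Q] by blast
  have "norm (A x) \<le> max K K' * norm x \<and> norm (Q x) \<le> max K K' * norm x" for x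
    using K(2)[of x] K'(2)[of x] mult_right_mono[of K "max K K'" "norm x"] mult_right_mono[of K' "max K K'" "norm x"]
    by simp
  hence "\<exists>K. K > 0 \<and> (\<forall>x. norm (A x) \<le> K * norm x \<and> norm (Q x) \<le> K * norm x)"
    using K(1) by (intro exI[of _ "max K K'"]) auto
  from someI_ex[OF this] show "\<alpha> > 0" "norm (A x) \<le> \<alpha> * norm x" "norm (Q x) \<le> \<alpha> * norm x"
    unfolding \<alpha>_def by blast+
qed

lemma norm_U1: "0 \<le> t \<Longrightarrow> norm (U t x) \<le> norm x"
  using norm_U[of t x] by simp

lemma norm_tUQ: assumes "0 \<le> t" shows "norm (t *\<^sub>R U t (Q x)) \<le> (1 + \<alpha>) * norm x"
proof -
  have "t *\<^sub>R U t (Q x) = x - U t (A x)" using assms by (simp add: U_A)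
  also have "norm \<dots> \<le> norm x + norm (U t (A x))" by (rule norm_triangle_ineq4)
  also have "norm (U t (A x)) \<le> \<alpha> * norm x" using norm_U1[OF assms] \<alpha>(2) order_trans by blast
  finally show ?thesis by (simp add: algebra_simps)
qed

text \<open>The equation for \<open>?u\<close> is tested with \<open>?u\<close>, as in
  \<open>U_js_bounds\<close>, now with right-hand side A x. It serves the boundary terms of
  \<open>integral_jUA_bounded\<close>.\<close>

lemma norm_jUA: assumes "0 \<le> s" shows "s * norm (j (U (s\<^sup>2) (A x))) \<le> \<alpha> * norm x"
proof -
  let ?u = "U (s\<^sup>2) (A x)"
  have "(norm ?u)\<^sup>2 + s\<^sup>2 * (norm (j ?u))\<^sup>2 \<le> Re (cinner (A x) ?u)"
    using coer_AQ[of "s\<^sup>2" ?u] by (simp add: AQ_U)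
  also have "\<dots> \<le> norm (A x) * norm ?u" using Re_cinner_le abs_le_D1 by blast
  also have "\<dots> \<le> (\<alpha> * norm x) * (\<alpha> * norm x)"
    using \<alpha>(1) \<alpha>(2)[of x] norm_U1[of "s\<^sup>2" "A x"] by (intro mult_mono) auto
  finally have "s\<^sup>2 * (norm (j ?u))\<^sup>2 \<le> (\<alpha> * norm x) * (\<alpha> * norm x)"
    by (smt (verit) zero_le_power2)
  hence "(s * norm (j ?u))\<^sup>2 \<le> (\<alpha> * norm x)\<^sup>2" by (simp add: power2_eq_square mult_ac)
  thus ?thesis by (rule power2_le_imp_le) (use \<alpha>(1) in simp)
qed

lemma norm_sU_js: assumes "0 \<le> s" shows "s * norm (U (s\<^sup>2) (js f)) \<le> norm f"
proof -
  have "(s * norm (U (s\<^sup>2) (js f)))\<^sup>2 \<le> (norm f)\<^sup>2"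
    using U_js_bounds(2)[of "s\<^sup>2" f] by (simp add: power_mult_distrib)
  thus ?thesis by (rule power2_le_imp_le) simp
qed

lemma UQ_decay: "norm (U (s\<^sup>2) (Q w)) \<le> ((1 + 2 * \<alpha>) * norm w) / (1 + s\<^sup>2)"
proof -
  have "norm (U (s\<^sup>2) (Q w)) \<le> \<alpha> * norm w" using norm_U1[of "s\<^sup>2" "Q w"] \<alpha>(3)[of w] by simp
  moreover have "s\<^sup>2 * norm (U (s\<^sup>2) (Q w)) \<le> (1 + \<alpha>) * norm w" using norm_tUQ[of "s\<^sup>2" w] by simp
  ultimately have "norm (U (s\<^sup>2) (Q w)) * (1 + s\<^sup>2) \<le> (1 + 2 * \<alpha>) * norm w" by (simp add: algebra_simps)
  thus ?thesis by (simp add: pos_le_divide_eq add_pos_nonneg)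
qed

lemma integrable_U: "(\<lambda>s. U (s\<^sup>2) b) integrable_on {0..N}"
  by (intro integrable_continuous_real continuous_on_U_square continuous_intros)

text \<open>The weight \<open>s ^ 4\<close> is shared between the weight \<open>s ^ 5\<close> of the
  energy estimate and the weight \<open>s ^ 3\<close> of the square function; in t = s^2 these
  correspond to t^2 dt and t dt.\<close>

lemma integral_product_bound:
  fixes p q :: "real \<Rightarrow> 'v" and h :: "real \<Rightarrow> complex"
  assumes c: "continuous_on {0..N} h" "continuous_on {0..N} p" "continuous_on {0..N} q"
    and h: "\<And>s. 0 \<le> s \<Longrightarrow> cmod (h s) \<le> s ^ 4 * (norm (p s) * norm (q s))"
    and p: "integral {0..N} (\<lambda>s. s ^ 5 * (norm (p s))\<^sup>2) \<le> a"
    and q: "integral {0..N} (\<lambda>s. s ^ 3 * (norm (q s))\<^sup>2) \<le> b"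
  shows "cmod (integral {0..N} h) \<le> (a + b) / 2"
proof -
  have i1: "(\<lambda>s. s ^ 5 * (norm (p s))\<^sup>2) integrable_on {0..N}" "(\<lambda>s. s ^ 3 * (norm (q s))\<^sup>2) integrable_on {0..N}"
    by (intro integrable_continuous_real continuous_intros c)+
  have "cmod (integral {0..N} h) \<le> integral {0..N} (\<lambda>s. (s ^ 5 * (norm (p s))\<^sup>2 + s ^ 3 * (norm (q s))\<^sup>2) / 2)"
  proof (rule integral_norm_bound_integral)
    show "h integrable_on {0..N}" by (intro integrable_continuous_real c)
    show "(\<lambda>s. (s ^ 5 * (norm (p s))\<^sup>2 + s ^ 3 * (norm (q s))\<^sup>2) / 2) integrable_on {0..N}"
      by (intro integrable_continuous_real continuous_intros c) simp
    fix s assume "s \<in> {0..N}"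
    hence s: "0 \<le> s" by simp
    have "0 \<le> s ^ 3 * (s * norm (p s) - norm (q s))\<^sup>2" using s by simp
    also have "\<dots> = s ^ 5 * (norm (p s))\<^sup>2 + s ^ 3 * (norm (q s))\<^sup>2 - 2 * (s ^ 4 * (norm (p s) * norm (q s)))"
      by (simp add: power2_eq_square algebra_simps numeral_eq_Suc)
    finally show "cmod (h s) \<le> (s ^ 5 * (norm (p s))\<^sup>2 + s ^ 3 * (norm (q s))\<^sup>2) / 2"
      using h[OF s] by simp
  qed
  also have "\<dots> = (integral {0..N} (\<lambda>s. s ^ 5 * (norm (p s))\<^sup>2) + integral {0..N} (\<lambda>s. s ^ 3 * (norm (q s))\<^sup>2)) / 2"
    using i1 by (simp add: Henstock_Kurzweil_Integration.integral_add)
  also have "\<dots> \<le> (a + b) / 2" using p q by simp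
  finally show ?thesis .
qed

context
  fixes M :: real
  assumes sq: "\<And>v N. 0 \<le> N \<Longrightarrow>
      integral {0..N} (\<lambda>s. s ^ 3 * (norm (W (s\<^sup>2) v))\<^sup>2) \<le> M * (norm v)\<^sup>2"
    and sq_adj: "\<And>v N. 0 \<le> N \<Longrightarrow>
      integral {0..N} (\<lambda>s. s ^ 3 * (norm (Ws (s\<^sup>2) v))\<^sup>2) \<le> M * (norm v)\<^sup>2"
begin

text \<open>The boundary terms of \<open>integral_U_by_parts\<close>, with 2/3 and 8/3 rounded up to
  1 and 3, and 16 times the bound of \<open>integral_product_bound\<close> for energy 1/4 and square
  function \<open>\<bar>M\<bar>\<close>.\<close>

abbreviation "K1 \<equiv> 1 + (1 + \<alpha>) + 3 * (1 + \<alpha>)\<^sup>2 + 16 * ((1/4 + \<bar>M\<bar>) / 2)"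
abbreviation "K2 \<equiv> \<alpha> + \<alpha> * (1 + \<alpha>) + 3 * (\<alpha> * (1 + \<alpha>)\<^sup>2) + 16 * (\<alpha> * ((1/4 + \<bar>M\<bar>) / 2))"

lemma M_bound: assumes "norm (v::'v) \<le> 1" shows "M * (norm v)\<^sup>2 \<le> \<bar>M\<bar>"
proof -
  have "M * (norm v)\<^sup>2 \<le> \<bar>M\<bar> * (norm v)\<^sup>2" by (intro mult_right_mono) auto
  also have "\<dots> \<le> \<bar>M\<bar> * 1" using assms by (intro mult_left_mono) (auto simp: power_le_one)
  finally show ?thesis by simp
qed

text \<open>Tested against w in V, the integrand left by the integration by parts splits as
  \<open>?z s\<close> against \<open>Ws (s\<^sup>2) w\<close>: the energy estimate controls the
  first factor, the adjoint square function the second.\<close>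

lemma integral_U_js_bounded:
  assumes N: "0 \<le> N"
  shows "norm (integral {0..N} (\<lambda>s. U (s\<^sup>2) (js f))) \<le> K1 * norm f"
proof (rule unit_ball_bound)
  show "integral {0..N} (\<lambda>s. U (s\<^sup>2) (js (r *\<^sub>R f))) = r *\<^sub>R integral {0..N} (\<lambda>s. U (s\<^sup>2) (js f))" for r f
    by (simp add: js.scaleR U_scaleR)
next
  fix f :: 'h assume f: "norm f \<le> 1"
  let ?z = "\<lambda>s. U (s\<^sup>2) (Q (U (s\<^sup>2) (js f)))"
  let ?m = "integral {0..N} (\<lambda>s. s ^ 4 *\<^sub>R U (s\<^sup>2) (A (U (s\<^sup>2) (Q (?z s)))))"
  have b0: "N * norm (U (N\<^sup>2) (js f)) \<le> 1" using norm_sU_js[OF N, of f] f by simp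
  have b1: "norm (N ^ 3 *\<^sub>R ?z N) \<le> 1 + \<alpha>"
  proof -
    have "norm (N ^ 3 *\<^sub>R ?z N) = N * norm (N\<^sup>2 *\<^sub>R ?z N)"
      using N by (simp add: power2_eq_square power3_eq_cube)
    also have "\<dots> \<le> N * ((1 + \<alpha>) * norm (U (N\<^sup>2) (js f)))"
      using N by (intro mult_left_mono norm_tUQ) auto
    also have "\<dots> = (1 + \<alpha>) * (N * norm (U (N\<^sup>2) (js f)))" by simp
    also have "\<dots> \<le> (1 + \<alpha>) * 1" using b0 \<alpha>(1) by (intro mult_left_mono) auto
    finally show ?thesis by simp
  qed
  have b2: "norm (N ^ 5 *\<^sub>R U (N\<^sup>2) (Q (?z N))) \<le> (1 + \<alpha>)\<^sup>2"
  proof -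
    have eq: "N ^ 5 *\<^sub>R U (N\<^sup>2) (Q (?z N)) = N\<^sup>2 *\<^sub>R U (N\<^sup>2) (Q (N ^ 3 *\<^sub>R ?z N))"
      by (simp add: Q.scaleR U_scaleR)
    have "(1 + \<alpha>) * norm (N ^ 3 *\<^sub>R ?z N) \<le> (1 + \<alpha>) * (1 + \<alpha>)"
      by (rule mult_left_mono[OF b1]) (use \<alpha>(1) in simp)
    from order_trans[OF norm_tUQ[OF zero_le_power2] this] show ?thesis
      unfolding eq power2_eq_square[of "1 + \<alpha>"] .
  qed
  have cz: "continuous_on {0..N} ?z" by (intro continuous_on_U_square Q.continuous_on continuous_intros)
  have main: "norm ?m \<le> (1/4 + \<bar>M\<bar>) / 2"
  proof (rule norm_le_by_cinner)
    fix w :: 'v assume w: "norm w \<le> 1"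
    let ?y = "\<lambda>s. Ws (s\<^sup>2) w"
    have eq: "cinner (U (s\<^sup>2) (A (U (s\<^sup>2) (Q x)))) w = cinner x (?y s)" for x s
      by (simp add: U_A_U_Q cinner_U cinner_Q_swap cinner_A)
    have "cinner ?m w = integral {0..N} (\<lambda>s. cinner (s ^ 4 *\<^sub>R U (s\<^sup>2) (A (U (s\<^sup>2) (Q (?z s))))) w)"
      using integral_linear[OF _ cinner.bounded_linear_left, of "\<lambda>s. s ^ 4 *\<^sub>R U (s\<^sup>2) (A (U (s\<^sup>2) (Q (?z s))))" "{0..N}" w]
      by (simp add: o_def integrable_continuous_real continuous_on_scaleR continuous_on_power continuous_on_id
          continuous_on_U_square A.continuous_on Q.continuous_on cz)
    also have "\<dots> = integral {0..N} (\<lambda>s. s ^ 4 *\<^sub>R cinner (?z s) (?y s))"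
      by (simp add: cinner.scaleR_left eq)
    also have "cmod \<dots> \<le> (1/4 + \<bar>M\<bar>) / 2"
    proof (rule integral_product_bound[where p = ?z and q = ?y])
      show cy: "continuous_on {0..N} ?y"
        by (intro adj.A.continuous_on adj.continuous_on_U_square Q.continuous_on continuous_intros)
      show "continuous_on {0..N} (\<lambda>s. s ^ 4 *\<^sub>R cinner (?z s) (?y s))"
        by (intro continuous_intros cinner.continuous_on cz cy)
      show "cmod (s ^ 4 *\<^sub>R cinner (?z s) (?y s)) \<le> s ^ 4 * (norm (?z s) * norm (?y s))" for s
        by (simp add: cinner_Cauchy_Schwarz mult_left_mono)
      have "(norm f)\<^sup>2 \<le> 1" using f by (simp add: power_le_one)
      thus "integral {0..N} (\<lambda>s. s ^ 5 * (norm (?z s))\<^sup>2) \<le> 1/4"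
        using energy_estimate[OF N, of f] by simp
      show "integral {0..N} (\<lambda>s. s ^ 3 * (norm (?y s))\<^sup>2) \<le> \<bar>M\<bar>"
        using sq_adj[OF N, of w] M_bound[OF w] by linarith
    qed (rule cz)
    finally show "cmod (cinner ?m w) \<le> (1/4 + \<bar>M\<bar>) / 2" .
  qed simp
  have eq: "integral {0..N} (\<lambda>s. U (s\<^sup>2) (js f)) =
      N *\<^sub>R U (N\<^sup>2) (js f) + (2/3) *\<^sub>R (N ^ 3 *\<^sub>R ?z N) - (8/3) *\<^sub>R (N ^ 5 *\<^sub>R U (N\<^sup>2) (Q (?z N))) + 16 *\<^sub>R ?m"
    unfolding integral_U_by_parts[OF N] by simp
  have "norm (integral {0..N} (\<lambda>s. U (s\<^sup>2) (js f))) \<le> 1 + 2/3 * (1 + \<alpha>) + 8/3 * (1 + \<alpha>)\<^sup>2 + 16 * ((1/4 + \<bar>M\<bar>) / 2)"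
    unfolding eq
  proof (intro norm_triangle_mono norm_triangle_le_diff add_mono)
    show "norm (N *\<^sub>R U (N\<^sup>2) (js f)) \<le> 1" using b0 N by simp
    show "norm ((2/3) *\<^sub>R (N ^ 3 *\<^sub>R ?z N)) \<le> 2/3 * (1 + \<alpha>)" using b1 by simp
    show "norm ((8/3) *\<^sub>R (N ^ 5 *\<^sub>R U (N\<^sup>2) (Q (?z N)))) \<le> 8/3 * (1 + \<alpha>)\<^sup>2" using b2 by simp
    show "norm (16 *\<^sub>R ?m) \<le> 16 * ((1/4 + \<bar>M\<bar>) / 2)" using main by simp
  qed
  moreover have "1 + 2/3 * (1 + \<alpha>) + 8/3 * (1 + \<alpha>)\<^sup>2 + 16 * ((1/4 + \<bar>M\<bar>) / 2) \<le>
      K1"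
  proof -
    have "1 + 2/3 * x + 8/3 * y + z \<le> 1 + x + 3 * y + z" if "0 \<le> x" "0 \<le> y" for x y z :: real
      using that by simp
    from this[of "1 + \<alpha>"] show ?thesis using \<alpha>(1) by simp
  qed
  ultimately show "norm (integral {0..N} (\<lambda>s. U (s\<^sup>2) (js f))) \<le> K1"
    by (rule order_trans)
qed

text \<open>Mirror image of the previous bound. Tested against g in \<open>'h\<close>, the integrand
  splits as A applied to \<open>W (s\<^sup>2) v\<close> against the energy term of the adjoint form
  at g.\<close>

lemma integral_jUA_bounded:
  assumes N: "0 \<le> N"
  shows "norm (integral {0..N} (\<lambda>s. j (U (s\<^sup>2) (A v)))) \<le>
    K2 * norm v"
proof (rule unit_ball_bound)
  show "integral {0..N} (\<lambda>s. j (U (s\<^sup>2) (A (r *\<^sub>R v)))) = r *\<^sub>R integral {0..N} (\<lambda>s. j (U (s\<^sup>2) (A v)))" for r v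
    by (simp add: A.scaleR U_scaleR j.scaleR)
next
  fix v :: 'v assume v: "norm v \<le> 1"
  let ?p = "\<lambda>s. W (s\<^sup>2) v"
  let ?x1 = "N\<^sup>2 *\<^sub>R U (N\<^sup>2) (Q v)"
  let ?x2 = "N\<^sup>2 *\<^sub>R U (N\<^sup>2) (Q ?x1)"
  let ?m = "integral {0..N} (\<lambda>s. s ^ 4 *\<^sub>R U (s\<^sup>2) (A (U (s\<^sup>2) (Q (?p s)))))"
  have n1: "norm ?x1 \<le> 1 + \<alpha>"
  proof -
    have "(1 + \<alpha>) * norm v \<le> (1 + \<alpha>) * 1" using v \<alpha>(1) by (intro mult_left_mono) auto
    from order_trans[OF norm_tUQ[OF zero_le_power2] this] show ?thesis by simp
  qed
  have n2: "norm ?x2 \<le> (1 + \<alpha>)\<^sup>2"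
  proof -
    have "norm ?x2 \<le> (1 + \<alpha>) * norm ?x1" by (rule norm_tUQ) simp
    also have "\<dots> \<le> (1 + \<alpha>) * (1 + \<alpha>)" using n1 \<alpha>(1) by (intro mult_left_mono) auto
    finally show ?thesis by (simp add: power2_eq_square)
  qed
  have jb: "N * norm (j (U (N\<^sup>2) (A x))) \<le> \<alpha> * b" if "norm x \<le> b" for x b
    by (rule order_trans[OF norm_jUA[OF N]]) (use that \<alpha>(1) in simp)
  \<comment> \<open>Moves A to the left, so that \<open>norm_jUA\<close> bounds the boundary terms
    in \<open>'h\<close> uniformly in N.\<close>
  have e1: "N ^ 3 *\<^sub>R ?p N = N *\<^sub>R U (N\<^sup>2) (A ?x1)"
    by (simp add: U_A_U_Q[symmetric] A.scaleR U_scaleR power2_eq_square power3_eq_cube)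
  have e2: "N ^ 5 *\<^sub>R U (N\<^sup>2) (Q (?p N)) = N *\<^sub>R U (N\<^sup>2) (A ?x2)"
  proof -
    have h: "N ^ 5 = N * (N\<^sup>2 * N\<^sup>2)" by (simp add: numeral_eq_Suc)
    show ?thesis
      by (simp only: h U_A_U_Q[OF zero_le_power2, symmetric] A.scaleR Q.scaleR
          U_scaleR[OF zero_le_power2] scaleR_scaleR)
  qed
  have cp: "continuous_on {0..N} ?p" by (intro continuous_on_U_square Q.continuous_on continuous_intros)
  have im: "(\<lambda>s. s ^ 4 *\<^sub>R U (s\<^sup>2) (A (U (s\<^sup>2) (Q (?p s))))) integrable_on {0..N}"
    by (intro integrable_continuous_real continuous_on_scaleR continuous_on_power continuous_on_id
          continuous_on_U_square A.continuous_on Q.continuous_on cp)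
  have main: "norm (j ?m) \<le> \<alpha> * ((1/4 + \<bar>M\<bar>) / 2)"
  proof (rule norm_le_by_cinner)
    fix g :: 'h assume g: "norm g \<le> 1"
    let ?y = "\<lambda>s. adj.U (s\<^sup>2) (Q (adj.U (s\<^sup>2) (js g)))"
    have eq: "cinner (U (s\<^sup>2) (A (U (s\<^sup>2) (Q x)))) (js g) = cinner (A x) (?y s)" for x s
      by (simp add: U_A_U_Q cinner_U cinner_Q_swap)
    have "cinner (j ?m) g = cinner ?m (js g)" by (rule jadj)
    also have "\<dots> = integral {0..N} (\<lambda>s. cinner (s ^ 4 *\<^sub>R U (s\<^sup>2) (A (U (s\<^sup>2) (Q (?p s))))) (js g))"
      using integral_linear[OF im cinner.bounded_linear_left] by (simp add: o_def)
    \<comment> \<open>The extra A costs a factor \<open>\<alpha>\<close>; dividing by it gives the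
      integrand the normalisation of \<open>integral_product_bound\<close>.\<close>
    also have "\<dots> = integral {0..N} (\<lambda>s. \<alpha> *\<^sub>R ((1 / \<alpha>) *\<^sub>R s ^ 4 *\<^sub>R cinner (A (?p s)) (?y s)))"
      using \<alpha>(1) by (simp add: cinner.scaleR_left eq)
    also have "\<dots> = \<alpha> *\<^sub>R integral {0..N} (\<lambda>s. (1 / \<alpha>) *\<^sub>R s ^ 4 *\<^sub>R cinner (A (?p s)) (?y s))"
      by (rule integral_cmul)
    finally have cm: "cmod (cinner (j ?m) g) = \<alpha> * cmod (integral {0..N} (\<lambda>s. (1 / \<alpha>) *\<^sub>R s ^ 4 *\<^sub>R cinner (A (?p s)) (?y s)))"
      using \<alpha>(1) by simp
    have "cmod (integral {0..N} (\<lambda>s. (1 / \<alpha>) *\<^sub>R s ^ 4 *\<^sub>R cinner (A (?p s)) (?y s))) \<le> (1/4 + \<bar>M\<bar>) / 2"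
    proof (rule integral_product_bound[where p = ?y and q = ?p])
      show cy: "continuous_on {0..N} ?y"
        by (intro adj.continuous_on_U_square Q.continuous_on continuous_intros)
      show "continuous_on {0..N} (\<lambda>s. (1 / \<alpha>) *\<^sub>R s ^ 4 *\<^sub>R cinner (A (?p s)) (?y s))"
        by (intro continuous_on_scaleR continuous_on_power continuous_on_const continuous_on_id
            cinner.continuous_on A.continuous_on cp cy)
      show "cmod ((1 / \<alpha>) *\<^sub>R s ^ 4 *\<^sub>R cinner (A (?p s)) (?y s)) \<le> s ^ 4 * (norm (?y s) * norm (?p s))" for s
      proof -
        have "cmod (cinner (A (?p s)) (?y s)) \<le> (\<alpha> * norm (?p s)) * norm (?y s)"
          using cinner_Cauchy_Schwarz[of "A (?p s)" "?y s"] \<alpha>(2)[of "?p s"]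
          by (meson mult_right_mono norm_ge_zero order_trans)
        hence "s ^ 4 * cmod (cinner (A (?p s)) (?y s)) \<le> s ^ 4 * ((\<alpha> * norm (?p s)) * norm (?y s))"
          by (intro mult_left_mono) auto
        thus ?thesis using \<alpha>(1) by (simp add: field_simps)
      qed
      have "(norm g)\<^sup>2 \<le> 1" using g by (simp add: power_le_one)
      thus "integral {0..N} (\<lambda>s. s ^ 5 * (norm (?y s))\<^sup>2) \<le> 1/4"
        using adj.energy_estimate[OF N, of g] by simp
      show "integral {0..N} (\<lambda>s. s ^ 3 * (norm (?p s))\<^sup>2) \<le> \<bar>M\<bar>"
        using sq[OF N, of v] M_bound[OF v] by linarith
    qed (rule cp)
    thus "cmod (cinner (j ?m) g) \<le> \<alpha> * ((1/4 + \<bar>M\<bar>) / 2)" unfolding cm using \<alpha>(1) by (intro mult_left_mono) auto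
  qed (use \<alpha>(1) in auto)
  have eq1: "integral {0..N} (\<lambda>s. j (U (s\<^sup>2) (A v))) = j (integral {0..N} (\<lambda>s. U (s\<^sup>2) (A v)))"
    using integral_linear[OF integrable_U j.bounded_linear_axioms] by (simp add: o_def)
  have eq2: "integral {0..N} (\<lambda>s. U (s\<^sup>2) (A v)) =
      N *\<^sub>R U (N\<^sup>2) (A v) + (2/3) *\<^sub>R (N ^ 3 *\<^sub>R ?p N) - (8/3) *\<^sub>R (N ^ 5 *\<^sub>R U (N\<^sup>2) (Q (?p N))) + 16 *\<^sub>R ?m"
    unfolding integral_U_by_parts[OF N] by simp
  have eq: "integral {0..N} (\<lambda>s. j (U (s\<^sup>2) (A v))) = N *\<^sub>R j (U (N\<^sup>2) (A v)) + (2/3) *\<^sub>R (N *\<^sub>R j (U (N\<^sup>2) (A ?x1)))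
      - (8/3) *\<^sub>R (N *\<^sub>R j (U (N\<^sup>2) (A ?x2))) + 16 *\<^sub>R j ?m"
    unfolding eq1 eq2 e1 e2 by (simp only: j.add j.diff j.scaleR)
  have "norm (integral {0..N} (\<lambda>s. j (U (s\<^sup>2) (A v)))) \<le> \<alpha> * 1 + 2/3 * (\<alpha> * (1 + \<alpha>)) + 8/3 * (\<alpha> * (1 + \<alpha>)\<^sup>2) + 16 * (\<alpha> * ((1/4 + \<bar>M\<bar>) / 2))"
    unfolding eq
  proof (intro norm_triangle_mono norm_triangle_le_diff add_mono)
    show "norm (N *\<^sub>R j (U (N\<^sup>2) (A v))) \<le> \<alpha> * 1" using jb[OF v] N by simp
    show "norm ((2/3) *\<^sub>R (N *\<^sub>R j (U (N\<^sup>2) (A ?x1)))) \<le> 2/3 * (\<alpha> * (1 + \<alpha>))"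
      using jb[OF n1] N by simp
    show "norm ((8/3) *\<^sub>R (N *\<^sub>R j (U (N\<^sup>2) (A ?x2)))) \<le> 8/3 * (\<alpha> * (1 + \<alpha>)\<^sup>2)"
      using jb[OF n2] N by simp
    show "norm (16 *\<^sub>R j ?m) \<le> 16 * (\<alpha> * ((1/4 + \<bar>M\<bar>) / 2))" using main by simp
  qed
  moreover have "\<alpha> * 1 + 2/3 * (\<alpha> * (1 + \<alpha>)) + 8/3 * (\<alpha> * (1 + \<alpha>)\<^sup>2) + 16 * (\<alpha> * ((1/4 + \<bar>M\<bar>) / 2)) \<le>
      K2"
  proof -
    have "0 \<le> \<alpha> * (1 + \<alpha>)" "0 \<le> \<alpha> * (1 + \<alpha>)\<^sup>2" using \<alpha>(1) by auto
    thus ?thesis by linarith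
  qed
  ultimately show "norm (integral {0..N} (\<lambda>s. j (U (s\<^sup>2) (A v)))) \<le>
    K2"
    by (rule order_trans)
qed

text \<open>The truncated integrals already converge in V, and continuity of j identifies their
  limit with the one in \<open>'h\<close>.\<close>

lemma range_inv_sqrt_subset: "range H.inv_sqrt \<subseteq> range j"
proof -
  define F where "F N f = integral {0..N} (\<lambda>s. U (s\<^sup>2) (js f))" for N f
  have "\<exists>L. bounded_linear L \<and> (\<forall>f. ((\<lambda>N. F N f) \<longlongrightarrow> L f) at_top)"
  proof (rule convergent_on_dense[OF _ _ dense])
    show bd: "norm (F N f) \<le> K1 * norm f" if "N \<ge> 0" for N f
      unfolding F_def by (rule integral_U_js_bounded[OF that])
    show "bounded_linear (F N)" if "N \<ge> 0" for N
    proof (rule bounded_linear_intro)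
      show "F N (x + y) = F N x + F N y" for x y
        unfolding F_def by (simp add: js.add U_add Henstock_Kurzweil_Integration.integral_add[OF integrable_U integrable_U])
      show "F N (r *\<^sub>R x) = r *\<^sub>R F N x" for r x
        unfolding F_def by (simp add: js.scaleR U_scaleR)
      show "norm (F N f) \<le> norm f * K1" for f
        using bd[OF that, of f] by (simp add: mult.commute)
    qed
    \<comment> \<open>For f = j w the integrand is \<open>U (s\<^sup>2) (Q w)\<close>, integrable by
      \<open>UQ_decay\<close>; for general f the available decay 1/s in V is not enough.\<close>
    fix f assume "f \<in> range j"
    then obtain w where w: "f = j w" by blast
    show "\<exists>l. ((\<lambda>N. F N f) \<longlongrightarrow> l) at_top"
      unfolding F_def w
    proof (rule integral_at_top_convergent)
      show "continuous_on {0..} (\<lambda>s. U (s\<^sup>2) (js (j w)))" by (intro continuous_on_U_square continuous_intros)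
      show "norm (U (s\<^sup>2) (js (j w))) \<le> ((1 + 2 * \<alpha>) * norm w) / (1 + s\<^sup>2)" for s
        using UQ_decay[of s w] by (simp add: Q_def)
    qed
  qed
  then obtain L where L: "\<And>f. ((\<lambda>N. F N f) \<longlongrightarrow> L f) at_top" by blast
  have "H.inv_sqrt f = j ((2 / pi) *\<^sub>R L f)" for f
  proof -
    have "(pi / 2) *\<^sub>R H.inv_sqrt f = j (L f)"
    proof (rule tendsto_unique[OF _ H.tendsto_inv_sqrt])
      have "integral {0..N} (\<lambda>s. Rh (s\<^sup>2) f) = j (F N f)" for N
        unfolding F_def using integral_linear[OF integrable_U j.bounded_linear_axioms] by (simp add: o_def Rh_apply)
      thus "((\<lambda>N. integral {0..N} (\<lambda>s. Rh (s\<^sup>2) f)) \<longlongrightarrow> j (L f)) at_top"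
        using j.tendsto[OF L] by simp
    qed simp
    hence "H.inv_sqrt f = (2 / pi) *\<^sub>R j (L f)" by (metis (no_types, lifting) divide_inverse
        inverse_divide left_inverse mult.commute pi_neq_zero scaleR_one scaleR_scaleR divide_eq_0_iff zero_neq_numeral)
    thus ?thesis by (simp add: j.scaleR)
  qed
  thus ?thesis by auto
qed

text \<open>The truncated integrals \<open>G N\<close> tend to pi/2 times the square root of the
  form operator. The limit is identified on the dense range of A^(-1) Q, where A cancels
  \<open>U 0\<close>; the relation with j is closed and so extends to V.\<close>

lemma range_j_subset: "range j \<subseteq> range H.inv_sqrt"
proof -
  define G where "G N v = integral {0..N} (\<lambda>s. j (U (s\<^sup>2) (A v)))" for N v
  have lim: "((\<lambda>N. G N (U 0 (Q w))) \<longlongrightarrow> (pi / 2) *\<^sub>R H.inv_sqrt (j w)) at_top" for w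
  proof -
    have "j (U (s\<^sup>2) (A (U 0 (Q w)))) = Rh (s\<^sup>2) (j w)" for s
      using A_U[of 0 "Q w"] by (simp add: Rh_apply Q_def)
    thus ?thesis unfolding G_def using H.tendsto_inv_sqrt[of "j w"] by simp
  qed
  have ij: "(\<lambda>s. j (U (s\<^sup>2) b)) integrable_on {0..N}" for b N
    by (intro integrable_continuous_real j.continuous_on continuous_on_U_square continuous_intros)
  have "\<exists>L. bounded_linear L \<and> (\<forall>v. ((\<lambda>N. G N v) \<longlongrightarrow> L v) at_top)"
  proof (rule convergent_on_dense[OF _ _ dense_range_UQ])
    show bd: "norm (G N v) \<le> K2 * norm v" if "N \<ge> 0" for N v
      unfolding G_def by (rule integral_jUA_bounded[OF that])
    show "bounded_linear (G N)" if "N \<ge> 0" for N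
    proof (rule bounded_linear_intro)
      show "G N (x + y) = G N x + G N y" for x y
        unfolding G_def by (simp add: A.add U_add j.add Henstock_Kurzweil_Integration.integral_add[OF ij ij])
      show "G N (r *\<^sub>R x) = r *\<^sub>R G N x" for r x
        unfolding G_def by (simp add: A.scaleR U_scaleR j.scaleR)
      show "norm (G N v) \<le> norm v * K2" for v
        using bd[OF that, of v] by (simp only: mult.commute)
    qed
  qed (use lim in blast)
  then obtain L where L: "bounded_linear L" "\<And>v. ((\<lambda>N. G N v) \<longlongrightarrow> L v) at_top" by blast
  have "closed {v. H.inv_sqrt (L v) = (pi / 2) *\<^sub>R j v}"
    by (intro closed_Collect_eq continuous_intros j.continuous_on bounded_linear.continuous_on[OF L(1)])
  moreover have "range (\<lambda>v. U 0 (Q v)) \<subseteq> {v. H.inv_sqrt (L v) = (pi / 2) *\<^sub>R j v}"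
  proof clarify
    fix w
    have "L (U 0 (Q w)) = (pi / 2) *\<^sub>R H.inv_sqrt (j w)"
      by (rule tendsto_unique[OF _ L(2) lim]) simp
    thus "H.inv_sqrt (L (U 0 (Q w))) = (pi / 2) *\<^sub>R j (U 0 (Q w))"
      by (simp add: blinfun.scaleR_right inv_sqrt_twice Q_def)
  qed
  ultimately have "closure (range (\<lambda>v. U 0 (Q v))) \<subseteq> {v. H.inv_sqrt (L v) = (pi / 2) *\<^sub>R j v}"
    by (simp add: closure_minimal)
  hence *: "H.inv_sqrt (L v) = (pi / 2) *\<^sub>R j v" for v using dense_range_UQ by auto
  have "j v = H.inv_sqrt ((2 / pi) *\<^sub>R L v)" for v
    by (simp add: blinfun.scaleR_right *)
  thus ?thesis by blast
qed

lemma range_inv_sqrt: "range H.inv_sqrt = range j"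
  by (rule equalityI[OF range_inv_sqrt_subset range_j_subset])

end

end

section \<open>Square function estimates from polynomial boundedness\<close>

text \<open>Each sign is chosen to make the new cross term nonnegative: a deterministic substitute
  for averaging over random signs.\<close>

lemma exists_signs:
  fixes x :: "nat \<Rightarrow> 'a::complex_inner"
  shows "\<exists>\<epsilon>. (\<forall>k. \<epsilon> k = 1 \<or> \<epsilon> k = -1) \<and>
    (\<Sum>k<n. (norm (x k))\<^sup>2) \<le> (norm (\<Sum>k<n. \<epsilon> k *\<^sub>R x k))\<^sup>2"
proof (induction n)
  case 0
  show ?case by (intro exI[of _ "\<lambda>_. 1"]) simp
next
  case (Suc n)
  then obtain \<epsilon> :: "nat \<Rightarrow> real" where e: "\<And>k. \<epsilon> k = 1 \<or> \<epsilon> k = -1"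
    and le: "(\<Sum>k<n. (norm (x k))\<^sup>2) \<le> (norm (\<Sum>k<n. \<epsilon> k *\<^sub>R x k))\<^sup>2" by blast
  define \<delta> :: real where "\<delta> = (if Re (cinner (\<Sum>k<n. \<epsilon> k *\<^sub>R x k) (x n)) \<ge> 0 then 1 else -1)"
  have d: "Re (cinner (\<Sum>k<n. \<epsilon> k *\<^sub>R x k) (\<delta> *\<^sub>R x n)) \<ge> 0" "norm (\<delta> *\<^sub>R x n) = norm (x n)"
    by (auto simp: \<delta>_def cinner.scaleR_right cinner.minus_right)
  have "(\<Sum>k<n. (\<epsilon>(n := \<delta>)) k *\<^sub>R x k) = (\<Sum>k<n. \<epsilon> k *\<^sub>R x k)"
    by (intro sum.cong) auto
  hence "(norm (\<Sum>k<Suc n. (\<epsilon>(n := \<delta>)) k *\<^sub>R x k))\<^sup>2 \<ge> (\<Sum>k<Suc n. (norm (x k))\<^sup>2)"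
    using le d by (simp add: norm_add_square del: norm_scaleR)
  thus ?case using e by (intro exI[of _ "\<epsilon>(n := \<delta>)"]) (auto simp: \<delta>_def)
qed

text \<open>Stretching each dyadic interval to [1, 2] turns the integral over [1, 2^n] into an
  integral over \<sigma> of dyadic sums, to which \<open>sums\<close> applies pointwise.\<close>

lemma dyadic_integral_bound:
  fixes g :: "real \<Rightarrow> real"
  assumes cont: "continuous_on {0..} g" and small: "\<And>s. 0 \<le> s \<Longrightarrow> s \<le> 1 \<Longrightarrow> s ^ 3 * (g s)\<^sup>2 \<le> B0"
    and sums: "\<And>\<sigma> n. 1 \<le> \<sigma> \<Longrightarrow> (\<Sum>k<n. ((2 ^ k * \<sigma>)\<^sup>2 * g (2 ^ k * \<sigma>))\<^sup>2) \<le> B"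
    and N: "0 \<le> N"
  shows "integral {0..N} (\<lambda>s. s ^ 3 * (g s)\<^sup>2) \<le> B0 + B"
proof -
  let ?\<phi> = "\<lambda>s. s ^ 3 * (g s)\<^sup>2"
  have ii: "?\<phi> integrable_on {a..b}" if "0 \<le> a" for a b
    using that by (intro integrable_continuous_real continuous_intros continuous_on_subset[OF cont]) auto
  have st: "(\<lambda>\<sigma>. 2 ^ k * ?\<phi> (2 ^ k * \<sigma>)) integrable_on {1..2}" for k :: nat
    by (intro integrable_continuous_real continuous_intros continuous_on_compose2[OF cont]) auto
  have piece: "integral {2 ^ k..2 ^ Suc k} ?\<phi> = integral {1..2} (\<lambda>\<sigma>. 2 ^ k * ?\<phi> (2 ^ k * \<sigma>))" for k :: nat
  proof -
    have im: "(\<lambda>x::real. x / 2 ^ k) ` {2 ^ k..2 ^ Suc k} = {1..2}"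
    proof (intro equalityI subsetI)
      fix y :: real assume "y \<in> {1..2}"
      thus "y \<in> (\<lambda>x. x / 2 ^ k) ` {2 ^ k..2 ^ Suc k}"
        by (intro image_eqI[of _ _ "2 ^ k * y"]) auto
    qed (auto simp: field_simps)
    have "integral {1..2} (\<lambda>\<sigma>. ?\<phi> (2 ^ k * \<sigma>)) = (1 / \<bar>2 ^ k\<bar>) *\<^sub>R integral {2 ^ k..2 ^ Suc k} ?\<phi>"
      using integral_stretch_real[of "2 ^ k" "2 ^ k" "2 ^ Suc k" ?\<phi>] unfolding im by simp
    hence "integral {2 ^ k..2 ^ Suc k} ?\<phi> = 2 ^ k * integral {1..2} (\<lambda>\<sigma>. ?\<phi> (2 ^ k * \<sigma>))" by simp
    thus ?thesis by (simp only: integral_mult_right)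
  qed
  have dy: "integral {1..2 ^ n} ?\<phi> = integral {1..2} (\<lambda>\<sigma>. \<Sum>k<n. 2 ^ k * ?\<phi> (2 ^ k * \<sigma>))" for n :: nat
  proof (induction n)
    case (Suc n)
    have "integral {1..2 ^ Suc n} ?\<phi> = integral {1..2 ^ n} ?\<phi> + integral {2 ^ n..2 ^ Suc n} ?\<phi>"
      by (rule Henstock_Kurzweil_Integration.integral_combine[symmetric]) (auto intro!: ii)
    also have "\<dots> = integral {1..2} (\<lambda>\<sigma>. (\<Sum>k<n. 2 ^ k * ?\<phi> (2 ^ k * \<sigma>)) + 2 ^ n * ?\<phi> (2 ^ n * \<sigma>))"
      unfolding Suc.IH piece
      by (intro Henstock_Kurzweil_Integration.integral_add[symmetric] integrable_sum st) auto
    finally show ?case by (simp add: mult_ac)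
  qed simp
  obtain n :: nat where "N < 2 ^ n" using real_arch_pow[of 2 N] by auto
  hence n: "N \<le> 2 ^ n" by simp
  have "integral {0..N} ?\<phi> \<le> integral {0..2 ^ n} ?\<phi>"
    using n by (intro integral_subset_le ii) auto
  also have "\<dots> = integral {0..1} ?\<phi> + integral {1..2 ^ n} ?\<phi>"
    by (rule Henstock_Kurzweil_Integration.integral_combine[symmetric]) (auto intro!: ii)
  also have "integral {0..1} ?\<phi> \<le> integral {0..1} (\<lambda>s::real. B0)"
    by (intro integral_le ii) (auto intro: small)
  also have "integral {0..1} (\<lambda>s::real. B0) = B0" by simp
  also have "integral {1..2 ^ n} ?\<phi> \<le> integral {1..2} (\<lambda>s::real. B)"
    unfolding dy
  proof (intro integral_le integrable_sum st)
    fix \<sigma> :: real assume \<sigma>: "\<sigma> \<in> {1..2}"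
    have "(\<Sum>k<n. 2 ^ k * ?\<phi> (2 ^ k * \<sigma>)) \<le> (\<Sum>k<n. ((2 ^ k * \<sigma>)\<^sup>2 * g (2 ^ k * \<sigma>))\<^sup>2)"
    proof (rule sum_mono)
      fix k
      define s where "s = 2 ^ k * \<sigma>"
      \<comment> \<open>The Jacobian \<open>2 ^ k\<close> is at most s and so raises the weight from
        \<open>s ^ 3\<close> to \<open>s ^ 4\<close>.\<close>
      have "2 ^ k * ?\<phi> s \<le> s * ?\<phi> s"
        using \<sigma> by (intro mult_right_mono) (auto simp: s_def)
      also have "\<dots> = (s\<^sup>2 * g s)\<^sup>2" by (simp add: power2_eq_square power3_eq_cube mult_ac)
      finally show "2 ^ k * ?\<phi> (2 ^ k * \<sigma>) \<le> ((2 ^ k * \<sigma>)\<^sup>2 * g (2 ^ k * \<sigma>))\<^sup>2" by (simp add: s_def)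
    qed
    also have "\<dots> \<le> B" using \<sigma> by (intro sums) auto
    finally show "(\<Sum>k<n. 2 ^ k * ?\<phi> (2 ^ k * \<sigma>)) \<le> B" .
  qed auto
  finally show ?thesis by simp
qed

text \<open>The exact remainder of the series of 1/(1 - w)^2 is what quantifies the truncation
  below, for scalars and for operators.\<close>

lemma arith_geometric_sum:
  fixes w :: "'a::comm_ring_1"
  shows "(1 - w)\<^sup>2 * (\<Sum>i\<le>m. of_nat (Suc i) * w ^ i) = 1 - of_nat (m + 2) * w ^ (m + 1) + of_nat (m + 1) * w ^ (m + 2)"
  by (induction m) (simp_all add: algebra_simps power2_eq_square)

definition trunc_poly :: "real \<Rightarrow> nat \<Rightarrow> complex poly" where
  "trunc_poly t m = (let \<rho> = (t - 1) / (t + 1) in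
     smult (of_real (t / (1 + t)\<^sup>2)) ([:1, 0, -1:] * (\<Sum>i\<le>m. monom (of_nat (Suc i) * of_real \<rho> ^ i) i)))"

text \<open>\<open>trunc_poly t m\<close> truncates the power series of \<open>t (1 - z\<^sup>2) / ((1 + z) + t (1 - z))\<^sup>2\<close>, which is
  \<open>t \<zeta> / (1 + t \<zeta>)\<^sup>2\<close> in the half plane variable \<open>\<zeta> = (1 - z) / (1 + z)\<close>.\<close>

lemma poly_trunc_poly:
  assumes t: "t \<ge> 1"
  defines "\<rho> \<equiv> (t - 1) / (t + 1)"
  shows "poly (trunc_poly t m) z * ((1 + z) + of_real t * (1 - z))\<^sup>2 = of_real t * (1 - z\<^sup>2) *
    (1 - of_nat (m + 2) * (of_real \<rho> * z) ^ (m + 1) + of_nat (m + 1) * (of_real \<rho> * z) ^ (m + 2))"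
proof -
  have t0: "complex_of_real (1 + t) \<noteq> 0" using t by (metis of_real_eq_0_iff add_pos_nonneg less_irrefl zero_less_one order_trans zero_le_one)
  \<comment> \<open>For t > 1, \<open>\<rho>\<close> is the reciprocal of the zero of the
    denominator; being less than 1, it makes the series converge on the closed disc.\<close>
  have "(1 + z) + of_real t * (1 - z) = of_real (1 + t) * (1 - of_real \<rho> * z)"
    using t t0 by (simp add: \<rho>_def field_simps)
  hence sq: "((1 + z) + of_real t * (1 - z))\<^sup>2 = (of_real (1 + t))\<^sup>2 * (1 - of_real \<rho> * z)\<^sup>2"
    by (simp add: power_mult_distrib)
  have p: "poly (trunc_poly t m) z = of_real (t / (1 + t)\<^sup>2) * ((1 - z\<^sup>2) * (\<Sum>i\<le>m. of_nat (Suc i) * (of_real \<rho> * z) ^ i))"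
    by (simp add: trunc_poly_def Let_def \<rho>_def[symmetric] poly_sum poly_monom power_mult_distrib power2_eq_square mult_ac)
      (simp add: algebra_simps)
  have "poly (trunc_poly t m) z * ((1 + z) + of_real t * (1 - z))\<^sup>2 =
     (of_real (t / (1 + t)\<^sup>2) * (of_real (1 + t))\<^sup>2) * (1 - z\<^sup>2) *
     ((1 - of_real \<rho> * z)\<^sup>2 * (\<Sum>i\<le>m. of_nat (Suc i) * (of_real \<rho> * z) ^ i))"
    unfolding p sq by (simp only: mult_ac)
  also have "of_real (t / (1 + t)\<^sup>2) * (of_real (1 + t))\<^sup>2 = complex_of_real t"
    using t0 by (simp add: power2_eq_square del: of_real_add)
  finally show ?thesis unfolding arith_geometric_sum .
qed

text \<open>The cross term is 2 t (1 - |z|^2), nonnegative because the Cayley transform maps the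
  disc to the right half plane.\<close>

lemma cayley_denominator:
  assumes "cmod z \<le> 1" "t \<ge> 0"
  shows "(cmod ((1 + z) + of_real t * (1 - z)))\<^sup>2 \<ge> (cmod (1 + z))\<^sup>2 + t\<^sup>2 * (cmod (1 - z))\<^sup>2"
proof -
  have "(cmod ((1 + z) + of_real t * (1 - z)))\<^sup>2 =
      (cmod (1 + z))\<^sup>2 + t\<^sup>2 * (cmod (1 - z))\<^sup>2 + 2 * t * (1 - (cmod z)\<^sup>2)"
    unfolding cmod_power2 by (simp add: power2_eq_square algebra_simps)
  moreover have "0 \<le> 2 * t * (1 - (cmod z)\<^sup>2)" using assms by (simp add: power_le_one)
  ultimately show ?thesis by linarith
qed

text \<open>Telescoping makes the dyadic sums of \<open>x / (1 + x\<^sup>2)\<close> uniformly bounded.\<close>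

lemma dyadic_telescope:
  fixes a b t :: real
  assumes "a \<ge> 0" "b \<ge> 0" "a + b > 0" "t > 0"
  defines "H \<equiv> \<lambda>t. 4 * t * b / (a + t * b)"
  shows "t * a * b / (a\<^sup>2 + t\<^sup>2 * b\<^sup>2) \<le> H (4 * t) - H t"
proof (cases "a = 0 \<or> b = 0")
  case True
  thus ?thesis using assms by auto
next
  case False
  define y where "y = t * b"
  have pos: "a > 0" "b > 0" "y > 0" using assms False by (auto simp: y_def)
  have "H (4 * t) - H t = 4 * (4 * y / (a + 4 * y) - y / (a + y))"
    by (simp add: H_def y_def mult_ac)
  also have "4 * y / (a + 4 * y) - y / (a + y) = 3 * a * y / ((a + 4 * y) * (a + y))"
    using pos by (simp add: diff_frac_eq add_pos_pos) (simp add: algebra_simps)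
  finally have e: "H (4 * t) - H t = 12 * a * y / ((a + 4 * y) * (a + y))" by simp
  \<comment> \<open>A crude bound; the factor 4 in \<open>H\<close> supplies the 12 in the numerator
    that matches it.\<close>
  have "(a + 4 * y) * (a + y) \<le> 12 * (a\<^sup>2 + y\<^sup>2)"
  proof -
    have "0 \<le> (a - y)\<^sup>2" by simp
    hence "2 * (a * y) \<le> a\<^sup>2 + y\<^sup>2" by (simp add: power2_eq_square algebra_simps)
    moreover have "(a + 4 * y) * (a + y) = a\<^sup>2 + 5 * (a * y) + 4 * y\<^sup>2" by (simp add: power2_eq_square algebra_simps)
    moreover have "A + 5 * p + 4 * B \<le> 12 * (A + B)" if "2 * p \<le> A + B" "0 \<le> A" "0 \<le> B" for p A B :: real
      using that by (smt (verit))
    ultimately show ?thesis by (metis zero_le_power2)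
  qed
  hence "12 * a * y / (12 * (a\<^sup>2 + y\<^sup>2)) \<le> 12 * a * y / ((a + 4 * y) * (a + y))"
    using pos by (intro divide_left_mono mult_pos_pos) (auto intro!: add_pos_pos)
  moreover have "12 * a * y / (12 * (a\<^sup>2 + y\<^sup>2)) = t * a * b / (a\<^sup>2 + t\<^sup>2 * b\<^sup>2)"
  proof -
    have "12 * a * y / (12 * X) = a * y / X" for X by simp
    note this[of "a\<^sup>2 + y\<^sup>2"]
    also have "a * y / (a\<^sup>2 + y\<^sup>2) = t * a * b / (a\<^sup>2 + t\<^sup>2 * b\<^sup>2)" by (simp add: y_def power_mult_distrib mult_ac)
    finally show ?thesis .
  qed
  ultimately show ?thesis unfolding e by simp
qed

text \<open>The 8 is 2 times 4: under \<open>small\<close> the truncation at most doubles the bound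
  of each term, and the telescoped sum of \<open>H\<close> is at most 4.\<close>

lemma trunc_poly_sum_bound:
  assumes z: "cmod z \<le> 1" and \<sigma>: "\<sigma> \<ge> 1" and e: "\<And>k. \<bar>\<epsilon> k\<bar> \<le> (1::real)"
    and small: "\<And>k. k < n \<Longrightarrow> let t = 4 ^ k * \<sigma>\<^sup>2; \<rho> = (t - 1) / (t + 1) in real (2 * m + 3) * \<rho> ^ (m + 1) \<le> 1"
  shows "cmod (poly (\<Sum>k<n. smult (of_real (\<epsilon> k)) (trunc_poly (4 ^ k * \<sigma>\<^sup>2) m)) z) \<le> 8"
proof -
  define a where "a = cmod (1 + z)"
  define b where "b = cmod (1 - z)"
  define H where "H t = 4 * t * b / (a + t * b)" for t
  have ab: "a \<ge> 0" "b \<ge> 0" "a + b > 0"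
  proof -
    have "cmod 2 \<le> a + b" using norm_triangle_ineq[of "1 + z" "1 - z"] by (simp add: a_def b_def)
    thus "a \<ge> 0" "b \<ge> 0" "a + b > 0" by (simp_all add: a_def b_def)
  qed
  define \<tau> where "\<tau> k = 4 ^ k * \<sigma>\<^sup>2" for k :: nat
  have \<tau>1: "\<tau> k \<ge> 1" for k
    using mult_mono[of 1 "4 ^ k" 1 "\<sigma>\<^sup>2"] \<sigma> by (simp add: \<tau>_def one_le_power)
  have term_bound: "cmod (poly (trunc_poly (\<tau> k) m) z) \<le> 2 * (H (\<tau> (Suc k)) - H (\<tau> k))" if k: "k < n" for k
  proof -
    define t where "t = \<tau> k"
    define \<rho> where "\<rho> = (t - 1) / (t + 1)"
    have t: "t \<ge> 1" using \<tau>1 by (simp add: t_def)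
    have \<rho>: "0 \<le> \<rho>" "\<rho> \<le> 1" using t by (auto simp: \<rho>_def)
    define W where "W = of_real \<rho> * z"
    have W: "cmod W \<le> \<rho>" using z \<rho> by (simp add: W_def norm_mult mult_left_le)
    define E where "E = 1 - of_nat (m + 2) * W ^ (m + 1) + of_nat (m + 1) * W ^ (m + 2)"
    have "cmod E \<le> 1 + real (m + 2) * \<rho> ^ (m + 1) + real (m + 1) * \<rho> ^ (m + 1)"
      unfolding E_def
    proof (intro norm_triangle_mono norm_triangle_le_diff add_mono)
      show "cmod (of_nat (m + 2) * W ^ (m + 1)) \<le> real (m + 2) * \<rho> ^ (m + 1)"
        unfolding norm_mult norm_power norm_of_nat by (intro mult_left_mono power_mono W) auto
      have "cmod W ^ (m + 2) \<le> \<rho> ^ (m + 2)" by (intro power_mono W) auto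
      also have "\<dots> \<le> \<rho> ^ (m + 1)" using \<rho> by (intro power_decreasing) auto
      finally show "cmod (of_nat (m + 1) * W ^ (m + 2)) \<le> real (m + 1) * \<rho> ^ (m + 1)"
        unfolding norm_mult norm_power norm_of_nat by (intro mult_left_mono) auto
    qed simp
    also have "\<dots> = 1 + real (2 * m + 3) * \<rho> ^ (m + 1)" by (simp add: algebra_simps)
    also have "\<dots> \<le> 2" using small[OF k] by (simp add: Let_def t_def \<tau>_def \<rho>_def)
    finally have E: "cmod E \<le> 2" .
    define Dn where "Dn = (1 + z) + of_real t * (1 - z)"
    have Dn: "(cmod Dn)\<^sup>2 \<ge> a\<^sup>2 + t\<^sup>2 * b\<^sup>2"
      unfolding Dn_def a_def b_def using z t by (intro cayley_denominator) auto
    have pos: "a\<^sup>2 + t\<^sup>2 * b\<^sup>2 > 0"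
    proof (cases "a = 0")
      case True
      hence "b > 0" using ab by simp
      thus ?thesis using t by (simp add: add_nonneg_pos)
    qed (simp add: add_pos_nonneg)
    have "cmod (poly (trunc_poly t m) z) * (cmod Dn)\<^sup>2 = cmod (poly (trunc_poly t m) z * Dn\<^sup>2)"
      by (simp add: norm_mult norm_power)
    also have "\<dots> = cmod (of_real t * (1 - z\<^sup>2) * E)"
      unfolding Dn_def E_def W_def \<rho>_def poly_trunc_poly[OF t] ..
    also have "\<dots> = t * (a * b) * cmod E"
    proof -
      have "1 - z\<^sup>2 = (1 + z) * (1 - z)" by (simp add: power2_eq_square algebra_simps)
      thus ?thesis using t by (simp add: norm_mult a_def b_def)
    qed
    also have "\<dots> \<le> t * (a * b) * 2" using E t ab by (intro mult_left_mono) auto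
    finally have "cmod (poly (trunc_poly t m) z) * (a\<^sup>2 + t\<^sup>2 * b\<^sup>2) \<le> t * (a * b) * 2"
      using mult_left_mono[OF Dn norm_ge_zero[of "poly (trunc_poly t m) z"]] by linarith
    hence "cmod (poly (trunc_poly t m) z) \<le> 2 * (t * a * b / (a\<^sup>2 + t\<^sup>2 * b\<^sup>2))"
      using pos by (simp add: pos_le_divide_eq mult_ac)
    also have "\<dots> \<le> 2 * (H (4 * t) - H t)"
      unfolding H_def using dyadic_telescope[OF ab, of t] t by (intro mult_left_mono) auto
    finally show ?thesis by (simp add: t_def \<tau>_def mult_ac)
  qed
  have "cmod (poly (\<Sum>k<n. smult (of_real (\<epsilon> k)) (trunc_poly (4 ^ k * \<sigma>\<^sup>2) m)) z) \<le>
      (\<Sum>k<n. cmod (poly (smult (of_real (\<epsilon> k)) (trunc_poly (\<tau> k) m)) z))"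
    unfolding poly_sum \<tau>_def by (rule norm_sum)
  also have "\<dots> \<le> (\<Sum>k<n. 2 * (H (\<tau> (Suc k)) - H (\<tau> k)))"
  proof (rule sum_mono)
    fix k assume "k \<in> {..<n}"
    hence k: "k < n" by simp
    have "cmod (poly (smult (of_real (\<epsilon> k)) (trunc_poly (\<tau> k) m)) z) = \<bar>\<epsilon> k\<bar> * cmod (poly (trunc_poly (\<tau> k) m) z)"
      by (simp add: norm_mult)
    also have "\<dots> \<le> 1 * cmod (poly (trunc_poly (\<tau> k) m) z)" by (intro mult_right_mono e) auto
    finally show "cmod (poly (smult (of_real (\<epsilon> k)) (trunc_poly (\<tau> k) m)) z) \<le> 2 * (H (\<tau> (Suc k)) - H (\<tau> k))"
      using term_bound[OF k] by simp
  qed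
  also have "\<dots> = 2 * (H (\<tau> n) - H (\<tau> 0))"
    by (simp only: sum_distrib_left[symmetric] sum_lessThan_telescope[of "\<lambda>k. H (\<tau> k)" n])
  also have "\<dots> \<le> 2 * (4 - 0)"
  proof (intro mult_left_mono diff_mono)
    have "a + \<tau> n * b > 0"
      using ab \<tau>1[of n] by (smt (verit) mult_left_mono mult_cancel_right1 mult_right_mono)
    thus "H (\<tau> n) \<le> 4" using ab by (simp add: H_def pos_divide_le_eq)
    show "0 \<le> H (\<tau> 0)" using ab \<tau>1[of 0] by (simp add: H_def)
  qed simp
  finally show ?thesis by simp
qed

text \<open>The points \<open>4 ^ k * \<sigma>\<^sup>2\<close> are the squares of the dyadic points
  \<open>2 ^ k * \<sigma>\<close> of the variable s.\<close>

abbreviation dyadic_sum :: "(nat \<Rightarrow> real) \<Rightarrow> real \<Rightarrow> nat \<Rightarrow> (real \<Rightarrow> 'a::real_vector) \<Rightarrow> 'a" where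
  "dyadic_sum \<epsilon> \<sigma> n Y \<equiv> \<Sum>k<n. \<epsilon> k *\<^sub>R ((4 ^ k * \<sigma>\<^sup>2) *\<^sub>R Y (4 ^ k * \<sigma>\<^sup>2))"

context form_pair
begin

section \<open>The Cayley transform and rational functions of it\<close>

definition C :: "'v \<Rightarrow> 'v" where "C x = A (U 1 x) - Q (U 1 x)"
text \<open>With X = Q A^(-1) one has \<open>A (U t x)\<close> = (1 + t X)^(-1) x, so
  \<open>Psi t\<close> is X (1 + t X)^(-2).\<close>

definition Psi :: "real \<Rightarrow> 'v \<Rightarrow> 'v" where "Psi t x = Q (U t (A (U t x)))"

lemma C_bounded: "cbounded_linear C"
  unfolding C_def[abs_def]
  by (intro cbounded_linear_diff cbounded_linear_compose[OF A_bounded] cbounded_linear_compose[OF cbounded_Q] cbounded_U) auto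

sublocale C: bounded_linear C by (rule cbounded_linear_bounded_linear[OF C_bounded])

lemma C_plus: "x + C x = 2 *\<^sub>R A (U 1 x)" and C_minus: "x - C x = 2 *\<^sub>R Q (U 1 x)"
  using AQ_U[of 1 x] by (simp_all add: C_def scaleR_2 algebra_simps)

lemma AUQ: "0 \<le> t \<Longrightarrow> A (U t (Q x)) = Q (U t (A x))"
  by (simp add: A_U U_A Q.diff Q.scaleR)

text \<open>Operator form of the denominator (1 + z) + t (1 - z). For t \<ge> 0 it is onto, so
  identities between rational functions of C can be checked after composing with it.\<close>

definition G :: "real \<Rightarrow> 'v \<Rightarrow> 'v" where "G t v = (v + C v) + t *\<^sub>R (v - C v)"

lemma G_eq: "G t v = 2 *\<^sub>R (A (U 1 v) + t *\<^sub>R Q (U 1 v))"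
  by (simp add: G_def C_plus C_minus algebra_simps)

lemma U_G: "0 \<le> t \<Longrightarrow> U t (G t v) = 2 *\<^sub>R U 1 v"
  by (simp add: G_eq U_scaleR U_AQ)

lemma surj_G: "0 \<le> t \<Longrightarrow> \<exists>v. G t v = x"
proof -
  assume t: "0 \<le> t"
  let ?v = "(1/2) *\<^sub>R (A (U t x) + 1 *\<^sub>R Q (U t x))"
  have "U 1 ?v = (1/2) *\<^sub>R U t x" by (simp only: U_scaleR[OF zero_le_one] U_AQ[OF zero_le_one])
  hence "G t ?v = A (U t x) + t *\<^sub>R Q (U t x)"
    unfolding G_eq by (simp add: A.scaleR Q.scaleR scaleR_add_right)
  hence "G t ?v = x" by (simp only: AQ_U[OF t])
  thus ?thesis by blast
qed

text \<open>The scalar identity behind it: with \<zeta> = (1 - z)/(1 + z), the product of \<zeta>/(1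
  + t \<zeta>)^2 and ((1 + z) + t (1 - z))^2 is 1 - z^2.\<close>

lemma Psi_G: assumes t: "0 \<le> t" shows "Psi t (G t (G t v)) = v - C (C v)"
proof -
  have "A (U 1 (G t v)) = 2 *\<^sub>R (A (U 1 (A (U 1 v))) + t *\<^sub>R Q (U 1 (A (U 1 v))))"
    by (simp add: G_eq U_scaleR U_add A.scaleR A.add AUQ)
  hence "U t (A (U 1 (G t v))) = 2 *\<^sub>R U 1 (A (U 1 v))"
    by (simp add: U_scaleR U_AQ t)
  hence "Psi t (G t (G t v)) = 4 *\<^sub>R Q (U 1 (A (U 1 v)))"
    by (simp add: Psi_def U_G A.scaleR U_scaleR Q.scaleR t)
  moreover have "v - C (C v) = (v + C v) - C (v + C v)" by (simp add: C.add)
  hence "v - C (C v) = 4 *\<^sub>R Q (U 1 (A (U 1 v)))"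
    by (simp add: C_minus) (simp add: C_plus U_scaleR Q.scaleR)
  ultimately show ?thesis by simp
qed

text \<open>Transfers \<open>poly_trunc_poly\<close> from scalars to C by multiplicativity. The
  vector \<open>v'\<close> is v corrected by the truncation remainder.\<close>

lemma poly_op_trunc_poly:
  assumes t: "t \<ge> 1"
  defines "\<rho> \<equiv> (t - 1) / (t + 1)"
  assumes v': "v' = v - (real (m + 2) * \<rho> ^ (m + 1)) *\<^sub>R (C ^^ (m + 1)) v + (real (m + 1) * \<rho> ^ (m + 2)) *\<^sub>R (C ^^ (m + 2)) v"
  shows "poly_op (trunc_poly t m) C (G t (G t v)) = t *\<^sub>R (v' - C (C v'))"
proof -
  let ?g = "[:of_real (1 + t), of_real (1 - t):] :: complex poly"
  let ?e = "1 - monom (of_nat (m + 2) * of_real \<rho> ^ (m + 1)) (m + 1) + monom (of_nat (m + 1) * of_real \<rho> ^ (m + 2)) (m + 2) :: complex poly"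
  have pe: "trunc_poly t m * (?g * ?g) = smult (of_real t) ([:1, 0, -1:] * ?e)"
  proof (rule iffD1[OF poly_eq_poly_eq_iff], rule ext)
    fix z
    have "poly (trunc_poly t m * (?g * ?g)) z = poly (trunc_poly t m) z * ((1 + z) + of_real t * (1 - z))\<^sup>2"
      by (simp add: power2_eq_square algebra_simps)
    also have "\<dots> = of_real t * (1 - z\<^sup>2) *
      (1 - of_nat (m + 2) * (of_real \<rho> * z) ^ (m + 1) + of_nat (m + 1) * (of_real \<rho> * z) ^ (m + 2))"
      unfolding \<rho>_def by (rule poly_trunc_poly[OF t])
    also have "\<dots> = poly (smult (of_real t) ([:1, 0, -1:] * ?e)) z"
      by (simp only: poly_smult poly_mult poly_add poly_diff poly_monom poly_1 poly_pCons poly_0 power_mult_distrib)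
        (simp add: power2_eq_square mult_ac)
    finally show "poly (trunc_poly t m * (?g * ?g)) z = poly (smult (of_real t) ([:1, 0, -1:] * ?e)) z" .
  qed
  have g: "poly_op ?g C x = G t x" for x
  proof -
    have "poly_op ?g C x = (1 + t) *\<^sub>R x + (1 - t) *\<^sub>R C x"
      unfolding scaleR_scaleC
      by (simp only: poly_op_pCons[OF C_bounded] poly_op_0 C.zero add_0_right cbounded_linear_scaleC[OF C_bounded])
    thus ?thesis by (simp add: G_def algebra_simps)
  qed
  have m2: "poly_op [:1, 0, -1:] C x = x - C (C x)" for x
    by (simp add: poly_op_pCons[OF C_bounded] poly_op_0 C.zero scaleC_one scaleC.zero_left scaleC.minus_left C.neg)
  have pd: "poly_op (p - r) C x = poly_op p C x - poly_op r C x" for p r x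
    using poly_op_add[of "p - r" r C x] by simp
  have one: "poly_op 1 C x = x" for x
    by (simp add: one_pCons poly_op_pCons[OF C_bounded] poly_op_0 C.zero scaleC_one)
  have mon: "poly_op (monom (of_nat k * of_real \<rho> ^ i) l) C x = (real k * \<rho> ^ i) *\<^sub>R (C ^^ l) x" for k i l x
    by (simp add: poly_op_monom scaleR_scaleC)
  have ev: "poly_op ?e C v = v'"
    unfolding poly_op_add pd one mon v' ..
  have "poly_op (trunc_poly t m) C (G t (G t v)) = poly_op (trunc_poly t m * (?g * ?g)) C v"
    by (simp only: poly_op_mult[OF C_bounded] g)
  also have "\<dots> = t *\<^sub>R (v' - C (C v'))"
    unfolding pe poly_op_smult poly_op_mult[OF C_bounded] m2 ev by (simp add: scaleR_scaleC)
  finally show ?thesis .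
qed

context
  fixes Mp :: real
  assumes Mp: "0 \<le> Mp" "\<And>p x. norm (poly_op p C x) \<le> Mp * (SUP z\<in>cball 0 1. cmod (poly p z)) * norm x"
begin

lemma poly_op_bound:
  assumes "\<And>z. cmod z \<le> 1 \<Longrightarrow> cmod (poly p z) \<le> B" shows "norm (poly_op p C x) \<le> Mp * B * norm x"
proof -
  have "(SUP z\<in>cball 0 1. cmod (poly p z)) \<le> B" by (rule cSUP_least) (use assms in auto)
  hence "Mp * (SUP z\<in>cball 0 1. cmod (poly p z)) * norm x \<le> Mp * B * norm x"
    using Mp(1) by (intro mult_right_mono mult_left_mono) auto
  thus ?thesis using Mp(2)[of p x] by linarith
qed

lemma power_bound: "norm ((C ^^ n) x) \<le> Mp * norm x"
  using poly_op_bound[of "monom 1 n" 1 x] by (simp add: poly_op_monom scaleC_one poly_monom norm_power power_le_one)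

text \<open>The remainder coefficients are of order m \<rho>^m, and the powers of C are bounded,
  being polynomials in C; hence the corrected vectors \<open>w m\<close> tend to v.\<close>

lemma tendsto_trunc_poly:
  assumes t: "t \<ge> 1"
  shows "(\<lambda>m. poly_op (trunc_poly t m) C x) \<longlonglongrightarrow> t *\<^sub>R Psi t x"
proof -
  obtain v1 where v1: "G t v1 = x" using surj_G[of t x] t by auto
  obtain v where v: "G t v = v1" using surj_G[of t v1] t by auto
  define \<rho> where "\<rho> = (t - 1) / (t + 1)"
  have \<rho>: "0 \<le> \<rho>" "\<rho> < 1" using t by (auto simp: \<rho>_def)
  define w where "w m = v - (real (m + 2) * \<rho> ^ (m + 1)) *\<^sub>R (C ^^ (m + 1)) v + (real (m + 1) * \<rho> ^ (m + 2)) *\<^sub>R (C ^^ (m + 2)) v" for m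
  have z: "(\<lambda>m. real m * \<rho> ^ m) \<longlonglongrightarrow> 0"
    using \<rho> by (intro powser_times_n_limit_0) simp
  have p: "(\<lambda>m. \<rho> ^ m) \<longlonglongrightarrow> 0" using \<rho> by (intro LIMSEQ_power_zero) simp
  have l1: "(\<lambda>m. real (m + 2) * \<rho> ^ (m + 1)) \<longlonglongrightarrow> 0"
  proof -
    have "(\<lambda>m. real (m + 1) * \<rho> ^ (m + 1) + \<rho> ^ (m + 1)) \<longlonglongrightarrow> 0 + 0"
      using LIMSEQ_ignore_initial_segment[OF z, of 1] LIMSEQ_ignore_initial_segment[OF p, of 1]
      by (intro tendsto_add) auto
    moreover have "real (m + 1) * \<rho> ^ (m + 1) + \<rho> ^ (m + 1) = real (m + 2) * \<rho> ^ (m + 1)" for m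
      by (simp add: algebra_simps)
    ultimately show ?thesis by simp
  qed
  have l2: "(\<lambda>m. real (m + 1) * \<rho> ^ (m + 2)) \<longlonglongrightarrow> 0"
  proof -
    have "(\<lambda>m. \<rho> * (real (m + 1) * \<rho> ^ (m + 1))) \<longlonglongrightarrow> \<rho> * 0"
      by (intro tendsto_mult tendsto_const LIMSEQ_ignore_initial_segment[OF z])
    thus ?thesis by (simp add: mult_ac)
  qed
  have null: "(\<lambda>m. c m *\<^sub>R (C ^^ (k m)) v) \<longlonglongrightarrow> 0" if "c \<longlonglongrightarrow> 0" for c :: "nat \<Rightarrow> real" and k
  proof (rule Lim_null_comparison)
    show "\<forall>\<^sub>F m in sequentially. norm (c m *\<^sub>R (C ^^ (k m)) v) \<le> \<bar>c m\<bar> * (Mp * norm v)"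
      by (simp add: mult_left_mono power_bound)
    show "(\<lambda>m. \<bar>c m\<bar> * (Mp * norm v)) \<longlonglongrightarrow> 0"
      using tendsto_mult_left_zero[OF tendsto_rabs_zero[OF that]] by simp
  qed
  have "w \<longlonglongrightarrow> v - 0 + 0"
    unfolding w_def by (intro tendsto_intros null l1 l2)
  hence w: "w \<longlonglongrightarrow> v" by simp
  have "(\<lambda>m. t *\<^sub>R (w m - C (C (w m)))) \<longlonglongrightarrow> t *\<^sub>R (v - C (C v))"
    by (intro tendsto_intros C.tendsto w)
  moreover have "poly_op (trunc_poly t m) C x = t *\<^sub>R (w m - C (C (w m)))" for m
    using poly_op_trunc_poly[OF t w_def[unfolded \<rho>_def, of m]] unfolding v v1 .
  moreover have "v - C (C v) = Psi t x"
    using Psi_G[of t v] t unfolding v v1 by simp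
  ultimately show ?thesis by simp
qed

lemma signed_sum_bound:
  assumes \<sigma>: "\<sigma> \<ge> 1" and e: "\<And>k. \<epsilon> k = 1 \<or> \<epsilon> k = (-1::real)"
  shows "norm (dyadic_sum \<epsilon> \<sigma> n (\<lambda>t. Psi t x)) \<le> 8 * Mp * norm x"
proof (rule tendsto_upperbound)
  define \<tau> where "\<tau> k = 4 ^ k * \<sigma>\<^sup>2" for k :: nat
  have \<tau>1: "\<tau> k \<ge> 1" for k
    using mult_mono[of 1 "4 ^ k" 1 "\<sigma>\<^sup>2"] \<sigma> by (simp add: \<tau>_def one_le_power)
  let ?q = "\<lambda>m. \<Sum>k<n. smult (of_real (\<epsilon> k)) (trunc_poly (4 ^ k * \<sigma>\<^sup>2) m)"
  have "(\<lambda>m. norm (\<Sum>k<n. \<epsilon> k *\<^sub>R poly_op (trunc_poly (\<tau> k) m) C x)) \<longlonglongrightarrow>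
      norm (\<Sum>k<n. \<epsilon> k *\<^sub>R (\<tau> k *\<^sub>R Psi (\<tau> k) x))"
    by (intro tendsto_intros tendsto_trunc_poly \<tau>1)
  thus "(\<lambda>m. norm (poly_op (?q m) C x)) \<longlonglongrightarrow> norm (dyadic_sum \<epsilon> \<sigma> n (\<lambda>t. Psi t x))"
    by (simp add: poly_op_sum poly_op_smult \<tau>_def flip: scaleR_scaleC)
  \<comment> \<open>Only n values of t occur, so the smallness condition holds for all of them at
    once when m is large. The resulting bound does not depend on n, \<sigma> or the signs.\<close>
  have "\<forall>\<^sub>F m in sequentially. \<forall>k\<in>{..<n}. real (2 * m + 3) * ((\<tau> k - 1) / (\<tau> k + 1)) ^ (m + 1) \<le> 1"
  proof (intro eventually_ball_finite ballI)
    fix k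
    define \<rho> where "\<rho> = (\<tau> k - 1) / (\<tau> k + 1)"
    have \<rho>: "0 \<le> \<rho>" "\<rho> < 1" using \<tau>1[of k] by (auto simp: \<rho>_def)
    have z: "(\<lambda>m. real m * \<rho> ^ m) \<longlonglongrightarrow> 0" and p: "(\<lambda>m. \<rho> ^ m) \<longlonglongrightarrow> 0"
      using \<rho> by (auto intro!: powser_times_n_limit_0 LIMSEQ_power_zero)
    have "(\<lambda>m. 2 * (real (m + 1) * \<rho> ^ (m + 1)) + \<rho> ^ (m + 1)) \<longlonglongrightarrow> 2 * 0 + 0"
      by (intro tendsto_add tendsto_mult tendsto_const LIMSEQ_ignore_initial_segment z p)
    moreover have "2 * (real (m + 1) * \<rho> ^ (m + 1)) + \<rho> ^ (m + 1) = real (2 * m + 3) * \<rho> ^ (m + 1)" for m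
      by (simp add: algebra_simps)
    ultimately have "(\<lambda>m. real (2 * m + 3) * \<rho> ^ (m + 1)) \<longlonglongrightarrow> 0" by simp
    hence "\<forall>\<^sub>F m in sequentially. real (2 * m + 3) * \<rho> ^ (m + 1) < 1" by (rule order_tendstoD) simp
    thus "\<forall>\<^sub>F m in sequentially. real (2 * m + 3) * ((\<tau> k - 1) / (\<tau> k + 1)) ^ (m + 1) \<le> 1"
      unfolding \<rho>_def by (rule eventually_mono) simp
  qed simp
  thus "\<forall>\<^sub>F m in sequentially. norm (poly_op (?q m) C x) \<le> 8 * Mp * norm x"
  proof (rule eventually_mono)
    fix m assume m: "\<forall>k\<in>{..<n}. real (2 * m + 3) * ((\<tau> k - 1) / (\<tau> k + 1)) ^ (m + 1) \<le> 1"
    have e1: "\<bar>\<epsilon> k\<bar> \<le> 1" for k using e[of k] by auto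
    have "norm (poly_op (?q m) C x) \<le> Mp * 8 * norm x"
    proof (rule poly_op_bound, rule trunc_poly_sum_bound[OF _ \<sigma> e1])
      fix k assume "k < n"
      with m show "let t = 4 ^ k * \<sigma>\<^sup>2; \<rho> = (t - 1) / (t + 1) in real (2 * m + 3) * \<rho> ^ (m + 1) \<le> 1"
        by (simp add: Let_def \<tau>_def)
    qed
    thus "norm (poly_op (?q m) C x) \<le> 8 * Mp * norm x" by (simp add: mult_ac)
  qed
qed simp

text \<open>\<open>W t\<close> is similar to \<open>Psi t\<close> through A, so the signed sums keep
  their bound up to the factor \<open>\<alpha>\<close>.\<close>

lemma UQUA_eq: assumes t: "0 \<le> t" shows "W t v = U 0 (Psi t (A v))"
proof -
  have "A (W t v) = Psi t (A v)" unfolding Psi_def by (rule AUQ[OF t])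
  thus ?thesis using U_AQ[of 0 "W t v"] by simp
qed

lemma cinner_UQUA: "0 \<le> t \<Longrightarrow> cinner (W t v) w = cinner v (Ws t w)"
  by (simp add: cinner_U cinner_Q_swap cinner_A)

lemma signed_sum_UQUA:
  assumes \<sigma>: "\<sigma> \<ge> 1" and e: "\<And>k. \<epsilon> k = 1 \<or> \<epsilon> k = (-1::real)"
  shows "norm (dyadic_sum \<epsilon> \<sigma> n (\<lambda>t. W t v)) \<le> 8 * Mp * \<alpha> * norm v"
proof -
  interpret U0: bounded_linear "U 0" by (rule bounded_linear_U) simp
  have "(dyadic_sum \<epsilon> \<sigma> n (\<lambda>t. W t v)) =
     U 0 (dyadic_sum \<epsilon> \<sigma> n (\<lambda>t. Psi t (A v)))"
    by (simp only: U0.sum U0.scaleR) (simp add: UQUA_eq)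
  also have "norm \<dots> \<le> norm (dyadic_sum \<epsilon> \<sigma> n (\<lambda>t. Psi t (A v)))"
    by (rule norm_U1) simp
  also have "\<dots> \<le> 8 * Mp * norm (A v)" by (rule signed_sum_bound[OF \<sigma> e])
  also have "\<dots> \<le> 8 * Mp * (\<alpha> * norm v)" using Mp(1) by (intro mult_left_mono \<alpha>(2)) auto
  finally show ?thesis by simp
qed

lemma sum_squares_bound:
  assumes \<sigma>: "\<sigma> \<ge> 1"
    and bd: "\<And>\<epsilon>. (\<And>k. \<epsilon> k = 1 \<or> \<epsilon> k = (-1::real)) \<Longrightarrow> norm (dyadic_sum \<epsilon> \<sigma> n Y) \<le> B"
  shows "(\<Sum>k<n. ((2 ^ k * \<sigma>)\<^sup>2 * norm (Y ((2 ^ k * \<sigma>)\<^sup>2) :: 'v))\<^sup>2) \<le> B\<^sup>2"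
proof -
  have e: "(2 ^ k * \<sigma>)\<^sup>2 = 4 ^ k * \<sigma>\<^sup>2" for k :: nat
    by (simp add: power_mult_distrib power2_eq_square)
      (simp flip: power_mult_distrib)
  obtain \<epsilon> where ep: "\<And>k. \<epsilon> k = 1 \<or> \<epsilon> k = (-1::real)"
    and le: "(\<Sum>k<n. (norm ((4 ^ k * \<sigma>\<^sup>2) *\<^sub>R Y (4 ^ k * \<sigma>\<^sup>2)))\<^sup>2) \<le> (norm (dyadic_sum \<epsilon> \<sigma> n Y))\<^sup>2"
    using exists_signs[where n = n and x = "\<lambda>k. (4 ^ k * \<sigma>\<^sup>2) *\<^sub>R Y (4 ^ k * \<sigma>\<^sup>2)"] by blast
  have "(norm (dyadic_sum \<epsilon> \<sigma> n Y))\<^sup>2 \<le> B\<^sup>2"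
    by (intro power_mono bd ep) auto
  with le show ?thesis by (simp add: e)
qed

lemma norm_UQUA: assumes "0 \<le> t" shows "norm (W t v) \<le> \<alpha>\<^sup>2 * norm v"
proof -
  have "norm (W t v) \<le> norm (Q (U t (A v)))" by (rule norm_U1[OF assms])
  also have "\<dots> \<le> \<alpha> * norm (U t (A v))" by (rule \<alpha>(3))
  also have "\<dots> \<le> \<alpha> * norm (A v)" using \<alpha>(1) norm_U1[OF assms] by (intro mult_left_mono) auto
  also have "\<dots> \<le> \<alpha> * (\<alpha> * norm v)" using \<alpha>(1) \<alpha>(2) by (intro mult_left_mono) auto
  finally show ?thesis by (simp add: power2_eq_square)
qed

lemma norm_adjoint_UQUA: assumes "0 \<le> t" shows "norm (Ws t w) \<le> \<alpha>\<^sup>2 * norm w"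
proof (rule norm_le_by_cinner)
  fix v :: 'v assume v: "norm v \<le> 1"
  have "cmod (cinner (Ws t w) v) = cmod (cinner (W t v) w)"
    unfolding cinner_UQUA[OF assms] by (subst cinner_commute) simp
  also have "\<dots> \<le> norm (W t v) * norm w" by (rule cinner_Cauchy_Schwarz)
  also have "\<dots> \<le> (\<alpha>\<^sup>2 * 1) * norm w"
  proof (intro mult_right_mono)
    show "norm (W t v) \<le> \<alpha>\<^sup>2 * 1"
      by (rule order_trans[OF norm_UQUA[OF assms]]) (use v in \<open>simp add: mult_left_le\<close>)
  qed simp
  finally show "cmod (cinner (Ws t w) v) \<le> \<alpha>\<^sup>2 * norm w" by simp
qed simp

lemma square_function_bound:
  fixes Y :: "real \<Rightarrow> 'v"
  assumes c: "continuous_on {0..} (\<lambda>s. Y (s\<^sup>2))" and b: "\<And>t. 0 \<le> t \<Longrightarrow> norm (Y t) \<le> \<alpha>\<^sup>2 * r"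
    and bd: "\<And>\<epsilon> \<sigma> n. \<sigma> \<ge> 1 \<Longrightarrow> (\<And>k. \<epsilon> k = 1 \<or> \<epsilon> k = (-1::real)) \<Longrightarrow>
        norm (dyadic_sum \<epsilon> \<sigma> n Y) \<le> 8 * Mp * \<alpha> * r"
    and N: "0 \<le> N"
  shows "integral {0..N} (\<lambda>s. s ^ 3 * (norm (Y (s\<^sup>2)))\<^sup>2) \<le> ((\<alpha>\<^sup>2)\<^sup>2 + (8 * Mp * \<alpha>)\<^sup>2) * r\<^sup>2"
proof -
  have "integral {0..N} (\<lambda>s. s ^ 3 * (norm (Y (s\<^sup>2)))\<^sup>2) \<le> (\<alpha>\<^sup>2 * r)\<^sup>2 + (8 * Mp * \<alpha> * r)\<^sup>2"
  proof (rule dyadic_integral_bound[OF _ _ _ N])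
    show "continuous_on {0..} (\<lambda>s. norm (Y (s\<^sup>2)))" by (intro continuous_intros c)
    fix s :: real assume s: "0 \<le> s" "s \<le> 1"
    have "s ^ 3 * (norm (Y (s\<^sup>2)))\<^sup>2 \<le> 1 * (\<alpha>\<^sup>2 * r)\<^sup>2"
      using s b[of "s\<^sup>2"] by (intro mult_mono power_mono power_le_one) auto
    thus "s ^ 3 * (norm (Y (s\<^sup>2)))\<^sup>2 \<le> (\<alpha>\<^sup>2 * r)\<^sup>2" by simp
  next
    show "(\<Sum>k<n. ((2 ^ k * \<sigma>)\<^sup>2 * norm (Y ((2 ^ k * \<sigma>)\<^sup>2)))\<^sup>2) \<le> (8 * Mp * \<alpha> * r)\<^sup>2" if "1 \<le> \<sigma>" for \<sigma> n
      using that by (intro sum_squares_bound bd)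
  qed
  thus ?thesis by (simp add: power_mult_distrib algebra_simps)
qed

text \<open>Bounds valid for all choices of signs pass to adjoints, while a square function estimate
  by itself does not. Duality is therefore applied before the signs are chosen.\<close>

lemma signed_sum_adjoint:
  assumes \<sigma>: "\<sigma> \<ge> 1" and e: "\<And>k. \<epsilon> k = 1 \<or> \<epsilon> k = (-1::real)"
  shows "norm (dyadic_sum \<epsilon> \<sigma> n (\<lambda>t. Ws t w)) \<le> 8 * Mp * \<alpha> * norm w"
    (is "norm ?y \<le> _")
proof (rule norm_le_by_cinner)
  fix v :: 'v assume v: "norm v \<le> 1"
  let ?x = "dyadic_sum \<epsilon> \<sigma> n (\<lambda>t. W t v)"
  have "cinner v ?y = cinner ?x w"
    by (simp add: cinner.sum_left cinner.sum_right cinner.scaleR_left cinner.scaleR_right cinner_UQUA)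
  hence "cmod (cinner ?y v) = cmod (cinner ?x w)"
    unfolding cinner_commute[of ?y v] complex_mod_cnj by (rule arg_cong)
  also have "\<dots> \<le> norm ?x * norm w" by (rule cinner_Cauchy_Schwarz)
  also have "\<dots> \<le> (8 * Mp * \<alpha> * 1) * norm w"
  proof (rule mult_right_mono)
    have "norm ?x \<le> 8 * Mp * \<alpha> * norm v" by (rule signed_sum_UQUA[OF \<sigma> e])
    moreover have "8 * Mp * \<alpha> * norm v \<le> 8 * Mp * \<alpha> * 1"
      by (rule mult_left_mono[OF v]) (use Mp(1) \<alpha>(1) in simp)
    ultimately show "norm ?x \<le> 8 * Mp * \<alpha> * 1" by (rule order_trans)
  qed simp
  finally show "cmod (cinner ?y v) \<le> 8 * Mp * \<alpha> * norm w" by simp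
qed (use Mp(1) \<alpha>(1) in auto)

theorem range_inv_sqrt_of_polynomially_bounded: "range H.inv_sqrt = range j"
proof (rule range_inv_sqrt)
  show "integral {0..N} (\<lambda>s. s ^ 3 * (norm (W (s\<^sup>2) v))\<^sup>2) \<le> ((\<alpha>\<^sup>2)\<^sup>2 + (8 * Mp * \<alpha>)\<^sup>2) * (norm v)\<^sup>2"
    if "0 \<le> N" for v N
    by (rule square_function_bound[OF _ norm_UQUA signed_sum_UQUA that])
      (intro continuous_on_U_square Q.continuous_on continuous_intros, auto)
  show "integral {0..N} (\<lambda>s. s ^ 3 * (norm (Ws (s\<^sup>2) v))\<^sup>2) \<le> ((\<alpha>\<^sup>2)\<^sup>2 + (8 * Mp * \<alpha>)\<^sup>2) * (norm v)\<^sup>2"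
    if "0 \<le> N" for v N
    by (rule square_function_bound[OF _ norm_adjoint_UQUA signed_sum_adjoint that])
      (intro adj.A.continuous_on adj.continuous_on_U_square Q.continuous_on continuous_intros, auto)
qed

end

end

section \<open>The equivalences\<close>

text \<open>A form of the closed graph theorem: it suffices that the adjoint is densely defined.\<close>

lemma bounded_by_duality:
  fixes f :: "'a::banach \<Rightarrow> 'b::complex_inner" and d :: "'c::real_vector \<Rightarrow> 'b"
  assumes lin: "\<And>g. bounded_linear (\<lambda>x. cinner (f x) (d g))"
    and sc: "\<And>r g. d (r *\<^sub>R g) = r *\<^sub>R d g" and dense: "closure (range d) = UNIV"
  shows "\<exists>M. \<forall>x. norm (f x) \<le> M * norm x"
proof -
  have "\<exists>M. \<forall>g\<in>{g. norm (d g) \<le> 1}. \<forall>x. norm (cinner (f x) (d g)) \<le> M * norm x"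
  proof (rule uniform_boundedness[OF lin])
    fix x
    have "norm (cinner (f x) (d g)) \<le> norm (f x)" if "norm (d g) \<le> 1" for g
      using cinner_Cauchy_Schwarz[of "f x" "d g"] mult_left_mono[OF that, of "norm (f x)"] by simp
    thus "\<exists>c. \<forall>g\<in>{g. norm (d g) \<le> 1}. norm (cinner (f x) (d g)) \<le> c" by blast
  qed
  then obtain M where M: "\<And>g x. norm (d g) \<le> 1 \<Longrightarrow> norm (cinner (f x) (d g)) \<le> M * norm x" by blast
  have "norm (f x) \<le> M * norm x" for x
  proof -
    \<comment> \<open>By density the bound extends from the range of \<open>d\<close> to all w; then
      w = \<open>f x\<close> gives the norm.\<close>
    have "closed {w. cmod (cinner (f x) w) \<le> M * norm x * norm w}"
      by (intro closed_Collect_le continuous_intros cinner.continuous_on)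
    moreover have "range d \<subseteq> {w. cmod (cinner (f x) w) \<le> M * norm x * norm w}"
    proof clarify
      fix g
      show "cmod (cinner (f x) (d g)) \<le> M * norm x * norm (d g)"
      proof (cases "d g = 0")
        case False
        have "norm (cinner (f x) (d ((1 / norm (d g)) *\<^sub>R g))) \<le> M * norm x"
          by (rule M) (simp add: sc False)
        thus ?thesis using False by (simp add: sc cinner.scaleR_right field_simps)
      qed (simp add: cinner.zero_right)
    qed
    ultimately have "closure (range d) \<subseteq> {w. cmod (cinner (f x) w) \<le> M * norm x * norm w}"
      by (simp add: closure_minimal)
    hence "cmod (cinner (f x) (f x)) \<le> M * norm x * norm (f x)" using dense by auto
    hence le: "norm (f x) * norm (f x) \<le> M * norm x * norm (f x)"
      by (simp add: cinner_self norm_mult power2_eq_square)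
    show ?thesis
    proof (cases "f x = 0")
      case True
      show ?thesis using order_trans[OF norm_ge_zero M[of 0 x]] sc[of 0 0] True by simp
    next
      case False
      thus ?thesis using le by (simp only: mult_le_cancel_right) simp
    qed
  qed
  thus ?thesis by blast
qed

lemma sectorI:
  assumes "\<bar>Im z\<bar> \<le> \<tau> * Re z" "0 \<le> Re z" "0 \<le> \<tau>"
  shows "z \<in> sector (arctan \<tau>)"
proof (cases "Re z = 0")
  case True
  hence "z = 0" using assms by (simp add: complex_eq_iff)
  \<comment> \<open>\<open>Arg 0\<close> is 0 by convention, so the vertex belongs to the
    sector.\<close>
  thus ?thesis using assms by (simp add: sector_def Arg_def)
next
  case False
  hence pos: "Re z > 0" using assms by simp
  have "\<bar>Im z / Re z\<bar> \<le> \<tau>" using assms pos by (simp add: abs_divide pos_divide_le_eq)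
  hence "Im z / Re z \<le> \<tau>" "- \<tau> \<le> Im z / Re z" by linarith+
  hence "arctan (Im z / Re z) \<le> arctan \<tau>" "arctan (- \<tau>) \<le> arctan (Im z / Re z)"
    by (simp_all only: arctan_le_iff)
  thus ?thesis using pos by (simp add: sector_def arg_conv_arctan arctan_minus abs_le_iff)
qed

lemma sector_Re_nonneg:
  assumes "z \<in> sector \<theta>" "\<theta> < pi / 2" shows "0 \<le> Re z"
proof (cases "z = 0")
  case False
  have "\<bar>Arg z\<bar> \<le> pi / 2" using assms by (simp add: sector_def)
  hence "cos (Arg z) \<ge> 0" by (intro cos_ge_zero) auto
  moreover have "Re z = cmod z * cos (Arg z)"
    using False by (metis Arg_eq Re_rcis rcis_def cis_conv_exp mult.commute)
  ultimately show ?thesis by simp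
qed simp

text \<open>The branch cut forces the case distinction: on negative reals \<open>Arg\<close> is pi
  and does not change sign, but there \<open>cnj z = z\<close>.\<close>

lemma cnj_in_sector_iff: "cnj z \<in> sector \<theta> \<longleftrightarrow> z \<in> sector \<theta>"
  by (cases "z \<in> \<real>") (auto simp: sector_def Arg_cnj Reals_cnj_iff)

context form_pair
begin

section \<open>The operator of the form, its resolvent and its inverse square root\<close>

context
  fixes a :: "'v \<Rightarrow> 'v \<Rightarrow> complex"
  assumes a: "\<And>u v. a u v = cinner (A u) v"
begin

lemma form_eq_iff: "(\<forall>v. a u v = cinner f (j v)) \<longleftrightarrow> A u = js f"
proof
  assume "\<forall>v. a u v = cinner f (j v)"
  thus "A u = js f" by (intro cinner_ext_left) (simp add: a adj')
qed (simp add: a adj')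

lemma formop_dom_iff: "h \<in> formop_dom a j \<longleftrightarrow> (\<exists>u f. h = j u \<and> A u = js f)"
  by (simp add: formop_dom_def form_eq_iff)

lemma formop_eq: assumes "A u = js f" shows "formop a j (j u) = f"
proof -
  have "inv j (j u) = u" by (rule inv_f_f[OF inj])
  thus ?thesis
    unfolding formop_def form_eq_iff using assms by (intro the_equality) (auto intro: js_inject)
qed

lemma formop_resolvent_eq:
  assumes t: "0 \<le> t" shows "formop_resolvent a j t f = j (U t (js f))"
  unfolding formop_resolvent_def
proof (rule the_equality)
  let ?u = "U t (js f)"
  have "A ?u = js (f - t *\<^sub>R j ?u)"
    using A_U[OF t, of "js f"] by (simp add: js.diff js.scaleR Q_def)
  thus "j ?u \<in> formop_dom a j \<and> t *\<^sub>R j ?u + formop a j (j ?u) = f"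
    by (auto simp: formop_dom_iff formop_eq)
next
  fix h assume h: "h \<in> formop_dom a j \<and> t *\<^sub>R h + formop a j h = f"
  then obtain u g where ug: "h = j u" "A u = js g" by (auto simp: formop_dom_iff)
  with h have "f = t *\<^sub>R j u + g" by (simp add: formop_eq)
  hence "js f = A u + t *\<^sub>R Q u" using ug by (simp add: js.add js.scaleR Q_def)
  thus "h = j (U t (js f))" using ug U_AQ[OF t, of u] by simp
qed

lemma formop_inv_sqrt_eq: "formop_inv_sqrt a j f = H.inv_sqrt f"
proof -
  have "integral {0<..} (\<lambda>t. t powr (-1/2) *\<^sub>R formop_resolvent a j t f) =
      integral {0<..} (\<lambda>t. t powr (-1/2) *\<^sub>R Rh t f)"
    by (rule Henstock_Kurzweil_Integration.integral_cong) (simp add: formop_resolvent_eq Rh_apply)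
  also have "\<dots> = pi *\<^sub>R H.inv_sqrt f" by (rule integral_unique[OF H.has_integral_inv_sqrt])
  finally show ?thesis by (simp add: formop_inv_sqrt_def)
qed

lemma kato_property_iff: "kato_property a j \<longleftrightarrow> range H.inv_sqrt = range j"
  by (simp add: kato_property_def formop_sqrt_dom_def formop_inv_sqrt_eq[abs_def])

end

lemma U_0_A: "U 0 (A u) = u" and A_U_0: "A (U 0 x) = x"
  using U_AQ[of 0 u] AQ_U[of 0 x] by simp_all

text \<open>Under the Kato property, \<open>R = j\<^sup>-\<^sup>1 L\<^sup>-\<^sup>1\<^sup>/\<^sup>2\<close> is an isomorphism intertwining \<open>L\<^sup>-\<^sup>1\<close> and \<open>A\<^sup>-\<^sup>1 Q\<close>, and
  \<open>L\<^sup>-\<^sup>1\<close> is sectorial on \<open>'h\<close>.\<close>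

lemma kato_imp_similar_sectorial:
  assumes range: "range H.inv_sqrt = range j"
  shows "\<exists>S \<theta>. positive_op S \<and> \<theta> < pi / 2 \<and> (\<forall>u. cinner (S (Q (U 0 u))) u \<in> sector \<theta>)"
proof -
  let ?D = "blinfun_apply H.inv_sqrt"
  define R where "R f = inv j (?D f)" for f
  have jR: "j (R f) = ?D f" for f
    unfolding R_def by (rule f_inv_into_f) (use range in blast)
  have j_inject: "u = v" if "j u = j v" for u v using injD[OF inj that] .
  have R_add: "R (x + y) = R x + R y" for x y
    by (rule j_inject) (simp add: jR j.add blinfun.add_right)
  have R_scaleC: "R (z *\<^sub>C x) = z *\<^sub>C R x" for z x
    by (rule j_inject) (simp add: jR cbounded_linear_scaleC[OF j] cbounded_linear_scaleC[OF cbounded_inv_sqrt])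
  \<comment> \<open>Only the ranges are known to agree. Boundedness of \<open>R\<close> is recovered
    by testing against \<open>js g\<close>, which replaces \<open>R f\<close> by
    \<open>j (R f)\<close>, that is by the bounded \<open>?D f\<close>.\<close>
  have "\<exists>M. \<forall>f. norm (R f) \<le> M * norm f"
  proof (rule bounded_by_duality[where d = js])
    show "bounded_linear (\<lambda>f. cinner (R f) (js g))" for g
      unfolding adj[symmetric] jR
      by (rule bounded_linear_compose[OF cinner.bounded_linear_left blinfun.bounded_linear_right])
    show "closure (range js) = UNIV"
    proof (rule dense_range[OF jsb])
      fix y assume "\<And>w. cinner (js w) y = 0"
      hence "cinner (j y) (j y) = 0" by (simp add: adj')
      thus "y = 0" by (intro j_eq_0) (simp add: cinner_eq_zero_iff)
    qed
  qed (rule js.scaleR)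
  then obtain M where M: "\<And>f. norm (R f) \<le> M * norm f" by blast
  have R: "cbounded_linear R"
    using R_add R_scaleC M by (intro cbounded_linearI[of R M]) (auto simp: mult.commute)
  interpret R: bounded_linear R by (rule cbounded_linear_bounded_linear[OF R])
  have R_0: "f = 0" if "R f = 0" for f
  proof -
    have "?D f = 0" using that jR[of f] by (simp add: j.zero)
    hence "j (U 0 (js f)) = 0" using inv_sqrt_twice[of f] by simp
    hence "U 0 (js f) = 0" by (rule j_eq_0)
    hence "js f = 0" using A_U_0[of "js f"] by (simp add: A.zero)
    thus ?thesis by (rule js_eq_0)
  qed
  have "bij R"
  proof (rule bijI)
    show "inj R"
    proof (rule injI)
      fix x y assume "R x = R y"
      hence "R (x - y) = 0" by (simp add: R.diff)
      from R_0[OF this] show "x = y" by simp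
    qed
    show "surj R"
    proof (rule surjI)
      fix v
      have "j v \<in> range ?D" using range by blast
      then obtain f where "j v = ?D f" by blast
      hence "R f = v" by (intro j_inject) (simp add: jR)
      thus "R (SOME f. R f = v) = v" by (rule someI)
    qed
  qed
  then have RRi: "R (inv R v) = v" and RiR: "inv R (R f) = f" for v f
    by (simp_all add: bij_is_surj surj_f_inv_f bij_is_inj)
  obtain Rs where Rs: "cbounded_linear Rs" "\<And>f v. cinner (R f) v = cinner f (Rs v)"
    using adjoint_exists[OF R] by blast
  \<comment> \<open>The same test for the inverse, on the dense range of the adjoint of
    \<open>R\<close>.\<close>
  have "\<exists>M. \<forall>v. norm (inv R v) \<le> M * norm v"
  proof (rule bounded_by_duality[where d = Rs])
    show "bounded_linear (\<lambda>v. cinner (inv R v) (Rs z))" for z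
      unfolding Rs(2)[symmetric] RRi by (rule cinner.bounded_linear_left)
    show "Rs (r *\<^sub>R z) = r *\<^sub>R Rs z" for r z
      by (simp add: linear_simps(5)[OF cbounded_linear_bounded_linear[OF Rs(1)]])
    show "closure (range Rs) = UNIV"
    proof (rule dense_range[OF Rs(1)])
      fix y assume y: "\<And>w. cinner (Rs w) y = 0"
      have "cinner (R y) (R y) = cnj (cinner (Rs (R y)) y)"
        using Rs(2)[of y "R y"] cinner_commute[of y "Rs (R y)"] by simp
      hence "R y = 0" by (simp add: y cinner_eq_zero_iff)
      thus "y = 0" by (rule R_0)
    qed
  qed
  then obtain M' where M': "\<And>v. norm (inv R v) \<le> M' * norm v" by blast
  define B where "B f = A (R f)" for f
  define Bi where "Bi v = inv R (U 0 v)" for v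
  have Bc: "cbounded_linear B" unfolding B_def[abs_def] by (rule cbounded_linear_compose[OF A_bounded R])
  have iR: "cbounded_linear (inv R)"
  proof (rule cbounded_linear_inv[OF R \<open>bij R\<close>])
    show "norm x \<le> M' * norm (R x)" for x using M'[of "R x"] by (simp add: RiR)
  qed
  have Bic: "cbounded_linear Bi" unfolding Bi_def[abs_def]
    by (rule cbounded_linear_compose[OF iR cbounded_U]) simp
  have BBi: "B (Bi v) = v" and BiB: "Bi (B f) = f" for v f
    by (simp_all add: B_def Bi_def RRi RiR U_0_A A_U_0)
  obtain Bs where Bs: "cbounded_linear Bs" "\<And>v f. cinner (Bi v) f = cinner v (Bs f)"
    using adjoint_exists[OF Bic] by blast
  \<comment> \<open>The inner product that makes \<open>B\<close> an isometry from \<open>'h\<close>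
    onto V; for it X turns into the square of \<open>?D\<close>, the inverse of the form
    operator.\<close>
  define S where "S v = Bs (Bi v)" for v
  have S: "cinner (S u) v = cinner (Bi u) (Bi v)" for u v
    unfolding S_def using Bs(2)[of v "Bi u"] by (metis cinner_commute)
  have "positive_op S"
    unfolding positive_op_def selfadjoint_op_def
  proof (intro conjI allI)
    show "cbounded_linear S" unfolding S_def[abs_def] by (rule cbounded_linear_compose[OF Bs(1) Bic])
    show "cinner (S u) v = cinner u (S v)" for u v
      using S[of u v] S[of v u] by (metis cinner_commute)
    obtain K where K: "K > 0" "\<And>f. norm (B f) \<le> K * norm f" using cbounded_linear_pos_bound[OF Bc] by blast
    show "\<exists>c>0. \<forall>u. c * (norm u)\<^sup>2 \<le> Re (cinner (S u) u)"
    proof (intro exI[of _ "1 / K\<^sup>2"] conjI allI)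
      fix u
      have "norm u \<le> K * norm (Bi u)" using K(2)[of "Bi u"] by (simp add: BBi)
      hence "(norm u)\<^sup>2 \<le> K\<^sup>2 * (norm (Bi u))\<^sup>2" by (metis norm_ge_zero power_mono power_mult_distrib)
      thus "1 / K\<^sup>2 * (norm u)\<^sup>2 \<le> Re (cinner (S u) u)"
        using K(1) by (simp add: S cinner_self_Re field_simps)
    qed (use K(1) in simp)
  qed
  moreover obtain \<tau> where \<tau>: "\<tau> > 0" "\<And>x. norm (T x) \<le> \<tau> * norm x"
    using cbounded_linear_pos_bound[OF T_bounded] by blast
  have "cinner (S (Q (U 0 u))) u \<in> sector (arctan \<tau>)" for u
  proof -
    define f where "f = Bi u"
    have u: "u = B f" by (simp add: f_def BBi)
    have "Q (U 0 u) = B (?D (?D f))"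
    proof -
      have "j (U 0 (Q (R f))) = ?D (?D (?D f))" by (simp add: Q_def inv_sqrt_twice[symmetric] jR)
      also have "\<dots> = j (R (?D (?D f)))" by (simp add: jR)
      finally have "U 0 (Q (R f)) = R (?D (?D f))" by (rule j_inject)
      hence "Q (R f) = A (R (?D (?D f)))" by (metis A_U_0)
      thus ?thesis by (simp add: u B_def U_0_A)
    qed
    hence "cinner (S (Q (U 0 u))) u = cinner (?D (?D f)) f"
      by (simp add: S BiB f_def)
    also have "\<dots> = cinner (U 0 (js f)) (js f)" by (simp add: inv_sqrt_twice adj)
    \<comment> \<open>The conjugate of the form at \<open>U 0 (js f)\<close>: its real part is the
      squared norm and its imaginary part at most \<open>\<tau>\<close> times that, whence the angle
      \<open>arctan \<tau>\<close>.\<close>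
    also have "\<dots> = cinner (U 0 (js f)) (A (U 0 (js f)))" by (simp add: A_U_0)
    finally have e: "cinner (S (Q (U 0 u))) u = cinner (U 0 (js f)) (A (U 0 (js f)))" .
    define w where "w = U 0 (js f)"
    have e': "cinner w (A w) = complex_of_real ((norm w)\<^sup>2) - \<i> * cinner w (T w)"
      by (simp add: A_def cinner.add_right cinner_scaleC_right cinner_self)
    have re: "Im (cinner w (T w)) = 0" using T_real[of w] by (simp add: T_sym)
    have "\<bar>Re (cinner w (T w))\<bar> \<le> \<tau> * (norm w)\<^sup>2"
    proof -
      have "\<bar>Re (cinner w (T w))\<bar> \<le> norm w * norm (T w)" by (rule Re_cinner_le)
      also have "\<dots> \<le> norm w * (\<tau> * norm w)" by (intro mult_left_mono \<tau>) auto
      finally show ?thesis by (simp add: power2_eq_square mult_ac)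
    qed
    thus ?thesis unfolding e w_def[symmetric] e' using \<tau>(1) re by (intro sectorI) auto
  qed
  ultimately show ?thesis using arctan_ubound by blast
qed

section \<open>Adjoints, similarity and contractivity of the Cayley transform\<close>

lemma cinner_Q_S_A:
  assumes "positive_op S"
  shows "cinner (Q (S (A u))) u = cnj (cinner (S (Q (U 0 (A u)))) (A u))"
proof -
  have sa: "cinner (S x) y = cinner x (S y)" for x y
    using assms by (simp add: positive_op_def selfadjoint_op_def)
  have "cinner (Q (S (A u))) u = cinner (A u) (S (Q (U 0 (A u))))"
    by (simp add: cinner_Q_swap sa U_0_A)
  thus ?thesis by (metis cinner_commute)
qed

lemma sector_QSA_iff:
  assumes "positive_op S"
  shows "(\<forall>u. cinner (Q (S (A u))) u \<in> sector \<theta>) \<longleftrightarrow> (\<forall>u. cinner (S (Q (U 0 u))) u \<in> sector \<theta>)"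
  unfolding cinner_Q_S_A[OF assms] cnj_in_sector_iff by (metis A_U_0)

lemma sector_adjoint_iff:
  assumes S: "positive_op S"
  shows "(\<forall>u. cinner (S (adj.U 0 (Q u))) u \<in> sector \<theta>) \<longleftrightarrow>
    (\<forall>u. cinner (inv S (Q (U 0 u))) u \<in> sector \<theta>)"
proof -
  note inv = positive_op_inverse[OF S]
  have sa: "cinner (S x) y = cinner x (S y)" and sai: "cinner (inv S x) y = cinner x (inv S y)" for x y
    using S inv(1) by (simp_all add: positive_op_def selfadjoint_op_def)
  have "cinner (inv S (Q (U 0 (S w)))) (S w) = cnj (cinner (S (adj.U 0 (Q w))) w)" for w
  proof -
    have "cinner (inv S (Q (U 0 (S w)))) (S w) = cinner (Q (U 0 (S w))) w"
      by (simp only: sai inv(3))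
    also have "\<dots> = cinner (S w) (adj.U 0 (Q w))" by (simp add: cinner_Q_swap cinner_U)
    also have "\<dots> = cnj (cinner (S (adj.U 0 (Q w))) w)" by (metis cinner_commute sa)
    finally show ?thesis .
  qed
  hence eq: "cinner (inv S (Q (U 0 (S w)))) (S w) \<in> sector \<theta> \<longleftrightarrow> cinner (S (adj.U 0 (Q w))) w \<in> sector \<theta>" for w
    by (simp only: cnj_in_sector_iff)
  show ?thesis using eq inv(2) by metis
qed

text \<open>For y = A u + Q u one has C y = A u - Q u, and the squared norms of y and C y given by S
  differ by 4 times the real part of \<open>cinner (S (A u)) (Q u)\<close>, nonnegative by
  assumption. \<open>D\<close> carries this norm to the original one.\<close>

lemma contraction_of_accretive:
  assumes S: "positive_op S" and acc: "\<And>u. Re (cinner (Q (S (A u))) u) \<ge> 0"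
  shows "similar_to_contraction C"
proof -
  obtain D D' :: "'v \<Rightarrow> 'v" where D: "cbounded_linear D" "cbounded_linear D'" "\<And>x. D (D' x) = x" "\<And>x. D' (D x) = x"
    and nD: "\<And>x. (norm (D x))\<^sup>2 = Re (cinner (S x) x)"
    using positive_op_sqrt[OF S] by blast
  have sa: "cinner (S x) y = cinner x (S y)" for x y
    using S by (simp add: positive_op_def selfadjoint_op_def)
  interpret S: bounded_linear S
    using S by (intro cbounded_linear_bounded_linear) (simp add: positive_op_def selfadjoint_op_def)
  have "norm (D (C y)) \<le> norm (D y)" for y
  proof -
    define u where "u = U 1 y"
    have y: "y = A u + Q u" using AQ_U[of 1 y] by (simp add: u_def)
    have Cy: "C y = A u - Q u" by (simp add: C_def u_def)
    have sw: "Re (cinner (S (Q u)) (A u)) = Re (cinner (S (A u)) (Q u))"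
      by (simp add: sa[of "Q u"] Re_cinner_commute[of "Q u"])
    have "Re (cinner (S (A u)) (Q u)) \<ge> 0" using acc[of u] by (simp add: cinner_Q_swap)
    hence "(norm (D (C y)))\<^sup>2 \<le> (norm (D y))\<^sup>2"
      unfolding nD unfolding Cy unfolding y using sw
      by (simp add: S.add S.diff cinner.add_left cinner.add_right cinner.diff_left cinner.diff_right)
    thus ?thesis by (rule power2_le_imp_le) simp
  qed
  hence "norm (D (C (D' x))) \<le> norm x" for x using D(3) by metis
  with D show ?thesis unfolding similar_to_contraction_def by blast
qed

end

lemma similar_to_contraction_imp_polynomially_bounded:
  fixes C :: "'a::chilbert_space \<Rightarrow> 'a"
  assumes C: "cbounded_linear C" and sim: "similar_to_contraction C"
  shows "polynomially_bounded C"
proof -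
  obtain S R :: "'a \<Rightarrow> 'a" where S: "cbounded_linear S" and R: "cbounded_linear R"
    and RS: "\<And>x. R (S x) = x" and con: "\<And>x. norm (S (C (R x))) \<le> norm x"
    using sim by (auto simp: similar_to_contraction_def)
  interpret S: bounded_linear S by (rule cbounded_linear_bounded_linear[OF S])
  let ?G = "\<lambda>x. S (C (R x))"
  have G: "cbounded_linear ?G"
    by (intro cbounded_linear_compose[OF S] cbounded_linear_compose[OF C] R)
  have pw: "(?G ^^ i) (S x) = S ((C ^^ i) x)" for i x
    by (induction i) (simp_all add: RS)
  have poly: "poly_op p ?G (S x) = S (poly_op p C x)" for p x
    by (simp add: poly_op_def pw S.sum cbounded_linear_scaleC[OF S])
  obtain KS where KS: "KS > 0" "\<And>x. norm (S x) \<le> KS * norm x" using cbounded_linear_pos_bound[OF S] by blast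
  obtain KR where KR: "KR > 0" "\<And>x. norm (R x) \<le> KR * norm x" using cbounded_linear_pos_bound[OF R] by blast
  show ?thesis
    unfolding polynomially_bounded_def
  proof (intro exI[of _ "KR * KS"] conjI allI)
    fix p x
    let ?s = "SUP z\<in>cball 0 1. cmod (poly p z)"
    have s0: "?s \<ge> 0" using order_trans[OF norm_ge_zero poly_le_SUP_disc[of 0 p]] by simp
    have "norm (poly_op p C x) = norm (R (poly_op p ?G (S x)))" by (simp add: poly RS)
    also have "\<dots> \<le> KR * norm (poly_op p ?G (S x))" by (rule KR)
    also have "\<dots> \<le> KR * (?s * norm (S x))"
      using KR(1) by (intro mult_left_mono von_Neumann_inequality[OF G con]) auto
    also have "\<dots> \<le> KR * (?s * (KS * norm x))"
      using KR(1) KS s0 by (intro mult_left_mono) auto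
    finally show "norm (poly_op p C x) \<le> KR * KS * ?s * norm x" by (simp add: mult_ac)
  qed (use KS KR in auto)
qed

theorem theorem2p1:
  fixes a :: "'v::chilbert_space \<Rightarrow> 'v \<Rightarrow> complex"
    and j :: "'v \<Rightarrow> 'h::chilbert_space"
    and T Q :: "'v \<Rightarrow> 'v"
  assumes sesq: "sesquilinear a"
    and bdd: "bounded_form a"
    and coer: "coercive_form a"
    and sect: "sectorial_form a"
    and re_inner: "\<forall>u v. form_re a u v = cinner u v"
    and emb: "dense_embedding j"
    and T_sa: "selfadjoint_op T"
    and T_def: "\<forall>u v. form_im a u v = cinner (T u) v"
    and Q_sa: "selfadjoint_op Q"
    and Q_def: "\<forall>u v. cinner (j u) (j v) = cinner (Q u) v"
  defines "C \<equiv> (\<lambda>u. u - Q u + \<i> *\<^sub>C T u) \<circ> inv (\<lambda>u. u + Q u + \<i> *\<^sub>C T u)"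
  shows
    "(kato_property a j \<longleftrightarrow>
        (\<exists>S \<theta>. positive_op S \<and> \<theta> < pi / 2 \<and>
           (\<forall>u. cinner (Q (S (u + \<i> *\<^sub>C T u))) u \<in> sector \<theta>)))
   \<and> (kato_property a j \<longleftrightarrow>
        (\<exists>S. positive_op S \<and> (\<forall>u. Re (cinner (Q (S (u + \<i> *\<^sub>C T u))) u) \<ge> 0)))
   \<and> (kato_property a j \<longleftrightarrow>
        (\<exists>S \<theta>. positive_op S \<and> \<theta> < pi / 2 \<and>
           (\<forall>u. cinner (S (inv (\<lambda>w. w - \<i> *\<^sub>C T w) (Q u))) u \<in> sector \<theta>)))
   \<and> (kato_property a j \<longleftrightarrow>
        (\<exists>S \<theta>. positive_op S \<and> \<theta> < pi / 2 \<and>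
           (\<forall>u. cinner (S (Q (inv (\<lambda>w. w + \<i> *\<^sub>C T w) u))) u \<in> sector \<theta>)))
   \<and> (kato_property a j \<longleftrightarrow> polynomially_bounded C)
   \<and> (kato_property a j \<longleftrightarrow> similar_to_contraction C)"
    (is "(?i \<longleftrightarrow> ?ii) \<and> (?i \<longleftrightarrow> ?ii') \<and> (?i \<longleftrightarrow> ?iii) \<and> (?i \<longleftrightarrow> ?iv) \<and> (?i \<longleftrightarrow> ?v) \<and> (?i \<longleftrightarrow> ?vi)")
proof -
  have jb: "cbounded_linear j" and inj: "inj j" and dense: "closure (range j) = UNIV"
    using emb by (auto simp: dense_embedding_def)
  obtain js where js: "cbounded_linear js" "\<And>u f. cinner (j u) f = cinner u (js f)"
    using adjoint_exists[OF jb] by blast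
  interpret F: form_pair T j js
    by unfold_locales (use T_sa jb js inj dense in auto)
  have FQ: "F.Q = Q"
  proof
    show "F.Q u = Q u" for u
      by (rule cinner_ext_left) (simp add: F.cinner_Q Q_def)
  qed
  have FA: "F.A = (\<lambda>u. u + \<i> *\<^sub>C T u)" and FAs: "F.As = (\<lambda>u. u - \<i> *\<^sub>C T u)"
    by (simp_all add: F.A_def F.As_def fun_eq_iff)
  have U0: "F.U 0 = inv (\<lambda>w. w + \<i> *\<^sub>C T w)" and aU0: "F.adj.U 0 = inv (\<lambda>w. w - \<i> *\<^sub>C T w)"
    unfolding F.U_def F.adj.U_def unfolding FA FAs by simp_all
  have FC: "F.C = C"
  proof -
    have U1: "F.U 1 = inv (\<lambda>u. u + Q u + \<i> *\<^sub>C T u)"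
      unfolding F.U_def unfolding FA FQ by (simp add: add_ac)
    show ?thesis
    proof
      show "F.C x = C x" for x
        unfolding F.C_def U1 unfolding FA FQ C_def by simp
    qed
  qed
  have a: "a u v = cinner (F.A u) v" for u v
  proof -
    have "a u v = form_re a u v + \<i> * form_im a u v"
      by (simp add: form_re_def form_im_def field_simps)
    thus ?thesis by (simp add: re_inner T_def FA cinner.add_left cinner_scaleC_left)
  qed
  note kato = F.kato_property_iff[OF a]
  have i_iv: "?i \<Longrightarrow> ?iv"
    using F.kato_imp_similar_sectorial unfolding kato FQ U0 .
  have iv_ii: "?iv \<longleftrightarrow> ?ii"
    using F.sector_QSA_iff unfolding FQ U0 unfolding FA by meson
  have iii_iv: "?iii \<Longrightarrow> ?iv" and iv_iii: "?iv \<Longrightarrow> ?iii"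
  proof -
    note eq = F.sector_adjoint_iff[unfolded FQ U0 aU0]
    show "?iii \<Longrightarrow> ?iv" using eq positive_op_inverse(1) by meson
    assume ?iv
    then obtain S \<theta> where S: "positive_op S" "\<theta> < pi / 2"
      "\<forall>u. cinner (S (Q (inv (\<lambda>w. w + \<i> *\<^sub>C T w) u))) u \<in> sector \<theta>" by blast
    \<comment> \<open>\<open>sector_adjoint_iff\<close> is applied to \<open>inv S\<close>, so its
      right-hand side speaks of the double inverse.\<close>
    have "inv (inv S) = S"
      using positive_op_inverse[OF S(1)] by (intro inv_inv_eq) (metis bijI' )
    with eq[OF positive_op_inverse(1)[OF S(1)], of \<theta>] S positive_op_inverse(1)[OF S(1)] show ?iii by auto
  qed
  have ii_ii': "?ii \<Longrightarrow> ?ii'" using sector_Re_nonneg by meson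
  have ii'_vi: "?ii' \<Longrightarrow> ?vi"
    using F.contraction_of_accretive unfolding FQ FA FC by blast
  have vi_v: "?vi \<Longrightarrow> ?v"
    using similar_to_contraction_imp_polynomially_bounded F.C_bounded unfolding FC by blast
  have v_i: "?v \<Longrightarrow> ?i"
    unfolding kato polynomially_bounded_def
    using F.range_inv_sqrt_of_polynomially_bounded unfolding FC by blast
  \<comment> \<open>The cycle runs through (i), (iv), (ii), (ii'), (vi), (v) and back to (i), with
    (iii) tied to (iv).\<close>
  show ?thesis
    using i_iv iv_ii iii_iv iv_iii ii_ii' ii'_vi vi_v v_i by argo
qed

end
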